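(* For every integer $d\ge 1$ there exist constants $\epsilon_d^*>0$ and $c_d>0$, depending only on $d$, such that for every real $q>1$ and every integer $n\ge 1$, \[ \sup_{P\in\mathcal{P}_d:\ \mathbb{E}_P[\|X\|^q]\le 1,\ \epsilon_P\ge\epsilon_d^*}\mathbb{E}\left[d_{\mathrm H}^2\bigl(\psi^*(\widehat{P}_n),\psi^*(P)\bigr)\right]\ge c_d\cdot n^{-\min\left\{\frac{2}{d+1},\,\frac12-\frac1{2q}\right\}}, \] where, for each $P$, $\widehat{P}_n$ denotes the empirical distribution of $X_1,\dots,X_n$ drawn i.i.d. from $P$.
   Context: $\mathcal{P}_d$ is the set of probability distributions $P$ on $\mathbb{R}^d$ with $\mathbb{E}_P[\|X\|]<\infty$ and $\mathbb{P}_P\{X\in H\}<1$ for every (affine) hyperplane $H\subseteq\mathbb{R}^d$; here $\|\cdot\|$ is the Euclidean norm and the subscript $P$ means $X\sim P$. $\mathcal{F}_d$ is the set of upper semi-continuous log-concave probability densities (with respect to Lebesgue measure) on $\mathbb{R}^d$. The log-concave projection $\psi^*:\mathcal{P}_d\to\mathcal{F}_d$ is $\psi^*(P)=\operatorname{argmax}_{f\in\mathcal{F}_d}\mathbb{E}_P[\log f(X)]$; it is known that for $P\in\mathcal{P}_d$ the maximizer exists and is unique. For $P$ with $\mathbb{E}_P[\|X\|]<\infty$, $\mu_P=\mathbb{E}_P[X]$ and $\epsilon_P=\inf_{u\in\mathbb{R}^d,\|u\|=1}\mathbb{E}_P\bigl[|u^\top(X-\mu_P)|\bigr]$. For densities $f,g$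 on $\mathbb{R}^d$, $d_{\mathrm H}^2(f,g)=\int_{\mathbb{R}^d}(\sqrt{f(x)}-\sqrt{g(x)})^2\,dx$ (squared Hellinger distance). Convention: if $\widehat{P}_n\notin\mathcal{P}_d$ (i.e. the sample lies in a hyperplane), so that $\psi^*(\widehat{P}_n)$ is undefined, then $d_{\mathrm H}^2(\psi^*(\widehat{P}_n),\psi^*(P))$ is interpreted as the maximal possible value $2$. *)

theory Defs
  imports "HOL-Probability.Probability"
begin

definition moment_nondegenerate :: "(real ^ 'd) measure set" where
  "moment_nondegenerate = {P. prob_space P \<and> sets P = sets borel \<and>
     (\<integral>\<^sup>+ x. ennreal (norm x) \<partial>P) < \<infinity> \<and>
     (\<forall>a b. a \<noteq> 0 \<longrightarrow> measure P {x. a \<bullet> x = b} < 1)}"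

definition upper_semicontinuous :: "('a::topological_space \<Rightarrow> real) \<Rightarrow> bool" where
  "upper_semicontinuous f \<longleftrightarrow> (\<forall>a. open {x. f x < a})"

(* Concavity of log f as a function into [-\<infinity>, \<infinity>): log f is concave on the set where it is
   finite, and concave_on includes the convexity of that set. *)
definition log_concave :: "('a::real_vector \<Rightarrow> real) \<Rightarrow> bool" where
  "log_concave f \<longleftrightarrow> (\<forall>x. 0 \<le> f x) \<and> concave_on {x. 0 < f x} (\<lambda>x. ln (f x))"

definition log_concave_densities :: "(real ^ 'd \<Rightarrow> real) set" where
  "log_concave_densities = {f. upper_semicontinuous f \<and> log_concave f \<and>
     (\<integral>\<^sup>+ x. ennreal (f x) \<partial>lborel) = 1}"

(* ln 0 = 0 in HOL, whereas a density vanishing at a point has log-density -\<infinity> there. *)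
definition log_ext :: "real \<Rightarrow> ereal" where
  "log_ext t = (if 0 < t then ereal (ln t) else - \<infinity>)"

(* E_P[log f(X)] as an extended real, positive part minus negative part. A log-concave density
   is bounded, so the positive part is finite for every probability distribution P. *)
definition expected_log :: "(real ^ 'd) measure \<Rightarrow> (real ^ 'd \<Rightarrow> real) \<Rightarrow> ereal" where
  "expected_log P f =
     enn2ereal (\<integral>\<^sup>+ x. e2ennreal (log_ext (f x)) \<partial>P) -
     enn2ereal (\<integral>\<^sup>+ x. e2ennreal (- log_ext (f x)) \<partial>P)"

(* arg_max_on picks some maximiser; it is the unique one for P in moment_nondegenerate,
   and unspecified if there is none. *)
definition log_concave_projection :: "(real ^ 'd) measure \<Rightarrow> (real ^ 'd \<Rightarrow> real)" where
  "log_concave_projection P = arg_max_on (expected_log P) log_concave_densities"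

definition mean :: "(real ^ 'd) measure \<Rightarrow> real ^ 'd" where
  "mean P = (\<integral>x. x \<partial>P)"

definition min_abs_deviation :: "(real ^ 'd) measure \<Rightarrow> real" where
  "min_abs_deviation P = (INF u \<in> {u. norm u = 1}. (\<integral>x. \<bar>u \<bullet> (x - mean P)\<bar> \<partial>P))"

definition hellinger_sq :: "(real ^ 'd \<Rightarrow> real) \<Rightarrow> (real ^ 'd \<Rightarrow> real) \<Rightarrow> ennreal" where
  "hellinger_sq f g = (\<integral>\<^sup>+ x. ennreal ((sqrt (f x) - sqrt (g x))\<^sup>2) \<partial>lborel)"

definition empirical :: "nat \<Rightarrow> (nat \<Rightarrow> real ^ 'd) \<Rightarrow> (real ^ 'd) measure" where
  "empirical n X = distr (uniform_count_measure {..<n}) borel X"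

definition projection_loss :: "(real ^ 'd) measure \<Rightarrow> nat \<Rightarrow> (nat \<Rightarrow> real ^ 'd) \<Rightarrow> ennreal" where
  "projection_loss P n X =
     (if empirical n X \<in> moment_nondegenerate
      then hellinger_sq (log_concave_projection (empirical n X)) (log_concave_projection P)
      else 2)"

(* The sample X_0, ..., X_{n-1} is i.i.d. from P: its law is the n-fold product of P. *)
definition projection_risk :: "nat \<Rightarrow> (real ^ 'd) measure \<Rightarrow> ennreal" where
  "projection_risk n P = (\<integral>\<^sup>+ X. projection_loss P n X \<partial>(\<Pi>\<^sub>M i \<in> {..<n}. P))"

end

theory Submission
  imports Defs "HOL-Real_Asymp.Real_Asymp"
begin

text \<open>
  The risk is bounded below at each of the two rates separately, using that the projection of an
  empirical distribution vanishes outside the convex hull of the sample.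

  Rate \<open>2 / (d + 1)\<close>: let \<open>P\<close> be uniform on the unit ball. By Gibbs' inequality \<open>P\<close> is its own
  projection, so the loss is at least the probability missed by the convex hull of the sample. A
  point at depth of order \<open>n powr (- 2 / (d + 1))\<close> cuts off a cap of probability at most
  \<open>1 / (2 * n)\<close>, and with probability at least one half this cap contains no sample point.

  Rate \<open>1 / 2 - 1 / (2 * q)\<close>: let \<open>P\<close> put mass \<open>1 - a\<close> uniformly on the vertices of a small cube and
  mass \<open>a\<close> of order \<open>1 / n\<close> on an atom at distance \<open>M = n powr (1 / q)\<close>. The atom is likely to
  be absent from the sample, and then the loss is at least the mass \<open>\<tau>\<close> that the projection of \<open>P\<close>
  puts off the cube. If \<open>\<tau>\<close> is small, the log-density falls by about \<open>M / \<tau>\<close> between the cube and the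
  atom, which costs \<open>a * M / \<tau>\<close> in expected log-likelihood. A density that is constant on the cube and
  decays exponentially off it at rate \<open>1 / sqrt (a * M)\<close> loses only a multiple of \<open>sqrt (a * M)\<close>,
  so \<open>\<tau>\<close> is at least of that order.
\<close>

text \<open>\<open>log_concave_projection\<close> is an \<open>arg_max_on\<close>, hence a bare
  choice until a maximiser is exhibited, and then some maximiser of which only membership and
  optimality are known. For finitely supported distributions existence comes from a
  finite-dimensional problem over the heights of tent functions; for uniform distributions it comes
  with Gibbs' inequality, whose equality case identifies every maximiser on the body. The cube
  distribution is symmetric under the reflections that fix the atom, while its projection
  \<open>f\<close> is only known to be optimal. Therefore \<open>ln f\<close> is averaged over these
  reflections: the average is concave and symmetric, it agrees with \<open>ln f\<close> at the atom,
  and lower bounds for it still bound the mass of \<open>f\<close> on reflection-invariant sets from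
  below. The constants may not depend on \<open>q\<close>: the cube depends on the dimension alone,
  and \<open>q\<close> and \<open>n\<close> enter only through \<open>M\<close> and
  \<open>a\<close>.\<close>

section \<open>Semicontinuous log-concave functions and the choice of a maximiser\<close>

lemma upper_semicontinuous_borel_measurable:
  fixes f :: "'a::topological_space \<Rightarrow> real"
  assumes "upper_semicontinuous f"
  shows "f \<in> borel_measurable borel"
  using assms by (auto simp: borel_measurable_iff_less upper_semicontinuous_def)

lemma log_concave_nonneg: "log_concave f \<Longrightarrow> 0 \<le> f x"
  by (simp add: log_concave_def)

lemma log_concave_convex_support: "log_concave f \<Longrightarrow> convex {x. 0 < f x}"
  by (auto simp: log_concave_def concave_on_def dest: convex_on_imp_convex)

lemma log_concaveI:
  assumes "\<And>x. 0 \<le> f x"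
    and "\<And>x y u v. \<lbrakk>0 < f x; 0 < f y; 0 \<le> u; 0 \<le> v; u + v = 1\<rbrakk> \<Longrightarrow>
      0 < f (u *\<^sub>R x + v *\<^sub>R y) \<and> u * ln (f x) + v * ln (f y) \<le> ln (f (u *\<^sub>R x + v *\<^sub>R y))"
  shows "log_concave f"
  unfolding log_concave_def concave_on_iff using assms by (auto simp: convex_def)

lemma log_concaveD:
  assumes "log_concave f" "0 < f x" "0 < f y" "0 \<le> u" "0 \<le> v" "u + v = 1"
  shows "0 < f (u *\<^sub>R x + v *\<^sub>R y)"
    and "u * ln (f x) + v * ln (f y) \<le> ln (f (u *\<^sub>R x + v *\<^sub>R y))"
  using assms unfolding log_concave_def concave_on_iff by (auto simp: convex_def)

lemma log_concave_scale:
  assumes "log_concave f" "0 < c"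
  shows "log_concave (\<lambda>x. c * f x)"
proof (rule log_concaveI)
  show "0 \<le> c * f x" for x using assms by (simp add: log_concave_nonneg)
next
  fix x y and u v :: real
  assume *: "0 < c * f x" "0 < c * f y" "0 \<le> u" "0 \<le> v" "u + v = 1"
  then have fp: "0 < f x" "0 < f y" using assms(2) by (auto simp: zero_less_mult_iff)
  note D = log_concaveD[OF assms(1) fp *(3-5)]
  have "u * ln (c * f x) + v * ln (c * f y) = (u + v) * ln c + (u * ln (f x) + v * ln (f y))"
    using fp assms(2) by (simp add: ln_mult algebra_simps)
  also have "\<dots> \<le> ln c + ln (f (u *\<^sub>R x + v *\<^sub>R y))" using D *(5) by simp
  also have "\<dots> = ln (c * f (u *\<^sub>R x + v *\<^sub>R y))" using D assms(2) by (simp add: ln_mult)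
  finally show "0 < c * f (u *\<^sub>R x + v *\<^sub>R y) \<and>
      u * ln (c * f x) + v * ln (c * f y) \<le> ln (c * f (u *\<^sub>R x + v *\<^sub>R y))"
    using D assms(2) by simp
qed

lemma upper_semicontinuous_scale:
  fixes f :: "'a::topological_space \<Rightarrow> real"
  assumes "upper_semicontinuous f" "0 < c"
  shows "upper_semicontinuous (\<lambda>x. c * f x)"
proof -
  have "{x. c * f x < a} = {x. f x < a / c}" for a
    using assms(2) by (auto simp: field_simps)
  then show ?thesis using assms(1) by (simp add: upper_semicontinuous_def)
qed

lemma log_concave_restrict:
  assumes "log_concave f" "convex C"
  shows "log_concave (\<lambda>x. f x * indicator C x)"
proof (rule log_concaveI)
  show "0 \<le> f x * indicator C x" for x using assms by (simp add: log_concave_nonneg)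
next
  fix x y and u v :: real
  assume *: "0 < f x * indicator C x" "0 < f y * indicator C y" "0 \<le> u" "0 \<le> v" "u + v = 1"
  then have fp: "0 < f x" "0 < f y" "x \<in> C" "y \<in> C"
    using * by (cases "x \<in> C"; cases "y \<in> C"; simp)+
  have "u *\<^sub>R x + v *\<^sub>R y \<in> C" using assms(2) fp * by (auto simp: convex_def)
  then show "0 < f (u *\<^sub>R x + v *\<^sub>R y) * indicator C (u *\<^sub>R x + v *\<^sub>R y) \<and>
    u * ln (f x * indicator C x) + v * ln (f y * indicator C y)
      \<le> ln (f (u *\<^sub>R x + v *\<^sub>R y) * indicator C (u *\<^sub>R x + v *\<^sub>R y))"
    using log_concaveD[OF assms(1) fp(1,2) *(3-5)] fp by simp
qed

text \<open>Levels \<open>a \<le> 0\<close> are trivial for a nonnegative function. Positive levels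
  ignore the zero set: restricting to a closed set intersects them with it, and those of a tent
  function are compact.\<close>

lemma upper_semicontinuous_iff_closed:
  fixes f :: "'a::topological_space \<Rightarrow> real"
  assumes "\<And>x. 0 \<le> f x"
  shows "upper_semicontinuous f \<longleftrightarrow> (\<forall>a>0. closed {x. a \<le> f x})"
proof -
  have eq: "- {x. f x < a} = {x. a \<le> f x}" for a by auto
  have "open {x. f x < a}" if "\<forall>a>0. closed {x. a \<le> f x}" for a
  proof (cases "a > 0")
    case True then show ?thesis using that by (simp add: open_closed eq)
  next
    case False
    then have "{x. f x < a} = {}" using assms by (auto simp: not_less) (meson le_less_trans not_less)
    then show ?thesis by simp
  qed
  then show ?thesis unfolding upper_semicontinuous_def by (metis (no_types) open_closed eq)
qed

lemma upper_semicontinuous_restrict: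
  fixes f :: "'a::topological_space \<Rightarrow> real"
  assumes "upper_semicontinuous f" "\<And>x. 0 \<le> f x" "closed C"
  shows "upper_semicontinuous (\<lambda>x. f x * indicator C x)"
proof -
  have "{x. a \<le> f x * indicator C x} = {x. a \<le> f x} \<inter> C" if "a > 0" for a
    using that by (auto simp: indicator_def split: if_splits)
  moreover have "\<forall>a>0. closed {x. a \<le> f x}" using assms upper_semicontinuous_iff_closed by blast
  ultimately show ?thesis
    using assms by (subst upper_semicontinuous_iff_closed) auto
qed

lemma log_concave_densitiesD:
  assumes "f \<in> log_concave_densities"
  shows "upper_semicontinuous f" "log_concave f" "(\<integral>\<^sup>+ x. ennreal (f x) \<partial>lborel) = 1"
    "\<And>x. 0 \<le> f x" "f \<in> borel_measurable borel"
  using assms upper_semicontinuous_borel_measurable[of f]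
  by (auto simp: log_concave_densities_def log_concave_def)

lemma normalize_in_log_concave_densities:
  fixes f :: "real ^ 'd \<Rightarrow> real"
  assumes "upper_semicontinuous f" "log_concave f"
    and "(\<integral>\<^sup>+ x. ennreal (f x) \<partial>lborel) = ennreal m" "0 < m"
  shows "(\<lambda>x. (1 / m) * f x) \<in> log_concave_densities"
proof -
  have [measurable]: "f \<in> borel_measurable borel"
    using assms(1) by (rule upper_semicontinuous_borel_measurable)
  have "(\<integral>\<^sup>+ x. ennreal ((1 / m) * f x) \<partial>lborel) = (\<integral>\<^sup>+ x. ennreal (1/m) * ennreal (f x) \<partial>lborel)"
    using assms(4) log_concave_nonneg[OF assms(2)] by (subst ennreal_mult) auto
  also have "\<dots> = ennreal (1/m) * ennreal m"
    by (subst nn_integral_cmult) (auto simp: assms(3))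
  also have "\<dots> = 1" using assms(4) by (simp flip: ennreal_mult)
  finally show ?thesis
    using assms(4) upper_semicontinuous_scale[OF assms(1), of "1/m"] log_concave_scale[OF assms(2), of "1/m"]
    unfolding log_concave_densities_def by simp
qed

text \<open>The choice yields a maximiser once one exists, but not necessarily the exhibited
  \<open>f\<close>; only membership and optimality pass to the projection.\<close>

lemma is_arg_max_log_concave_projection:
  assumes "is_arg_max (expected_log P) (\<lambda>f. f \<in> log_concave_densities) f"
  shows "log_concave_projection P \<in> log_concave_densities"
    "\<And>g. g \<in> log_concave_densities \<Longrightarrow> expected_log P g \<le> expected_log P (log_concave_projection P)"
proof -
  have "is_arg_max (expected_log P) (\<lambda>f. f \<in> log_concave_densities) (log_concave_projection P)"
    unfolding log_concave_projection_def arg_max_on_def arg_max_def 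
    by (rule someI[where P = "is_arg_max (expected_log P) (\<lambda>f. f \<in> log_concave_densities)"]) (rule assms)
  then show "log_concave_projection P \<in> log_concave_densities"
    "\<And>g. g \<in> log_concave_densities \<Longrightarrow> expected_log P g \<le> expected_log P (log_concave_projection P)"
    by (auto simp: is_arg_max_linorder)
qed

subsection \<open>Discrete distributions\<close>

text \<open>Points are given by an index map instead of a set, so repeated sample points simply
  accumulate weight. Empirical distributions and the cube with its atom both have this form.\<close>

definition discrete_distr :: "'i set \<Rightarrow> ('i \<Rightarrow> real) \<Rightarrow> ('i \<Rightarrow> real ^ 'd) \<Rightarrow> (real ^ 'd) measure" where
  "discrete_distr I w X = distr (point_measure I (\<lambda>i. ennreal (w i))) borel X"

lemma measurable_point_measure_borel [measurable]: "X \<in> point_measure I w \<rightarrow>\<^sub>M borel"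
  by (simp add: measurable_def space_point_measure sets_point_measure)

lemma nn_integral_discrete_distr:
  assumes "finite I" "g \<in> borel_measurable borel"
  shows "(\<integral>\<^sup>+ x. g x \<partial>discrete_distr I w X) = (\<Sum>i\<in>I. ennreal (w i) * g (X i))"
  using assms unfolding discrete_distr_def
  by (simp add: nn_integral_distr nn_integral_point_measure_finite)

lemma empirical_eq_discrete_distr:
  "empirical n X = discrete_distr {..<n} (\<lambda>i. 1 / real n) X"
  by (simp add: empirical_def discrete_distr_def uniform_count_measure_def)

locale weighted_points =
  fixes I :: "'i set" and w :: "'i \<Rightarrow> real" and X :: "'i \<Rightarrow> real ^ 'd"
  assumes finite_I: "finite I" and w_pos: "\<And>i. i \<in> I \<Longrightarrow> 0 < w i" and sum_w: "sum w I = 1"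
begin

abbreviation P :: "(real ^ 'd) measure" where "P \<equiv> discrete_distr I w X"

lemma I_nonempty: "I \<noteq> {}"
  using sum_w by auto

lemma sets_P [simp]: "sets P = sets borel" and space_P [simp]: "space P = UNIV"
  by (simp_all add: discrete_distr_def)

lemma emeasure_P:
  assumes "A \<in> sets borel"
  shows "emeasure P A = (\<Sum>i\<in>I. ennreal (w i) * indicator A (X i))"
proof -
  have "emeasure P A = (\<integral>\<^sup>+ x. indicator A x \<partial>P)" using assms by simp
  then show ?thesis using assms by (subst (asm) nn_integral_discrete_distr[OF finite_I]) auto
qed

lemma prob_space_P: "prob_space P"
proof
  have "emeasure P (space P) = (\<Sum>i\<in>I. ennreal (w i))" by (simp add: emeasure_P)
  also have "\<dots> = 1" using sum_w w_pos by (subst sum_ennreal) (auto intro: less_imp_le)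
  finally show "emeasure P (space P) = 1" .
qed

lemma integrable_P:
  fixes g :: "real ^ 'd \<Rightarrow> 'b :: {banach, second_countable_topology}"
  assumes "g \<in> borel_measurable borel"
  shows "integrable P g"
proof -
  have "(\<integral>\<^sup>+ x. norm (g x) \<partial>P) = (\<Sum>i\<in>I. ennreal (w i) * norm (g (X i)))"
    using assms by (subst nn_integral_discrete_distr[OF finite_I]) auto
  also have "\<dots> < \<infinity>" using finite_I by (auto simp: less_top ennreal_mult_less_top)
  finally show ?thesis using assms by (auto simp: integrable_iff_bounded discrete_distr_def)
qed

lemma integral_P:
  fixes g :: "real ^ 'd \<Rightarrow> real"
  assumes [measurable]: "g \<in> borel_measurable borel" and "\<And>x. 0 \<le> g x"
  shows "(\<integral>x. g x \<partial>P) = (\<Sum>i\<in>I. w i * g (X i))"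
proof -
  have "ennreal (\<integral>x. g x \<partial>P) = (\<integral>\<^sup>+ x. ennreal (g x) \<partial>P)"
    by (rule nn_integral_eq_integral[symmetric]) (simp_all add: integrable_P assms)
  also have "\<dots> = (\<Sum>i\<in>I. ennreal (w i * g (X i)))"
    using assms w_pos by (subst nn_integral_discrete_distr[OF finite_I])
      (auto intro!: sum.cong simp: ennreal_mult less_imp_le)
  also have "\<dots> = ennreal (\<Sum>i\<in>I. w i * g (X i))"
    using assms w_pos by (subst sum_ennreal) (auto simp: less_imp_le)
  finally show ?thesis using assms w_pos
    by (subst (asm) ennreal_inj) (auto intro!: integral_nonneg_AE sum_nonneg simp: less_imp_le)
qed

lemma expected_log_eq:
  assumes [measurable]: "f \<in> borel_measurable borel" and pos: "\<And>i. i \<in> I \<Longrightarrow> 0 < f (X i)"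
  shows "expected_log P f = ereal (\<Sum>i\<in>I. w i * ln (f (X i)))"
proof -
  have [measurable]: "(\<lambda>x. log_ext (f x)) \<in> borel_measurable borel"
    unfolding log_ext_def by measurable
  \<comment> \<open>The sign \<open>s\<close> treats the positive part (\<open>s = 1\<close>) and
    the negative part (\<open>s = -1\<close>) in one computation.\<close>
  have eq: "(\<integral>\<^sup>+ x. e2ennreal (s * log_ext (f x)) \<partial>P) = ennreal (\<Sum>i\<in>I. w i * max 0 (s * ln (f (X i))))"
    if "s \<noteq> 0" for s :: real
  proof -
    have "(\<integral>\<^sup>+ x. e2ennreal (s * log_ext (f x)) \<partial>P)
        = (\<Sum>i\<in>I. ennreal (w i) * e2ennreal (s * log_ext (f (X i))))"
      by (subst nn_integral_discrete_distr[OF finite_I]) auto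
    also have "\<dots> = (\<Sum>i\<in>I. ennreal (w i * max 0 (s * ln (f (X i)))))"
      using pos w_pos
      by (intro sum.cong) (auto simp: log_ext_def ennreal_mult less_imp_le max_def ennreal_def[symmetric] ennreal_neg not_le)
    finally show ?thesis using w_pos by (simp add: sum_ennreal less_imp_le)
  qed
  have neg: "ereal (- 1) * z = - z" for z by (cases z) auto
  have nn: "0 \<le> (\<Sum>i\<in>I. w i * max 0 (s * ln (f (X i))))" for s
    using w_pos by (intro sum_nonneg) (auto simp: less_imp_le)
  have "expected_log P f = ereal (\<Sum>i\<in>I. w i * max 0 (1 * ln (f (X i)))) - ereal (\<Sum>i\<in>I. w i * max 0 (-1 * ln (f (X i))))"
    using eq[of 1] eq[of "-1"] nn[of 1] nn[of "-1"] unfolding expected_log_def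
    by (simp add: neg)
  also have "\<dots> = ereal (\<Sum>i\<in>I. w i * ln (f (X i)))"
    by (auto simp: sum_subtractf[symmetric] max_def algebra_simps intro!: sum.cong)
  finally show ?thesis .
qed

text \<open>A positive weight at a zero of \<open>f\<close> makes the negative part infinite, while
  the positive part is a finite sum of finite terms.\<close>

lemma expected_log_eq_MInf:
  assumes [measurable]: "f \<in> borel_measurable borel" and i: "i \<in> I" "f (X i) \<le> 0"
  shows "expected_log P f = - \<infinity>"
proof -
  have [measurable]: "(\<lambda>x. log_ext (f x)) \<in> borel_measurable borel"
    unfolding log_ext_def by measurable
  have "(\<integral>\<^sup>+ x. e2ennreal (log_ext (f x)) \<partial>P) = (\<Sum>i\<in>I. ennreal (w i) * e2ennreal (log_ext (f (X i))))"
    by (subst nn_integral_discrete_distr[OF finite_I]) auto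
  also have "\<dots> < \<infinity>" using finite_I
    by (auto simp: less_top log_ext_def ennreal_mult_less_top ennreal_def[symmetric] e2ennreal_neg)
  finally have p: "(\<integral>\<^sup>+ x. e2ennreal (log_ext (f x)) \<partial>P) \<noteq> \<infinity>" by simp
  have "(\<integral>\<^sup>+ x. e2ennreal (- log_ext (f x)) \<partial>P) = (\<Sum>i\<in>I. ennreal (w i) * e2ennreal (- log_ext (f (X i))))"
    by (subst nn_integral_discrete_distr[OF finite_I]) auto
  moreover have "ennreal (w i) * e2ennreal (- log_ext (f (X i))) = \<infinity>"
    using i w_pos[OF i(1)] by (auto simp: log_ext_def ennreal_mult_eq_top_iff not_le[symmetric] ennreal_eq_0_iff)
  then have "\<infinity> \<le> (\<Sum>i\<in>I. ennreal (w i) * e2ennreal (- log_ext (f (X i))))"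
    using member_le_sum[of i I "\<lambda>i. ennreal (w i) * e2ennreal (- log_ext (f (X i)))"] finite_I i by simp
  ultimately have "(\<integral>\<^sup>+ x. e2ennreal (- log_ext (f x)) \<partial>P) = \<infinity>" by (simp add: top_unique)
  with p show ?thesis unfolding expected_log_def
    by (cases "\<integral>\<^sup>+ x. e2ennreal (log_ext (f x)) \<partial>P") auto
qed

end

subsection \<open>Tent functions and existence of the projection\<close>

text \<open>The least log-concave function with value at least \<open>exp (y i)\<close> at each \<open>X i\<close>.\<close>

definition tent :: "'i set \<Rightarrow> ('i \<Rightarrow> real ^ 'd) \<Rightarrow> ('i \<Rightarrow> real) \<Rightarrow> real ^ 'd \<Rightarrow> real" where
  "tent I X y x = Sup (insert 0 {exp t | t. (x, t) \<in> convex hull ((\<lambda>i. (X i, y i)) ` I)})"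

context
  fixes I :: "'i set" and X :: "'i \<Rightarrow> real ^ 'd"
  assumes fin: "finite I"
begin

lemma compact_lifted_hull: "compact (convex hull ((\<lambda>i. (X i, y i :: real)) ` I))"
  using fin by (simp add: finite_imp_compact_convex_hull)

text \<open>The lifted hull is compact, so the supremum in \<open>tent\<close> is attained above
  every point of the hull; the inserted 0 is the value elsewhere. This case distinction replaces
  \<open>Sup\<close> in the proofs below.\<close>

lemma tent_cases:
  obtains (outside) "tent I X y x = 0" "\<And>t. (x, t) \<notin> convex hull ((\<lambda>i. (X i, y i)) ` I)"
  | (inside) t where "tent I X y x = exp t" "(x, t) \<in> convex hull ((\<lambda>i. (X i, y i)) ` I)"
      "\<And>t'. (x, t') \<in> convex hull ((\<lambda>i. (X i, y i)) ` I) \<Longrightarrow> t' \<le> t"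
proof (cases "\<exists>t. (x, t) \<in> convex hull ((\<lambda>i. (X i, y i)) ` I)")
  case False
  then show ?thesis by (intro outside) (auto simp: tent_def)
next
  case True
  let ?H = "convex hull ((\<lambda>i. (X i, y i)) ` I)"
  let ?T = "snd ` (?H \<inter> {x} \<times> UNIV)"
  have T: "t \<in> ?T \<longleftrightarrow> (x, t) \<in> ?H" for t by force
  have "closed ({x} \<times> (UNIV :: real set))" by (intro closed_Times) auto
  then have "compact ?T"
    by (intro compact_continuous_image compact_Int_closed compact_lifted_hull continuous_intros)
  moreover have "?T \<noteq> {}" using True T by blast
  ultimately obtain t where t: "t \<in> ?T" "\<And>t'. t' \<in> ?T \<Longrightarrow> t' \<le> t"
    using compact_attains_sup[of ?T] by blast
  have "tent I X y x = exp t"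
    unfolding tent_def using t T by (intro cSup_eq_maximum) (auto intro: less_imp_le)
  then show ?thesis using t T by (intro inside[of t]) auto
qed

lemma tent_nonneg: "0 \<le> tent I X y x"
  by (cases rule: tent_cases[of y x]) auto

lemma tent_ge: "(x, t) \<in> convex hull ((\<lambda>i. (X i, y i)) ` I) \<Longrightarrow> exp t \<le> tent I X y x"
  by (cases rule: tent_cases[of y x]) auto

lemma fst_lifted_hull:
  "fst ` (convex hull ((\<lambda>i. (X i, y i :: real)) ` I)) = convex hull (X ` I)"
  by (simp add: convex_hull_linear_image linear_fst image_image)

lemma tent_pos_iff: "0 < tent I X y x \<longleftrightarrow> x \<in> convex hull (X ` I)"
  using fst_lifted_hull[of y] by (cases rule: tent_cases[of y x]) force+

text \<open>A superlevel set at a positive level is the projection of a slice of the compact lifted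
  hull, hence compact.\<close>

lemma tent_upper_semicontinuous: "upper_semicontinuous (tent I X y)"
proof -
  let ?H = "convex hull ((\<lambda>i. (X i, y i)) ` I)"
  have "closed {x. a \<le> tent I X y x}" if "a > 0" for a
  proof -
    have ln_le: "ln a \<le> t \<longleftrightarrow> a \<le> exp t" for t
      using that by (metis exp_le_cancel_iff exp_ln)
    have "{x. a \<le> tent I X y x} = fst ` (?H \<inter> UNIV \<times> {ln a..})"
    proof (intro set_eqI iffI)
      fix x assume "x \<in> {x. a \<le> tent I X y x}"
      then show "x \<in> fst ` (?H \<inter> UNIV \<times> {ln a..})"
        using that by (cases rule: tent_cases[of y x]) (auto simp: image_iff ln_le intro!: bexI[of _ "(x, _)"])
    next
      fix x assume "x \<in> fst ` (?H \<inter> UNIV \<times> {ln a..})"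
      then obtain t where "(x, t) \<in> ?H" "ln a \<le> t" by auto
      then show "x \<in> {x. a \<le> tent I X y x}"
        using order_trans[of a "exp t"] tent_ge[of x t y] by (auto simp: ln_le)
    qed
    moreover have "compact (fst ` (?H \<inter> UNIV \<times> {ln a..}))"
      by (intro compact_continuous_image compact_Int_closed compact_lifted_hull continuous_intros closed_Times)
    ultimately show ?thesis by (simp add: compact_imp_closed)
  qed
  then show ?thesis by (simp add: upper_semicontinuous_iff_closed tent_nonneg)
qed

lemma tent_log_concave: "log_concave (tent I X y)"
proof (rule log_concaveI)
  fix x z and u v :: real
  assume *: "0 < tent I X y x" "0 < tent I X y z" "0 \<le> u" "0 \<le> v" "u + v = 1"
  let ?H = "convex hull ((\<lambda>i. (X i, y i)) ` I)"
  obtain s where s: "tent I X y x = exp s" "(x, s) \<in> ?H"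
    using *(1) by (cases rule: tent_cases[of y x]) auto
  obtain t where t: "tent I X y z = exp t" "(z, t) \<in> ?H"
    using *(2) by (cases rule: tent_cases[of y z]) auto
  have "u *\<^sub>R (x, s) + v *\<^sub>R (z, t) \<in> ?H"
    using s t * by (intro convexD[OF convex_convex_hull]) auto
  then have le: "exp (u * s + v * t) \<le> tent I X y (u *\<^sub>R x + v *\<^sub>R z)"
    by (intro tent_ge) auto
  moreover have pos: "0 < tent I X y (u *\<^sub>R x + v *\<^sub>R z)" using le less_le_trans exp_gt_zero by blast
  ultimately show "0 < tent I X y (u *\<^sub>R x + v *\<^sub>R z) \<and>
      u * ln (tent I X y x) + v * ln (tent I X y z) \<le> ln (tent I X y (u *\<^sub>R x + v *\<^sub>R z))"
    using s t by (auto simp: ln_ge_iff)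
qed (rule tent_nonneg)

lemma tent_ge_exp: "i \<in> I \<Longrightarrow> exp (y i) \<le> tent I X y (X i)"
  by (intro tent_ge hull_inc) auto

text \<open>The hypograph of \<open>ln f\<close> over the support is convex and contains the lifted
  points, hence their convex hull.\<close>

lemma tent_least:
  assumes f: "log_concave f" and ge: "\<And>i. i \<in> I \<Longrightarrow> exp (y i) \<le> f (X i)"
  shows "tent I X y x \<le> f x"
proof -
  let ?G = "{p. 0 < f (fst p) \<and> snd p \<le> ln (f (fst p))}"
  have "convex ?G"
  proof (rule convexI)
    fix p q and u v :: real
    assume *: "p \<in> ?G" "q \<in> ?G" "0 \<le> u" "0 \<le> v" "u + v = 1"
    have "u * snd p + v * snd q \<le> u * ln (f (fst p)) + v * ln (f (fst q))"
      using * by (intro add_mono mult_left_mono) auto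
    then show "u *\<^sub>R p + v *\<^sub>R q \<in> ?G"
      using log_concaveD[OF f, of "fst p" "fst q" u v] * by auto
  qed
  moreover have "(\<lambda>i. (X i, y i)) ` I \<subseteq> ?G"
  proof clarsimp
    fix i assume "i \<in> I"
    from ge[OF this] show "0 < f (X i) \<and> y i \<le> ln (f (X i))"
      using less_le_trans[OF exp_gt_zero] by (auto simp: ln_ge_iff)
  qed
  ultimately have H: "convex hull ((\<lambda>i. (X i, y i)) ` I) \<subseteq> ?G" by (rule hull_minimal[rotated])
  show ?thesis
  proof (cases rule: tent_cases[of y x])
    case outside then show ?thesis using log_concave_nonneg[OF f] by simp
  next
    case (inside t) then show ?thesis using H by (force simp: ln_ge_iff)
  qed
qed

text \<open>Scaling by \<open>exp \<delta>\<close> keeps the second tent log-concave and lifts it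
  above all heights \<open>y i\<close>, so \<open>tent_least\<close> applies. At the level of masses
  this gives monotonicity (\<open>\<delta> = 0\<close>) and continuity in the heights.\<close>

lemma tent_shift:
  assumes "\<And>i. i \<in> I \<Longrightarrow> y i \<le> y' i + \<delta>"
  shows "tent I X y x \<le> exp \<delta> * tent I X y' x"
proof (rule tent_least)
  fix i assume "i \<in> I"
  then have "exp (y i) \<le> exp \<delta> * exp (y' i)" using assms by (simp add: exp_add[symmetric] add.commute)
  also have "\<dots> \<le> exp \<delta> * tent I X y' (X i)" using \<open>i \<in> I\<close> by (intro mult_left_mono tent_ge_exp) auto
  finally show "exp (y i) \<le> exp \<delta> * tent I X y' (X i)" .
qed (simp add: log_concave_scale tent_log_concave)

definition tent_mass :: "('i \<Rightarrow> real) \<Rightarrow> ennreal" where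
  "tent_mass y = (\<integral>\<^sup>+ x. ennreal (tent I X y x) \<partial>lborel)"

lemma tent_measurable [measurable]: "tent I X y \<in> borel_measurable borel"
  by (rule upper_semicontinuous_borel_measurable[OF tent_upper_semicontinuous])

lemma tent_mass_shift:
  assumes "\<And>i. i \<in> I \<Longrightarrow> y i \<le> y' i + \<delta>"
  shows "tent_mass y \<le> ennreal (exp \<delta>) * tent_mass y'"
proof -
  have "tent_mass y \<le> (\<integral>\<^sup>+ x. ennreal (exp \<delta>) * ennreal (tent I X y' x) \<partial>lborel)"
    unfolding tent_mass_def using tent_shift[OF assms] tent_nonneg
    by (intro nn_integral_mono) (simp add: ennreal_mult[symmetric] ennreal_leI)
  then show ?thesis unfolding tent_mass_def by (simp add: nn_integral_cmult)
qed

lemma tent_mass_finite: "tent_mass y < \<infinity>"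
proof -
  define B where "B = (\<Sum>i\<in>I. \<bar>y i\<bar>)"
  have le: "tent I X y x \<le> exp B" for x
  proof (rule tent_least[where f = "\<lambda>_. exp B"])
    show "log_concave (\<lambda>_. exp B)" by (rule log_concaveI) (auto simp flip: distrib_right)
    fix i assume "i \<in> I"
    then have "\<bar>y i\<bar> \<le> B" unfolding B_def using fin by (intro member_le_sum) auto
    then show "exp (y i) \<le> exp B" by simp
  qed
  have "compact (convex hull (X ` I))" using fin by (simp add: finite_imp_compact_convex_hull)
  then have C: "emeasure lborel (convex hull (X ` I)) < \<infinity>"
    using emeasure_bounded_finite compact_imp_bounded by blast
  have "tent_mass y \<le> (\<integral>\<^sup>+ x. ennreal (exp B) * indicator (convex hull (X ` I)) x \<partial>lborel)"
    unfolding tent_mass_def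
  proof (rule nn_integral_mono)
    fix x
    show "ennreal (tent I X y x) \<le> ennreal (exp B) * indicator (convex hull (X ` I)) x"
      using le[of x] tent_pos_iff[of y x] tent_nonneg[of y x]
      by (cases "x \<in> convex hull (X ` I)") (auto simp: ennreal_leI)
  qed
  also have "\<dots> = ennreal (exp B) * emeasure lborel (convex hull (X ` I))"
    using \<open>compact _\<close> by (subst nn_integral_cmult_indicator) (auto simp: borel_compact)
  also have "\<dots> < \<infinity>" using C by (simp add: ennreal_mult_less_top)
  finally show ?thesis .
qed

lemma tent_ge_const:
  assumes "\<And>i. i \<in> I \<Longrightarrow> m \<le> y i" "x \<in> convex hull (X ` I)"
  shows "exp m \<le> tent I X y x"
proof -
  have "convex hull ((\<lambda>i. (X i, y i)) ` I) \<subseteq> UNIV \<times> {m..}"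
    using assms by (intro hull_minimal convex_Times) auto
  moreover obtain t where "(x, t) \<in> convex hull ((\<lambda>i. (X i, y i)) ` I)"
    using assms(2) fst_lifted_hull[of y] by force
  ultimately have "exp m \<le> exp t" "exp t \<le> tent I X y x" using tent_ge[of x t y] by auto
  then show ?thesis by (rule order_trans)
qed

text \<open>The inner ball is contracted towards the peak \<open>X j\<close> by the factor
  \<open>t\<close>; log-concavity interpolates between the height \<open>y j\<close> at the peak and
  the floor \<open>m\<close> on the ball. A small \<open>t\<close> loses volume
  \<open>t ^ d\<close>, a large one loses height \<open>t * (y j - m)\<close>.\<close>

lemma tent_mass_ge:
  assumes B: "ball p \<rho> \<subseteq> convex hull (X ` I)" and \<rho>: "0 < \<rho>"
    and j: "j \<in> I" and m: "\<And>i. i \<in> I \<Longrightarrow> m \<le> y i" and t: "0 < t" "t \<le> 1"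
  shows "ennreal (exp (y j - t * (y j - m)) * ((t * \<rho>) ^ CARD('d) * measure lborel (ball (0 :: real ^ 'd) 1))) \<le> tent_mass y"
proof -
  let ?c = "(1 - t) *\<^sub>R X j + t *\<^sub>R p"
  have ge: "exp (y j - t * (y j - m)) \<le> tent I X y x" if x: "x \<in> ball ?c (t * \<rho>)" for x
  proof -
    define z where "z = (1 / t) *\<^sub>R (x - (1 - t) *\<^sub>R X j)"
    have x_eq: "x = (1 - t) *\<^sub>R X j + t *\<^sub>R z" using t by (simp add: z_def)
    have "dist ?c x = t * dist p z"
      using t unfolding x_eq dist_norm by (simp flip: scaleR_diff_right)
    with x t have "z \<in> ball p \<rho>" by auto
    then have z: "exp m \<le> tent I X y z" using B m by (intro tent_ge_const) auto
    have Xj: "exp (y j) \<le> tent I X y (X j)" by (rule tent_ge_exp[OF j])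
    note pos = less_le_trans[OF exp_gt_zero Xj] less_le_trans[OF exp_gt_zero z]
    have "y j - t * (y j - m) = (1 - t) * y j + t * m" by (simp add: algebra_simps)
    also have "\<dots> \<le> (1 - t) * ln (tent I X y (X j)) + t * ln (tent I X y z)"
      using z Xj t pos by (intro add_mono mult_left_mono) (auto simp: ln_ge_iff)
    also have "\<dots> \<le> ln (tent I X y x)"
      unfolding x_eq using t by (intro log_concaveD(2)[OF tent_log_concave pos]) auto
    finally have "y j - t * (y j - m) \<le> ln (tent I X y x)" .
    moreover have "0 < tent I X y x"
      unfolding x_eq using t by (intro log_concaveD(1)[OF tent_log_concave pos]) auto
    ultimately show ?thesis by (simp add: ln_ge_iff)
  qed
  have "ennreal (exp (y j - t * (y j - m)) * ((t * \<rho>) ^ CARD('d) * measure lborel (ball (0 :: real ^ 'd) 1)))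
      = ennreal (exp (y j - t * (y j - m))) * emeasure lborel (ball ?c (t * \<rho>))"
    using t \<rho> content_ball_conv_unit_ball[of "t * \<rho>" ?c] emeasure_lborel_ball_finite[of ?c "t * \<rho>"]
    by (subst emeasure_eq_ennreal_measure) (auto simp: ennreal_mult)
  also have "\<dots> = (\<integral>\<^sup>+ x. ennreal (exp (y j - t * (y j - m))) * indicator (ball ?c (t * \<rho>)) x \<partial>lborel)"
    by (subst nn_integral_cmult_indicator) auto
  also have "\<dots> \<le> tent_mass y"
    unfolding tent_mass_def using ge by (intro nn_integral_mono) (auto simp: indicator_def ennreal_leI)
  finally show ?thesis .
qed

end

text \<open>The exponential beats every power; this will turn the mass constraint into a bound on
  the heights.\<close>

lemma exp_le_power_bounded:
  fixes a K :: real
  assumes "0 < K" "0 \<le> a"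
  obtains B where "0 \<le> B" "\<And>z. \<lbrakk>0 \<le> z; exp z * K \<le> (1 + a * z) ^ d\<rbrakk> \<Longrightarrow> z \<le> B"
proof -
  have "eventually (\<lambda>x::real. x ^ d / exp x < K / (1 + a) ^ d) at_top"
    using assms by (intro order_tendstoD(2)[OF tendsto_power_div_exp_0]) auto
  then obtain B where B: "\<And>x::real. x \<ge> B \<Longrightarrow> x ^ d / exp x < K / (1 + a) ^ d"
    by (auto simp: eventually_at_top_linorder)
  show ?thesis
  proof (rule that[of "max 1 B"])
    fix z :: real assume z: "0 \<le> z" "exp z * K \<le> (1 + a * z) ^ d"
    show "z \<le> max 1 B"
    proof (rule ccontr)
      assume n: "\<not> z \<le> max 1 B"
      have "exp z * K \<le> (1 + a * z) ^ d" by fact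
      also have "\<dots> \<le> ((1 + a) * z) ^ d"
        using n assms by (intro power_mono) (auto simp: algebra_simps)
      finally have "exp z * K \<le> (1 + a) ^ d * z ^ d" by (simp add: power_mult_distrib)
      moreover have "z ^ d * (1 + a) ^ d < K * exp z"
        using B[of z] n assms by (simp add: field_simps)
      ultimately show False by (simp add: mult.commute)
    qed
  qed simp
qed

section \<open>Compactness in the heights\<close>

locale spanning_points = weighted_points +
  assumes spanning: "interior (convex hull (X ` I)) \<noteq> {}"
begin

lemma tent_mass_pos: "0 < tent_mass I X y"
proof -
  obtain p \<rho> where p: "ball p \<rho> \<subseteq> convex hull (X ` I)" "0 < \<rho>"
    using spanning by (auto simp: mem_interior)
  obtain j where j: "j \<in> I" using I_nonempty by auto
  have "0 < ennreal (exp (y j - 1 * (y j - Min (y ` I))) * ((1 * \<rho>) ^ CARD('b) * measure lborel (ball (0 :: real ^ 'b) 1)))"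
    using p content_ball_pos[of 1 "0 :: real ^ 'b"] by (simp only: ennreal_less_zero_iff) (auto intro!: mult_pos_pos)
  also have "\<dots> \<le> tent_mass I X y"
    using finite_I by (intro tent_mass_ge[OF finite_I p j]) auto
  finally show ?thesis .
qed

text \<open>Coercivity. Let \<open>z\<close> be the excess of the largest height over
  \<open>c\<close>. As every weight is at least \<open>w0\<close>, no height lies more than
  \<open>z / w0\<close> below the largest one, so \<open>tent_mass_ge\<close> yields an inequality
  of the form \<open>exp z * K \<le> (1 + z / w0) ^ d\<close>, which bounds \<open>z\<close> and
  then all heights.\<close>

lemma bounded_heights:
  obtains B where "\<And>y i. \<lbrakk>tent_mass I X y \<le> 1; c \<le> (\<Sum>i\<in>I. w i * y i); i \<in> I\<rbrakk> \<Longrightarrow> \<bar>y i\<bar> \<le> B"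
proof -
  obtain p \<rho> where p: "ball p \<rho> \<subseteq> convex hull (X ` I)" "0 < \<rho>"
    using spanning by (auto simp: mem_interior)
  define \<beta> where "\<beta> = measure lborel (ball (0 :: real ^ 'b) 1)"
  have \<beta>: "0 < \<beta>" by (simp add: \<beta>_def content_ball_pos)
  define w0 where "w0 = Min (w ` I)"
  have w0: "0 < w0" "\<And>i. i \<in> I \<Longrightarrow> w0 \<le> w i"
    using finite_I I_nonempty w_pos by (auto simp: w0_def)
  define K where "K = exp (c - 1) * (\<rho> ^ CARD('b) * \<beta>)"
  have "0 < K" using p \<beta> by (simp add: K_def)
  then obtain B0 where B0: "0 \<le> B0" "\<And>z. \<lbrakk>0 \<le> z; exp z * K \<le> (1 + 1 / w0 * z) ^ CARD('b)\<rbrakk> \<Longrightarrow> z \<le> B0"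
    using exp_le_power_bounded[of K "1 / w0"] w0 by (metis divide_nonneg_pos zero_le_one)
  show ?thesis
  proof (rule that[of "\<bar>c\<bar> + B0 + B0 / w0"])
    fix y i assume mass: "tent_mass I X y \<le> 1" and c: "c \<le> (\<Sum>i\<in>I. w i * y i)" and i: "i \<in> I"
    have "Max (y ` I) \<in> y ` I" using finite_I I_nonempty by (intro Max_in) auto
    then obtain j where j: "j \<in> I" "Max (y ` I) = y j" by auto
    then have j: "j \<in> I" "\<And>i. i \<in> I \<Longrightarrow> y i \<le> y j"
      using finite_I Max_ge[of "y ` I"] by auto
    define z where "z = y j - c"
    have eq: "(\<Sum>i\<in>I. w i * (y j - y i)) = y j - (\<Sum>i\<in>I. w i * y i)"
      using sum_w by (simp add: right_diff_distrib sum_subtractf flip: sum_distrib_right)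
    have low: "y j - y k \<le> z / w0" if "k \<in> I" for k
    proof -
      have "w0 * (y j - y k) \<le> w k * (y j - y k)" using w0 j that by (intro mult_right_mono) auto
      also have "\<dots> \<le> (\<Sum>i\<in>I. w i * (y j - y i))"
        using that finite_I j w_pos by (intro member_le_sum) (auto simp: less_imp_le)
      also have "\<dots> \<le> z" using c eq by (simp add: z_def)
      finally show ?thesis using w0 by (simp add: field_simps)
    qed
    have "0 \<le> (\<Sum>i\<in>I. w i * (y j - y i))" using j w_pos by (intro sum_nonneg) (auto simp: less_imp_le)
    then have z: "0 \<le> z" using c eq by (simp add: z_def)
    \<comment> \<open>With this \<open>t\<close> the contraction costs at most one unit of
      log-height, and only a polynomial factor in volume.\<close>
    define t where "t = 1 / (1 + z / w0)"
    have t: "0 < t" "t \<le> 1" "t * (z / w0) \<le> 1"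
      using z w0 by (auto simp: t_def field_simps)
    have "ennreal (exp (y j - t * (y j - (y j - z / w0))) * ((t * \<rho>) ^ CARD('b) * \<beta>)) \<le> tent_mass I X y"
      unfolding \<beta>_def using low by (intro tent_mass_ge[OF finite_I p j(1) _ t(1,2)]) (auto simp: algebra_simps)
    also note mass
    finally have "exp (y j - t * (z / w0)) * ((t * \<rho>) ^ CARD('b) * \<beta>) \<le> 1"
      by (simp add: ennreal_le_1)
    moreover have "exp (y j - 1) * ((t * \<rho>) ^ CARD('b) * \<beta>) \<le> exp (y j - t * (z / w0)) * ((t * \<rho>) ^ CARD('b) * \<beta>)"
      using t p \<beta> by (intro mult_right_mono) auto
    ultimately have "exp (y j - 1) * ((t * \<rho>) ^ CARD('b) * \<beta>) \<le> 1" by linarith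
    moreover have Kz: "exp z * K = exp (y j - 1) * (\<rho> ^ CARD('b) * \<beta>)"
      by (simp add: K_def z_def mult.assoc[symmetric] flip: exp_add)
    ultimately have "exp z * K * t ^ CARD('b) \<le> 1"
      by (simp add: Kz power_mult_distrib mult_ac)
    then have "exp z * K \<le> (1 + 1 / w0 * z) ^ CARD('b)"
      using z w0 by (simp add: t_def power_one_over field_simps)
    then have "z \<le> B0" using B0 z by blast
    moreover have "z / w0 \<le> B0 / w0" using \<open>z \<le> B0\<close> w0 by (simp add: divide_right_mono)
    ultimately show "\<bar>y i\<bar> \<le> \<bar>c\<bar> + B0 + B0 / w0"
      using low[OF i] j(2)[OF i] z B0 w0 divide_nonneg_pos[OF B0(1) w0(1)] unfolding z_def by linarith
  qed
qed

lemma closed_tent_mass_le_1: "closed {y. tent_mass I X y \<le> 1}"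
proof -
  have "open {y. 1 < tent_mass I X y}"
  proof (subst open_subopen, safe)
    fix y assume y: "1 < tent_mass I X y"
    obtain g where g: "tent_mass I X y = ennreal g" "1 < g"
      using y tent_mass_finite[OF finite_I, of X y] by (cases "tent_mass I X y") auto
    \<comment> \<open>\<open>exp \<delta>\<close> is the square root of the mass
      \<open>g > 1\<close>, so heights within \<open>\<delta>\<close> of \<open>y\<close> still have
      mass above 1.\<close>
    define \<delta> where "\<delta> = ln g / 2"
    have "ln g / 2 < ln g" using g by simp
    then have "exp (ln g / 2) < exp (ln g)" by (simp only: exp_less_mono)
    then have \<delta>: "0 < \<delta>" "exp \<delta> < g" using g by (auto simp: \<delta>_def)
    let ?T = "{y'. (\<Sum>i\<in>I. \<bar>y i - y' i\<bar>) < \<delta>}"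
    have "open ?T"
      by (intro open_Collect_less continuous_intros continuous_on_product_coordinates)
    moreover have "y \<in> ?T" using \<delta> by simp
    moreover have "?T \<subseteq> {y. 1 < tent_mass I X y}"
    proof (intro subsetI CollectI)
      fix y' assume "y' \<in> ?T"
      moreover have "\<bar>y i - y' i\<bar> \<le> (\<Sum>i\<in>I. \<bar>y i - y' i\<bar>)" if "i \<in> I" for i
        using finite_I that by (intro member_le_sum) auto
      ultimately have "y i \<le> y' i + \<delta>" if "i \<in> I" for i using that by fastforce
      then have le: "ennreal g \<le> ennreal (exp \<delta>) * tent_mass I X y'"
        using tent_mass_shift[OF finite_I, of y y' \<delta> X] g by simp
      show "1 < tent_mass I X y'"
      proof (rule ccontr)
        assume "\<not> 1 < tent_mass I X y'"
        then have "ennreal (exp \<delta>) * tent_mass I X y' \<le> ennreal (exp \<delta>) * 1"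
          by (intro mult_left_mono) auto
        with le have "ennreal g \<le> ennreal (exp \<delta>)" using order_trans by fastforce
        with \<delta> g show False by (simp add: ennreal_le_iff)
      qed
    qed
    ultimately show "\<exists>T. open T \<and> y \<in> T \<and> T \<subseteq> {y. 1 < tent_mass I X y}" by blast
  qed
  moreover have "- {y. tent_mass I X y \<le> 1} = {y. 1 < tent_mass I X y}" by auto
  ultimately show ?thesis by (simp add: closed_def)
qed

lemma optimal_heights:
  obtains y where "tent_mass I X y \<le> 1"
    "\<And>y'. tent_mass I X y' \<le> 1 \<Longrightarrow> (\<Sum>i\<in>I. w i * y' i) \<le> (\<Sum>i\<in>I. w i * y i)"
proof -
  let ?L = "\<lambda>y. \<Sum>i\<in>I. w i * y i"
  obtain g where g: "tent_mass I X (\<lambda>_. 0) = ennreal g" "0 < g"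
    using tent_mass_pos[of "\<lambda>_. 0"] tent_mass_finite[OF finite_I, of X "\<lambda>_. 0"]
    by (cases "tent_mass I X (\<lambda>_. 0)") auto
  \<comment> \<open>A feasible start: the constant height \<open>- ln g\<close> rescales the flat
    tent of mass \<open>g\<close> to mass at most 1. Its likelihood is the level passed to
    \<open>bounded_heights\<close>.\<close>
  define y0 :: "'a \<Rightarrow> real" where "y0 = (\<lambda>_. - ln g)"
  have y0: "tent_mass I X y0 \<le> 1"
    using tent_mass_shift[OF finite_I, of y0 "\<lambda>_. 0" "- ln g" X] g
    by (simp add: y0_def exp_minus flip: ennreal_mult)
  obtain B where B: "\<And>y i. \<lbrakk>tent_mass I X y \<le> 1; ?L y0 \<le> ?L y; i \<in> I\<rbrakk> \<Longrightarrow> \<bar>y i\<bar> \<le> B"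
    using bounded_heights[of "?L y0"] by blast
  \<comment> \<open>Heights are set to 0 off \<open>I\<close>, where they affect neither the mass
    bound nor the likelihood; the candidates then lie in a compact product even if the index type is
    infinite.\<close>
  define r where "r y = (\<lambda>i. if i \<in> I then y i else 0)" for y :: "'a \<Rightarrow> real"
  have mass_r: "tent_mass I X (r y) \<le> tent_mass I X y" for y
    using tent_mass_shift[OF finite_I, of "r y" y 0 X] by (simp add: r_def)
  have L_r: "?L (r y) = ?L y" for y by (simp add: r_def)
  define Q where "Q = PiE UNIV (\<lambda>i. if i \<in> I then {-B..B} else {0}) \<inter> {y. tent_mass I X y \<le> 1}"
  have "compact (PiE UNIV (\<lambda>i. if i \<in> I then {-B..B} else {0}))"
  proof -
    have "compactin (product_topology (\<lambda>i. euclidean) UNIV) (PiE UNIV (\<lambda>i. if i \<in> I then {-B..B} else {0}))"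
      by (subst compactin_PiE) auto
    then show ?thesis by (simp add: euclidean_product_topology)
  qed
  then have "compact Q" unfolding Q_def by (intro compact_Int_closed closed_tent_mass_le_1)
  have rQ: "r y \<in> Q" if "tent_mass I X y \<le> 1" "?L y0 \<le> ?L y" for y
    using B[OF that] that(1) order_trans[OF mass_r[of y]] by (auto simp: Q_def r_def abs_le_iff) fastforce
  have "continuous_on Q ?L"
    by (intro continuous_intros continuous_on_subset[OF continuous_on_product_coordinates]) auto
  then obtain y where y: "y \<in> Q" "\<And>y'. y' \<in> Q \<Longrightarrow> ?L y' \<le> ?L y"
    using continuous_attains_sup[OF \<open>compact Q\<close>, of ?L] rQ[OF y0] by auto
  show ?thesis
  proof (rule that[of y])
    show "tent_mass I X y \<le> 1" using y by (simp add: Q_def)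
    fix y' assume y': "tent_mass I X y' \<le> 1"
    have y0y: "?L y0 \<le> ?L y" using y(2)[OF rQ[OF y0]] L_r[of y0] by simp
    show "?L y' \<le> ?L y"
    proof (cases "?L y0 \<le> ?L y'")
      case True then show ?thesis using y(2)[OF rQ[OF y']] L_r[of y'] by simp
    next
      case False then show ?thesis using y0y by simp
    qed
  qed
qed

text \<open>Replacing a density \<open>g\<close> by the tent through its log-values at the points
  keeps the likelihood and, by \<open>tent_least\<close>, does not raise the mass. So a linear form
  in the heights is to be maximised under mass at most 1, and rescaling the optimal tent to mass 1
  can only raise its values.\<close>

lemma ex_is_arg_max: "\<exists>f. is_arg_max (expected_log P) (\<lambda>f. f \<in> log_concave_densities) f"
proof -
  obtain y where y: "tent_mass I X y \<le> 1"
    "\<And>y'. tent_mass I X y' \<le> 1 \<Longrightarrow> (\<Sum>i\<in>I. w i * y' i) \<le> (\<Sum>i\<in>I. w i * y i)"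
    using optimal_heights by blast
  obtain m where m: "tent_mass I X y = ennreal m" "0 < m"
    using tent_mass_pos[of y] tent_mass_finite[OF finite_I, of X y] by (cases "tent_mass I X y") auto
  have m1: "m \<le> 1" using y(1) m by (simp add: ennreal_le_1)
  let ?f = "\<lambda>x. (1 / m) * tent I X y x"
  have f: "?f \<in> log_concave_densities"
    using m tent_upper_semicontinuous[OF finite_I] tent_log_concave[OF finite_I]
    by (intro normalize_in_log_concave_densities) (auto simp: tent_mass_def[OF finite_I])
  have ge: "exp (y i) \<le> ?f (X i)" if "i \<in> I" for i
  proof -
    have "exp (y i) \<le> tent I X y (X i)" by (rule tent_ge_exp[OF finite_I that])
    also have "\<dots> \<le> ?f (X i)" using m m1 tent_nonneg[OF finite_I, of X y "X i"]
      using mult_left_le[of m "tent I X y (X i)"] by (simp add: field_simps)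
    finally show ?thesis .
  qed
  have fpos: "0 < ?f (X i)" if "i \<in> I" for i using less_le_trans[OF exp_gt_zero ge[OF that]] .
  have "expected_log P g \<le> expected_log P ?f" if g: "g \<in> log_concave_densities" for g
  proof (cases "\<forall>i\<in>I. 0 < g (X i)")
    case False
    then obtain i where "i \<in> I" "g (X i) \<le> 0" by (auto simp: not_less)
    then show ?thesis using expected_log_eq_MInf[of g i] log_concave_densitiesD(5)[OF g] by simp
  next
    case True
    have "tent_mass I X (\<lambda>i. ln (g (X i))) \<le> (\<integral>\<^sup>+ x. ennreal (g x) \<partial>lborel)"
      unfolding tent_mass_def[OF finite_I] using True
      by (intro nn_integral_mono ennreal_leI tent_least[OF finite_I] log_concave_densitiesD(2)[OF g]) auto
    then have "(\<Sum>i\<in>I. w i * ln (g (X i))) \<le> (\<Sum>i\<in>I. w i * y i)"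
      using y(2) log_concave_densitiesD(3)[OF g] by simp
    also have "\<dots> \<le> (\<Sum>i\<in>I. w i * ln (?f (X i)))"
      using ge fpos w_pos by (intro sum_mono mult_left_mono) (auto simp: ln_ge_iff less_imp_le)
    finally show ?thesis
      using True fpos log_concave_densitiesD(5)[OF g] log_concave_densitiesD(5)[OF f]
      by (simp only: expected_log_eq[of g] expected_log_eq[of ?f]) auto
  qed
  then have "is_arg_max (expected_log P) (\<lambda>f. f \<in> log_concave_densities) ?f"
    using f by (simp add: is_arg_max_linorder)
  then show ?thesis by blast
qed

section \<open>Support and positivity of the chosen maximiser\<close>

abbreviation "f \<equiv> log_concave_projection P"

lemma projection_density: "f \<in> log_concave_densities"
  and projection_maximal: "g \<in> log_concave_densities \<Longrightarrow> expected_log P g \<le> expected_log P f"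
  using ex_is_arg_max is_arg_max_log_concave_projection by blast+

text \<open>A zero at one of the points would make the expected log-likelihood
  \<open>-\<infinity>\<close>, whereas the normalised flat tent has a finite one.\<close>

lemma projection_pos:
  assumes "i \<in> I"
  shows "0 < f (X i)"
proof (rule ccontr)
  assume "\<not> 0 < f (X i)"
  then have "expected_log P f = - \<infinity>"
    using expected_log_eq_MInf[of f i] assms log_concave_densitiesD(5)[OF projection_density] by simp
  moreover obtain m where m: "tent_mass I X (\<lambda>_. 0) = ennreal m" "0 < m"
    using tent_mass_pos[of "\<lambda>_. 0"] tent_mass_finite[OF finite_I, of X "\<lambda>_. 0"]
    by (cases "tent_mass I X (\<lambda>_. 0)") auto
  let ?g = "\<lambda>x. (1 / m) * tent I X (\<lambda>_. 0) x"
  have g: "?g \<in> log_concave_densities"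
    using m tent_upper_semicontinuous[OF finite_I] tent_log_concave[OF finite_I]
    by (intro normalize_in_log_concave_densities) (auto simp: tent_mass_def[OF finite_I])
  have "0 < ?g (X i)" if "i \<in> I" for i
    using m that by (simp add: tent_pos_iff[OF finite_I] hull_inc)
  then have "expected_log P ?g = ereal (\<Sum>i\<in>I. w i * ln (?g (X i)))"
    using log_concave_densitiesD(5)[OF g] by (intro expected_log_eq) auto
  ultimately show False using projection_maximal[OF g] by simp
qed

lemma projection_maximal_real:
  assumes "g \<in> log_concave_densities" "\<And>i. i \<in> I \<Longrightarrow> 0 < g (X i)"
  shows "(\<Sum>i\<in>I. w i * ln (g (X i))) \<le> (\<Sum>i\<in>I. w i * ln (f (X i)))"
  using projection_maximal[OF assms(1)] expected_log_eq[of f] expected_log_eq[of g] assms projection_pos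
    log_concave_densitiesD(5)[OF assms(1)] log_concave_densitiesD(5)[OF projection_density] by simp

text \<open>Cutting \<open>f\<close> down to the hull and renormalising by the retained mass
  \<open>m\<close> adds \<open>- ln m\<close> to the expected log-likelihood; optimality forces
  \<open>m = 1\<close>.\<close>

lemma projection_supported: "AE x in lborel. x \<notin> convex hull (X ` I) \<longrightarrow> f x = 0"
proof -
  let ?C = "convex hull (X ` I)"
  note D = log_concave_densitiesD[OF projection_density]
  note [measurable] = D(5)
  have "compact ?C" using finite_I by (simp add: finite_imp_compact_convex_hull)
  then have C: "closed ?C" "?C \<in> sets borel" by (auto simp: compact_imp_closed borel_compact)
  note [measurable] = C(2)
  let ?h = "\<lambda>x. f x * indicator ?C x"
  \<comment> \<open>The tent through the values of \<open>f\<close> lies below the restriction, so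
    the retained mass is positive and can be divided by.\<close>
  have le: "tent I X (\<lambda>i. ln (f (X i))) x \<le> ?h x" for x
    using projection_pos
    by (intro tent_least[OF finite_I] log_concave_restrict D(2) convex_convex_hull) (auto simp: hull_inc)
  have "0 < tent_mass I X (\<lambda>i. ln (f (X i)))" by (rule tent_mass_pos)
  also have "\<dots> \<le> (\<integral>\<^sup>+ x. ennreal (?h x) \<partial>lborel)"
    unfolding tent_mass_def[OF finite_I] using le by (intro nn_integral_mono ennreal_leI) auto
  finally have pos: "0 < (\<integral>\<^sup>+ x. ennreal (?h x) \<partial>lborel)" .
  have split: "(\<integral>\<^sup>+ x. ennreal (?h x) \<partial>lborel) + (\<integral>\<^sup>+ x. ennreal (f x * indicator (- ?C) x) \<partial>lborel) = 1"
    unfolding D(3)[symmetric]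
    by (subst nn_integral_add[symmetric]) (auto intro!: nn_integral_cong simp: indicator_def D(4))
  have "(\<integral>\<^sup>+ x. ennreal (?h x) \<partial>lborel)
      \<le> (\<integral>\<^sup>+ x. ennreal (?h x) \<partial>lborel) + (\<integral>\<^sup>+ x. ennreal (f x * indicator (- ?C) x) \<partial>lborel)"
    by simp
  also note split
  finally have "(\<integral>\<^sup>+ x. ennreal (?h x) \<partial>lborel) \<le> 1" .
  then obtain m where m: "(\<integral>\<^sup>+ x. ennreal (?h x) \<partial>lborel) = ennreal m" "0 < m" "m \<le> 1"
    using pos by (cases "\<integral>\<^sup>+ x. ennreal (?h x) \<partial>lborel") (auto simp: ennreal_le_1 top_unique)
  let ?g = "\<lambda>x. (1 / m) * ?h x"
  have g: "?g \<in> log_concave_densities"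
    using m D C by (intro normalize_in_log_concave_densities upper_semicontinuous_restrict log_concave_restrict) auto
  have gX: "?g (X i) = f (X i) / m" if "i \<in> I" for i using that by (simp add: hull_inc)
  have "(\<Sum>i\<in>I. w i * ln (?g (X i))) \<le> (\<Sum>i\<in>I. w i * ln (f (X i)))"
    using projection_pos m by (intro projection_maximal_real g) (subst gX, auto)
  also have "(\<Sum>i\<in>I. w i * ln (?g (X i))) = (\<Sum>i\<in>I. w i * ln (f (X i)) - w i * ln m)"
  proof (intro sum.cong refl)
    fix i assume i: "i \<in> I"
    show "w i * ln (?g (X i)) = w i * ln (f (X i)) - w i * ln m"
      using projection_pos[OF i] m unfolding gX[OF i] by (simp add: ln_div algebra_simps)
  qed
  also have "\<dots> = (\<Sum>i\<in>I. w i * ln (f (X i))) - ln m"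
    by (simp add: sum_subtractf sum_w flip: sum_distrib_right)
  finally have "1 \<le> m" using m by simp
  then have m_eq: "m = 1" using m(3) by simp
  have "1 + (\<integral>\<^sup>+ x. ennreal (f x * indicator (- ?C) x) \<partial>lborel) = 1 + 0"
    using split unfolding m(1) m_eq by simp
  then have "(\<integral>\<^sup>+ x. ennreal (f x * indicator (- ?C) x) \<partial>lborel) = 0"
    by (subst (asm) ennreal_add_left_cancel) auto
  then have AE: "AE x in lborel. ennreal (f x * indicator (- ?C) x) = 0"
    by (subst (asm) nn_integral_0_iff_AE) auto
  have "f x = 0" if "ennreal (f x * indicator (- ?C) x) = 0" "x \<notin> ?C" for x
    using that D(4)[of x] by (simp add: ennreal_eq_0_iff)
  with AE show ?thesis by (auto elim!: eventually_mono)
qed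

end


text \<open>A convex set with empty interior lies in a hyperplane, which would then carry all of
  \<open>P\<close>.\<close>

lemma (in weighted_points) spanning_points:
  assumes "P \<in> moment_nondegenerate"
  shows "spanning_points I w X"
proof unfold_locales
  show "interior (convex hull (X ` I)) \<noteq> {}"
  proof
    assume "interior (convex hull (X ` I)) = {}"
    then obtain a b where ab: "a \<noteq> 0" "convex hull (X ` I) \<subseteq> {x. a \<bullet> x = b}"
      using empty_interior_subset_hyperplane[OF convex_convex_hull] by metis
    have "emeasure P {x. a \<bullet> x = b} = (\<Sum>i\<in>I. ennreal (w i) * indicator {x. a \<bullet> x = b} (X i))"
      by (rule emeasure_P) (simp add: closed_hyperplane)
    also have "\<dots> = (\<Sum>i\<in>I. ennreal (w i))"
      using ab(2) by (intro sum.cong) (auto simp: hull_inc subset_iff)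
    also have "\<dots> = 1" using sum_w w_pos by (subst sum_ennreal) (auto intro: less_imp_le)
    finally have "measure P {x. a \<bullet> x = b} = 1" by (simp add: measure_def)
    moreover have "measure P {x. a \<bullet> x = b} < 1" using assms ab(1) by (simp add: moment_nondegenerate_def)
    ultimately show False by simp
  qed
qed

subsection \<open>Lower bounds for the loss\<close>

text \<open>Where \<open>g\<close> vanishes, the Hellinger integrand is \<open>f\<close>
  itself.\<close>

lemma hellinger_sq_ge:
  assumes "AE x in lborel. x \<notin> K \<longrightarrow> g x = 0" "\<And>x. 0 \<le> f x"
  shows "(\<integral>\<^sup>+ x. ennreal (f x) * indicator (- K) x \<partial>lborel) \<le> hellinger_sq g f"
  unfolding hellinger_sq_def
proof (rule nn_integral_mono_AE)
  show "AE x in lborel. ennreal (f x) * indicator (- K) x \<le> ennreal ((sqrt (g x) - sqrt (f x))\<^sup>2)"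
    using assms(1) by eventually_elim (auto simp: indicator_def assms(2))
qed

text \<open>Off the hull the empirical projection vanishes; if it is undefined, the conventional
  loss 2 still exceeds the total mass 1. A general convex \<open>K\<close> instead of the hull lets
  one fixed cube serve for all samples inside it.\<close>

lemma projection_loss_ge:
  assumes f: "log_concave_projection P \<in> log_concave_densities"
    and n: "1 \<le> n" and K: "convex K" "X ` {..<n} \<subseteq> K"
  shows "(\<integral>\<^sup>+ x. ennreal (log_concave_projection P x) * indicator (- K) x \<partial>lborel) \<le> projection_loss P n X"
    (is "?L \<le> _")
proof (cases "empirical n X \<in> moment_nondegenerate")
  case False
  have "?L \<le> (\<integral>\<^sup>+ x. ennreal (log_concave_projection P x) \<partial>lborel)"
    by (intro nn_integral_mono) (auto simp: indicator_def)
  also have "\<dots> = 1" by (rule log_concave_densitiesD(3)[OF f])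
  also have "\<dots> \<le> 2" by simp
  finally show ?thesis using False by (simp add: projection_loss_def)
next
  case True
  interpret weighted_points "{..<n}" "\<lambda>_. 1 / real n" X
    using n by unfold_locales auto
  interpret spanning_points "{..<n}" "\<lambda>_. 1 / real n" X
    using True by (intro spanning_points) (simp add: empirical_eq_discrete_distr)
  have "convex hull (X ` {..<n}) \<subseteq> K" using K by (intro hull_minimal)
  then have "AE x in lborel. x \<notin> K \<longrightarrow> log_concave_projection (empirical n X) x = 0"
    using projection_supported by (auto simp: empirical_eq_discrete_distr elim!: eventually_mono)
  then have "?L \<le> hellinger_sq (log_concave_projection (empirical n X)) (log_concave_projection P)"
    using log_concave_densitiesD(4)[OF f] by (intro hellinger_sq_ge)
  then show ?thesis using True by (simp add: projection_loss_def)
qed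

section \<open>Nondegeneracy and volumes of slabs\<close>

text \<open>The deviation is bounded from every centre \<open>c\<close>: a hyperplane of full
  probability contradicts the bound at its own offset, and \<open>min_abs_deviation\<close> follows
  without computing the mean.\<close>

lemma moment_nondegenerateI:
  fixes P :: "(real ^ 'd) measure"
  assumes "prob_space P" and sets: "sets P = sets borel"
    and fin: "(\<integral>\<^sup>+ x. ennreal (norm x) \<partial>P) < \<infinity>" and "0 < \<epsilon>"
    and dev: "\<And>u c. norm u = 1 \<Longrightarrow> \<epsilon> \<le> (\<integral>x. \<bar>u \<bullet> x - c\<bar> \<partial>P)"
  shows "P \<in> moment_nondegenerate" "\<epsilon> \<le> min_abs_deviation P"
proof -
  interpret prob_space P by fact
  have "measure P {x. a \<bullet> x = b} < 1" if "a \<noteq> 0" for a b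
  proof (rule ccontr)
    assume "\<not> measure P {x. a \<bullet> x = b} < 1"
    then have "prob {x. a \<bullet> x = b} = 1" using prob_le_1[of "{x. a \<bullet> x = b}"] by simp
    then have "AE x in P. x \<in> {x. a \<bullet> x = b}" by (rule prob_eq_1[THEN iffD1, rotated])
      (simp add: sets borel_closed closed_hyperplane)
    then have "AE x in P. \<bar>(a /\<^sub>R norm a) \<bullet> x - b / norm a\<bar> = 0"
      by eventually_elim (use that in \<open>auto simp: divide_simps\<close>)
    then have "(\<integral>x. \<bar>(a /\<^sub>R norm a) \<bullet> x - b / norm a\<bar> \<partial>P) = 0" by (rule integral_eq_zero_AE)
    moreover have "norm (a /\<^sub>R norm a) = 1" using that by simp
    ultimately show False using dev[of "a /\<^sub>R norm a" "b / norm a"] \<open>0 < \<epsilon>\<close> by simp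
  qed
  then show "P \<in> moment_nondegenerate"
    using assms by (simp add: moment_nondegenerate_def)
  show "\<epsilon> \<le> min_abs_deviation P"
    unfolding min_abs_deviation_def
  proof (rule cINF_greatest)
    show "{u :: real ^ 'd. norm u = 1} \<noteq> {}" using norm_axis_1 by blast
    show "\<epsilon> \<le> (\<integral>x. \<bar>u \<bullet> (x - mean P)\<bar> \<partial>P)" if "u \<in> {u. norm u = 1}" for u
      using dev[of u "u \<bullet> mean P"] that by (simp add: inner_diff_right)
  qed
qed

text \<open>The absolute values of the coordinates add up to at least the norm, so one of them
  reaches \<open>1 / d\<close>.\<close>

lemma unit_vector_large_coordinate:
  fixes u :: "real ^ 'd"
  assumes "norm u = 1"
  obtains k where "1 \<le> real CARD('d) * \<bar>u $ k\<bar>"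
proof (rule ccontr)
  assume "\<not> thesis"
  then have "\<not> 1 \<le> real CARD('d) * \<bar>u $ k\<bar>" for k using that by blast
  then have "\<bar>u $ k\<bar> < 1 / CARD('d)" for k by (simp add: field_simps not_le)
  then have "(\<Sum>k\<in>UNIV. \<bar>u $ k\<bar>) < (\<Sum>k\<in>(UNIV :: 'd set). 1 / CARD('d))"
    by (intro sum_strict_mono) auto
  also have "\<dots> = 1" by simp
  finally show False using norm_le_l1_cart[of u] assms by simp
qed

text \<open>The slab is compared with \<open>N\<close> disjoint translates of itself along the \<open>k\<close>-th axis, all
  contained in one long box.\<close>

lemma measure_cube_slab_le:
  fixes u c :: "real ^ 'd" and a h \<omega> :: real
  assumes k: "1 \<le> real CARD('d) * \<bar>u $ k\<bar>" and h: "0 < h" and \<omega>: "0 < \<omega>"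
  defines "S \<equiv> {y. (\<forall>i. \<bar>y $ i - c $ i\<bar> \<le> \<omega>) \<and> a \<le> u \<bullet> y \<and> u \<bullet> y \<le> a + h}"
  shows "S \<in> sets borel" "emeasure lborel S < \<infinity>"
    "measure lborel S \<le> (2 * \<omega>) ^ (CARD('d) - 1) * (6 * h * CARD('d))"
proof -
  have uk: "u $ k \<noteq> 0" using k by auto
  \<comment> \<open>A shift by \<open>s\<close> along the axis changes \<open>u \<bullet> y\<close>
    by \<open>2 * h\<close>, so consecutive translates are a gap \<open>h\<close> apart.\<close>
  define s where "s = 2 * h / u $ k"
  have s_le: "\<bar>s\<bar> \<le> 2 * h * CARD('d)"
    using k h uk by (simp add: s_def abs_divide field_simps)
  have S_eq: "S = cbox (c - (\<chi> i. \<omega>)) (c + (\<chi> i. \<omega>)) \<inter> {y. a \<le> u \<bullet> y} \<inter> {y. u \<bullet> y \<le> a + h}"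
    by (auto simp: S_def mem_box_cart abs_le_iff algebra_simps)
  have "closed S" unfolding S_eq
    by (intro closed_Int closed_cbox closed_Collect_le continuous_intros)
  then show S_borel [measurable]: "S \<in> sets borel" by (rule borel_closed)
  show S_fin: "emeasure lborel S < \<infinity>"
    by (rule emeasure_bounded_finite) (auto simp: S_eq intro: bounded_subset[OF bounded_cbox])
  \<comment> \<open>\<open>N\<close> is so large that the initial width \<open>\<omega>\<close> is
    absorbed: \<open>\<omega> + N * \<bar>s\<bar> \<le> 3 * N * h * d\<close>, whence the factor
    6.\<close>
  obtain N :: nat where N: "\<omega> / (h * CARD('d)) < N" using reals_Archimedean2 by blast
  moreover have "0 < \<omega> / (h * CARD('d))" using h \<omega> by simp
  ultimately have N0: "0 < N" using of_nat_0_less_iff order.strict_trans by blast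
  define F where "F j = {y. (- real j * s) *\<^sub>R axis k 1 + y \<in> S}" for j :: nat
  have F_borel: "F j \<in> sets lborel" for j unfolding F_def by measurable
  have F_emeasure: "emeasure lborel (F j) = emeasure lborel S" for j
  proof -
    have "emeasure lborel S = emeasure (distr lborel borel ((+) ((- real j * s) *\<^sub>R axis k 1))) S"
      by (simp add: lborel_distr_plus)
    also have "\<dots> = emeasure lborel (F j)"
      by (subst emeasure_distr) (auto simp: F_def vimage_def)
    finally show ?thesis by simp
  qed
  have F_inner: "a + 2 * j * h \<le> u \<bullet> y \<and> u \<bullet> y \<le> a + 2 * j * h + h" if "y \<in> F j" for j y
    using that uk by (auto simp: F_def S_def inner_simps inner_axis s_def field_simps)
  have disj: "disjoint_family_on F {..<N}"
    unfolding disjoint_family_on_def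
  proof (intro ballI impI)
    have aux: "F i \<inter> F j = {}" if "i < j" for i j :: nat
    proof -
      have "2 * real i * h + h < 2 * real j * h"
      proof -
        have "(2 * real i + 1) * h < (2 * real j) * h" using that h by (intro mult_strict_right_mono) auto
        then show ?thesis by (simp add: algebra_simps)
      qed
      then show ?thesis using F_inner[of _ i] F_inner[of _ j] by fastforce
    qed
    fix i j :: nat assume "i \<noteq> j"
    then show "F i \<inter> F j = {}" using aux[of i j] aux[of j i] by (cases i j rule: linorder_cases) auto
  qed
  define e where "e = (\<chi> i. if i = k then \<omega> + N * \<bar>s\<bar> else \<omega>)"
  have "(\<Union>j\<in>{..<N}. F j) \<subseteq> cbox (c - e) (c + e)"
  proof (intro UN_least subsetI)
    fix j y assume "j \<in> {..<N}" "y \<in> F j"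
    then have y: "\<bar>(- real j * s) * (if i = k then 1 else 0) + y $ i - c $ i\<bar> \<le> \<omega>" for i
      by (auto simp: F_def S_def axis_def)
    have "\<bar>real j * s\<bar> \<le> N * \<bar>s\<bar>" using \<open>j \<in> _\<close> by (simp add: abs_mult mult_right_mono)
    then have "\<bar>y $ i - c $ i\<bar> \<le> e $ i" for i
      using y[of i] by (auto simp: e_def abs_le_iff split: if_splits)
    then show "y \<in> cbox (c - e) (c + e)"
      by (auto simp: mem_box_cart abs_le_iff algebra_simps)
  qed
  then have "measure lborel (\<Union>j\<in>{..<N}. F j) \<le> measure lborel (cbox (c - e) (c + e))"
    using F_borel by (intro measure_mono_fmeasurable) auto
  also have "measure lborel (\<Union>j\<in>{..<N}. F j) = (\<Sum>j\<in>{..<N}. measure lborel (F j))"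
    using F_borel F_emeasure S_fin by (intro measure_finite_Union disj) auto
  also have "\<dots> = N * measure lborel S" using F_emeasure by (simp add: measure_def)
  also have "measure lborel (cbox (c - e) (c + e)) = (\<Prod>i\<in>UNIV. 2 * e $ i)"
  proof -
    have "c \<in> cbox (c - e) (c + e)" using \<omega> by (auto simp: mem_box_cart e_def intro!: add_nonneg_nonneg)
    then show ?thesis by (subst content_cbox_cart) (auto intro!: prod.cong)
  qed
  also have "\<dots> = 2 * e $ k * (\<Prod>i\<in>UNIV - {k}. 2 * e $ i)" by (simp add: prod.remove)
  also have "(\<Prod>i\<in>UNIV - {k}. 2 * e $ i) = (\<Prod>i\<in>UNIV - {k}. 2 * \<omega>)"
    by (intro prod.cong) (auto simp: e_def)
  also have "\<dots> = (2 * \<omega>) ^ (CARD('d) - 1)" by (simp add: card_Diff_singleton)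
  finally have "N * measure lborel S \<le> (2 * (\<omega> + N * \<bar>s\<bar>)) * (2 * \<omega>) ^ (CARD('d) - 1)"
    by (simp add: e_def)
  also have "\<dots> \<le> (N * (6 * h * CARD('d))) * (2 * \<omega>) ^ (CARD('d) - 1)"
  proof (rule mult_right_mono)
    have "\<omega> \<le> N * (h * CARD('d))" using N h by (simp add: field_simps)
    moreover have "N * \<bar>s\<bar> \<le> N * (2 * h * CARD('d))" by (intro mult_left_mono s_le) auto
    ultimately show "2 * (\<omega> + N * \<bar>s\<bar>) \<le> N * (6 * h * CARD('d))" by (simp add: algebra_simps)
  qed (use \<omega> in auto)
  finally have "N * measure lborel S \<le> N * ((2 * \<omega>) ^ (CARD('d) - 1) * (6 * h * CARD('d)))"
    by (simp add: mult_ac)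
  then show "measure lborel S \<le> (2 * \<omega>) ^ (CARD('d) - 1) * (6 * h * CARD('d))"
    using N0 by (simp add: mult_le_cancel_left)
qed

subsection \<open>Uniform distributions on convex bodies\<close>

text \<open>Gibbs' inequality from \<open>ln t \<le> t - 1\<close> at \<open>t = V * g x\<close>,
  whose mean under \<open>P\<close> is at most 1 because \<open>g\<close> has total mass 1. Equality
  forces \<open>t = 1\<close> almost everywhere on \<open>C\<close>; this second claim pins down
  whichever maximiser is chosen.\<close>

lemma expected_log_uniform:
  fixes C :: "(real ^ 'd) set" and g :: "real ^ 'd \<Rightarrow> real"
  assumes C [measurable]: "C \<in> sets borel" and V: "emeasure lborel C = ennreal V" "0 < V"
    and g: "g \<in> log_concave_densities"
  defines "P \<equiv> uniform_measure lborel C"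
  shows "expected_log P g \<le> ereal (- ln V)"
    and "ereal (- ln V) \<le> expected_log P g \<Longrightarrow> AE x in lborel. x \<in> C \<longrightarrow> g x = 1 / V"
proof -
  note D = log_concave_densitiesD[OF g]
  note [measurable] = D(5)
  interpret prob_space P unfolding P_def using V by (intro prob_space_uniform_measure) auto
  have sets_P [measurable_cong, simp]: "sets P = sets borel" by (simp add: P_def)
  have "(\<lambda>x. log_ext (g x)) \<in> borel_measurable borel"
    unfolding log_ext_def by measurable
  then have [measurable]: "(\<lambda>x. log_ext (g x)) \<in> borel_measurable P"
    using measurable_cong_sets[OF sets_P refl] by blast
  have [measurable]: "g \<in> borel_measurable P"
    using D(5) measurable_cong_sets[OF sets_P refl] by blast
  have nn_P: "(\<integral>\<^sup>+ x. f x \<partial>P) = (\<integral>\<^sup>+ x. f x * indicator C x \<partial>lborel) / ennreal V"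
    if [measurable]: "f \<in> borel_measurable borel" for f
    unfolding P_def using V by (subst nn_integral_uniform_measure) auto
  have "(\<integral>\<^sup>+ x. ennreal (g x) * indicator C x \<partial>lborel) \<le> (\<integral>\<^sup>+ x. ennreal (g x) \<partial>lborel)"
    by (intro nn_integral_mono) (auto simp: indicator_def)
  then have "(\<integral>\<^sup>+ x. ennreal (g x) \<partial>P) \<le> 1 / ennreal V"
    using D(3) by (simp add: nn_P divide_right_mono_ennreal)
  also have "1 / ennreal V = ennreal (1 / V)"
    using V by (simp add: divide_ennreal flip: ennreal_1)
  finally have g_le: "(\<integral>\<^sup>+ x. ennreal (g x) \<partial>P) \<le> ennreal (1 / V)" .
  then have g_int: "integrable P g"
    using D(4) by (auto simp: integrable_iff_bounded intro: le_less_trans)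
  have "(\<integral>x. g x \<partial>P) \<le> 1 / V"
    using g_le V D(4) g_int by (subst (asm) nn_integral_eq_integral) (auto simp: ennreal_le_iff)
  then have g_mean: "V * (\<integral>x. g x \<partial>P) \<le> 1" using V by (simp add: field_simps)
  let ?A = "\<integral>\<^sup>+ x. e2ennreal (log_ext (g x)) \<partial>P" and ?B = "\<integral>\<^sup>+ x. e2ennreal (- log_ext (g x)) \<partial>P"
  have "e2ennreal (log_ext (g x)) \<le> ennreal (g x)" for x
    using ln_le_minus_one[of "g x"] by (auto simp: log_ext_def e2ennreal_neg ennreal_def[symmetric] intro!: ennreal_leI)
  then have "?A \<le> (\<integral>\<^sup>+ x. ennreal (g x) \<partial>P)" by (intro nn_integral_mono)
  from order_trans[OF this g_le] have A_fin: "?A < \<infinity>" by (rule le_less_trans) simp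
  have "expected_log P g \<le> ereal (- ln V) \<and>
    (ereal (- ln V) \<le> expected_log P g \<longrightarrow> (AE x in lborel. x \<in> C \<longrightarrow> g x = 1 / V))"
  proof (cases "?B = \<infinity>")
    case True
    then have "expected_log P g = - \<infinity>"
      using A_fin by (cases ?A) (auto simp: expected_log_def)
    then show ?thesis by simp
  next
    case False
    have "AE x in P. e2ennreal (- log_ext (g x)) \<noteq> \<infinity>"
      using False by (intro nn_integral_PInf_AE) auto
    then have pos: "AE x in P. 0 < g x" by eventually_elim (auto simp: log_ext_def split: if_splits)
    have A_eq: "?A = (\<integral>\<^sup>+ x. ennreal (ln (g x)) \<partial>P)"
      using pos by (intro nn_integral_cong_AE) (auto simp: log_ext_def ennreal_def[symmetric] elim!: eventually_mono)
    have B_eq: "?B = (\<integral>\<^sup>+ x. ennreal (- ln (g x)) \<partial>P)"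
      using pos by (intro nn_integral_cong_AE) (auto simp: log_ext_def ennreal_def[symmetric] elim!: eventually_mono)
    have ln_int: "integrable P (\<lambda>x. ln (g x))"
      using A_fin False A_eq B_eq by (auto simp: real_integrable_def)
    have E: "expected_log P g = ereal (\<integral>x. ln (g x) \<partial>P)"
      using A_fin False unfolding expected_log_def real_lebesgue_integral_def[OF ln_int]
      by (cases ?A; cases ?B) (auto simp: A_eq[symmetric] B_eq[symmetric])
    let ?r = "\<lambda>x. V * g x - 1 - ln V - ln (g x)"
    have r_int: "integrable P ?r" using g_int ln_int by auto
    have r: "ln (V * g x) = ln V + ln (g x)" if "0 < g x" for x using that V by (simp add: ln_mult)
    have r_nn: "AE x in P. 0 \<le> ?r x"
      using pos
    proof eventually_elim
      case (elim x)
      then show ?case using ln_le_minus_one[of "V * g x"] r[of x] V by simp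
    qed
    have r_eq: "(\<integral>x. ?r x \<partial>P) = V * (\<integral>x. g x \<partial>P) - 1 - ln V - (\<integral>x. ln (g x) \<partial>P)"
      using g_int ln_int by (simp add: prob_space)
    have "0 \<le> (\<integral>x. ?r x \<partial>P)" using r_nn by (rule integral_nonneg_AE)
    then have le: "(\<integral>x. ln (g x) \<partial>P) \<le> - ln V" using r_eq g_mean by linarith
    have "AE x in lborel. x \<in> C \<longrightarrow> g x = 1 / V" if "- ln V \<le> (\<integral>x. ln (g x) \<partial>P)"
    proof -
      have "(\<integral>x. ?r x \<partial>P) = 0" using that r_eq g_mean \<open>0 \<le> (\<integral>x. ?r x \<partial>P)\<close> by linarith
      then have "AE x in P. ?r x = 0" using integral_nonneg_eq_0_iff_AE[OF r_int r_nn] by simp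
      with pos have "AE x in P. g x = 1 / V"
      proof eventually_elim
        case (elim x)
        then have "V * g x = 1" using r[of x] V by (intro ln_eq_minus_one) auto
        then show ?case using V by (simp add: field_simps)
      qed
      then show ?thesis unfolding P_def using V by (subst (asm) AE_uniform_measure) auto
    qed
    with le show ?thesis unfolding E by simp
  qed
  then show "expected_log P g \<le> ereal (- ln V)"
    and "ereal (- ln V) \<le> expected_log P g \<Longrightarrow> AE x in lborel. x \<in> C \<longrightarrow> g x = 1 / V" by auto
qed

lemma uniform_density_log_concave:
  fixes C :: "(real ^ 'd) set"
  assumes "closed C" "convex C" and V: "emeasure lborel C = ennreal V" "0 < V"
  shows "(\<lambda>x. (1 / V) * (1 * indicator C x)) \<in> log_concave_densities"
proof (rule normalize_in_log_concave_densities[OF _ _ _ V(2)])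
  show "upper_semicontinuous (\<lambda>x. 1 * indicator C x :: real)"
    using assms by (intro upper_semicontinuous_restrict) (auto simp: upper_semicontinuous_def)
  show "log_concave (\<lambda>x. 1 * indicator C x :: real)"
    using assms by (intro log_concave_restrict) (auto intro!: log_concaveI)
  show "(\<integral>\<^sup>+ x. ennreal (1 * indicator C x) \<partial>lborel) = ennreal V"
    using assms by (simp add: ennreal_indicator)
qed

text \<open>The normalised indicator of \<open>C\<close> attains the Gibbs bound and is thus a
  maximiser; the chosen maximiser then attains the bound as well, and the equality case applies to
  it.\<close>

lemma projection_uniform:
  fixes C :: "(real ^ 'd) set"
  assumes C: "closed C" "convex C" and V: "emeasure lborel C = ennreal V" "0 < V"
  defines "P \<equiv> uniform_measure lborel C"
  shows "log_concave_projection P \<in> log_concave_densities"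
    and "AE x in lborel. x \<in> C \<longrightarrow> log_concave_projection P x = 1 / V"
proof -
  have [measurable]: "C \<in> sets borel" using C by (simp add: borel_closed)
  let ?f = "\<lambda>x. (1 / V) * (1 * indicator C x)"
  have f: "?f \<in> log_concave_densities" using assms by (intro uniform_density_log_concave)
  note [measurable] = log_concave_densitiesD(5)[OF f]
  interpret prob_space P unfolding P_def using V by (intro prob_space_uniform_measure) auto
  have AE: "AE x in P. x \<in> C" unfolding P_def by (intro AE_uniform_measureI) auto
  have const: "(\<integral>\<^sup>+ x. e2ennreal (s * log_ext (?f x)) \<partial>P) = ennreal (s * ln (1 / V))" for s :: real
  proof -
    have "(\<integral>\<^sup>+ x. e2ennreal (s * log_ext (?f x)) \<partial>P) = (\<integral>\<^sup>+ x. ennreal (s * ln (1 / V)) \<partial>P)"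
    proof (rule nn_integral_cong_AE)
      show "AE x in P. e2ennreal (s * log_ext (?f x)) = ennreal (s * ln (1 / V))"
        using AE by eventually_elim (use V in \<open>simp add: log_ext_def ennreal_def[symmetric]\<close>)
    qed
    then show ?thesis by (simp add: emeasure_space_1)
  qed
  have neg: "ereal (- 1) * z = - z" for z by (cases z) auto
  have "expected_log P ?f = ereal (ln (1 / V))"
    using const[of 1] const[of "-1"] unfolding expected_log_def
    by (cases "0 \<le> ln (1 / V)") (auto simp: neg ennreal_neg zero_ennreal.rep_eq one_ereal_def[symmetric])
  then have E: "expected_log P ?f = ereal (- ln V)" using V by (simp add: ln_div)
  have "is_arg_max (expected_log P) (\<lambda>f. f \<in> log_concave_densities) ?f"
    using f expected_log_uniform(1)[OF _ V, folded P_def] E by (simp add: is_arg_max_linorder)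
  note M = is_arg_max_log_concave_projection[OF this]
  show "log_concave_projection P \<in> log_concave_densities" by (rule M)
  then show "AE x in lborel. x \<in> C \<longrightarrow> log_concave_projection P x = 1 / V"
    unfolding P_def using M(2)[OF f] E
    by (intro expected_log_uniform(2) V) (auto simp: P_def)
qed


text \<open>If the cap cut off at a point \<open>x\<close> of \<open>A\<close> contains no sample
  point, then \<open>x\<close> lies outside the hull and the density \<open>1 / V\<close> at
  \<open>x\<close> is lost. This happens with probability at least 1/2, and exchanging the integrals
  over \<open>x\<close> and over the sample gives half the probability of \<open>A\<close>.\<close>

lemma projection_risk_uniform_ge:
  fixes C :: "(real ^ 'd) set"
  assumes C: "closed C" "convex C" and V: "emeasure lborel C = ennreal V" "0 < V"
    and n: "1 \<le> n" and A: "A \<in> sets borel" "A \<subseteq> C"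
  defines "P \<equiv> uniform_measure lborel C"
  assumes cap: "\<And>x. x \<in> A \<Longrightarrow> measure P {y. x \<bullet> x \<le> x \<bullet> y} \<le> 1 / (2 * real n)"
  shows "ennreal (1 / (2 * V)) * emeasure lborel A \<le> projection_risk n P"
proof -
  note [measurable] = A(1)
  interpret prob_space P unfolding P_def using V by (intro prob_space_uniform_measure) auto
  have sets_P: "sets P = sets borel" and space_P: "space P = UNIV" by (simp_all add: P_def)
  interpret product: product_prob_space "\<lambda>_. P" "{..<n}" ..
  let ?\<Pi> = "Pi\<^sub>M {..<n} (\<lambda>_. P)"
  interpret fin: finite_product_prob_space "\<lambda>_. P" "{..<n}" by standard simp
  interpret pair_sigma_finite lborel ?\<Pi> ..
  \<comment> \<open>Asking for an empty cap instead of \<open>x\<close> outside the hull makes joint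
    measurability, which Fubini demands, immediate.\<close>
  define F :: "real ^ 'd \<Rightarrow> (nat \<Rightarrow> real ^ 'd) \<Rightarrow> ennreal" where
    "F x X = (if x \<in> A \<and> (\<forall>i\<in>{..<n}. x \<bullet> X i < x \<bullet> x) then ennreal (1 / V) else 0)" for x X
  have [measurable]: "(\<lambda>X. X i) \<in> ?\<Pi> \<rightarrow>\<^sub>M borel" if "i \<in> {..<n}" for i
    using measurable_component_singleton[OF that, of "\<lambda>_. P"] measurable_cong_sets[OF refl sets_P] by blast
  have F_meas: "case_prod F \<in> borel_measurable (lborel \<Otimes>\<^sub>M ?\<Pi>)"
    unfolding F_def by measurable
  have loss: "(\<integral>\<^sup>+ x. F x X \<partial>lborel) \<le> projection_loss P n X" for X
  proof -
    let ?K = "convex hull (X ` {..<n})"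
    have "x \<notin> ?K" if "\<forall>i\<in>{..<n}. x \<bullet> X i < x \<bullet> x" for x
    proof -
      have "?K \<subseteq> {y. x \<bullet> y < x \<bullet> x}" using that by (intro hull_minimal convex_halfspace_lt) auto
      then show ?thesis by auto
    qed
    then have "AE x in lborel. F x X \<le> ennreal (log_concave_projection P x) * indicator (- ?K) x"
      using projection_uniform(2)[OF C V, folded P_def] A(2)
      by (auto simp: F_def elim!: eventually_mono)
    then have "(\<integral>\<^sup>+ x. F x X \<partial>lborel)
        \<le> (\<integral>\<^sup>+ x. ennreal (log_concave_projection P x) * indicator (- ?K) x \<partial>lborel)"
      by (rule nn_integral_mono_AE)
    also have "\<dots> \<le> projection_loss P n X"
      using projection_uniform(1)[OF C V, folded P_def] n
      by (intro projection_loss_ge) (auto simp: hull_inc)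
    finally show ?thesis .
  qed
  have miss: "ennreal (1 / (2 * V)) \<le> (\<integral>\<^sup>+ X. F x X \<partial>?\<Pi>)" if "x \<in> A" for x
  proof -
    let ?H = "{y. x \<bullet> y < x \<bullet> x}"
    have H: "?H \<in> sets P" by (simp add: sets_P borel_open open_halfspace_lt)
    have "- ?H = {y. x \<bullet> x \<le> x \<bullet> y}" by auto
    then have "1 - prob ?H \<le> 1 / (2 * real n)"
      using cap[OF that] prob_compl[OF H] by (simp add: space_P Compl_eq_Diff_UNIV)
    then have le: "1 - 1 / (2 * real n) \<le> prob ?H" by simp
    \<comment> \<open>Bernoulli's inequality: \<open>n\<close> independent misses, each of
      probability at least \<open>1 - 1 / (2 * n)\<close>, occur together with probability at least
      1/2.\<close>
    have "1 / 2 = 1 + real n * (- 1 / (2 * real n))" using n by simp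
    also have "\<dots> \<le> (1 + (- 1 / (2 * real n))) ^ n"
      using n by (intro Bernoulli_inequality) (simp add: field_simps)
    also have "\<dots> \<le> prob ?H ^ n" using le n by (intro power_mono) (auto simp: field_simps)
    finally have half: "1 / 2 \<le> prob ?H ^ n" .
    have "ennreal (1 / (2 * V)) = ennreal (1 / V) * ennreal (1 / 2)"
      using V by (subst ennreal_mult[symmetric]) auto
    also have "\<dots> \<le> ennreal (1 / V) * ennreal (prob ?H ^ n)"
      using half by (intro mult_left_mono ennreal_leI) auto
    also have "ennreal (prob ?H ^ n) = emeasure ?\<Pi> (PiE {..<n} (\<lambda>_. ?H))"
      using H by (subst product.emeasure_PiM) (auto simp: emeasure_eq_measure ennreal_power)
    also have "ennreal (1 / V) * \<dots> = (\<integral>\<^sup>+ X. ennreal (1 / V) * indicator (PiE {..<n} (\<lambda>_. ?H)) X \<partial>?\<Pi>)"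
      using H by (subst nn_integral_cmult_indicator) (auto intro!: sets_PiM_I_finite)
    also have "\<dots> = (\<integral>\<^sup>+ X. F x X \<partial>?\<Pi>)"
      using that by (intro nn_integral_cong) (auto simp: F_def indicator_def space_PiM PiE_iff)
    finally show ?thesis .
  qed
  have "ennreal (1 / (2 * V)) * emeasure lborel A = (\<integral>\<^sup>+ x. ennreal (1 / (2 * V)) * indicator A x \<partial>lborel)"
    by (subst nn_integral_cmult_indicator) auto
  also have "\<dots> \<le> (\<integral>\<^sup>+ x. (\<integral>\<^sup>+ X. F x X \<partial>?\<Pi>) \<partial>lborel)"
    using miss by (intro nn_integral_mono) (auto simp: indicator_def)
  also have "\<dots> = (\<integral>\<^sup>+ X. (\<integral>\<^sup>+ x. F x X \<partial>lborel) \<partial>?\<Pi>)"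
    using F_meas by (rule Fubini'[symmetric])
  \<comment> \<open>Monotonicity of the nonnegative integral asks no measurability of the larger
    function, so the loss enters only through its measurable minorant.\<close>
  also have "\<dots> \<le> projection_risk n P"
    unfolding projection_risk_def using loss by (intro nn_integral_mono)
  finally show ?thesis .
qed

subsection \<open>The uniform distribution on the unit ball\<close>

definition ball_distr :: "(real ^ 'd) measure" where
  "ball_distr = uniform_measure lborel (cball 0 1)"

lemma emeasure_unit_cball:
  "emeasure lborel (cball (0 :: real ^ 'd) 1) = ennreal (measure lborel (cball (0 :: real ^ 'd) 1))"
  using emeasure_lborel_cball_finite[of "0 :: real ^ 'd" 1] by (intro emeasure_eq_ennreal_measure) auto

lemma measure_unit_cball_pos: "0 < measure lborel (cball (0 :: real ^ 'd) 1)"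
  by (rule content_cball_pos) simp

lemma prob_space_ball_distr: "prob_space ball_distr"
  unfolding ball_distr_def using measure_unit_cball_pos
  by (intro prob_space_uniform_measure) (auto simp: emeasure_unit_cball)

lemma sets_ball_distr [simp, measurable_cong]: "sets ball_distr = sets borel"
  and space_ball_distr [simp]: "space ball_distr = UNIV"
  by (simp_all add: ball_distr_def)

lemma measure_ball_distr:
  fixes A :: "(real ^ 'd) set"
  assumes [measurable]: "A \<in> sets borel"
  shows "measure ball_distr A
    = measure lborel (cball 0 1 \<inter> A) / measure lborel (cball (0 :: real ^ 'd) 1)"
  unfolding ball_distr_def using measure_unit_cball_pos
  by (subst measure_uniform_measure) (auto simp: emeasure_unit_cball)

lemma AE_ball_distr: "AE x in ball_distr. norm x \<le> 1"
  unfolding ball_distr_def by (intro AE_uniform_measureI) auto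

text \<open>\<open>t\<close> makes the bound of \<open>measure_cube_slab_le\<close> for the slab of
  half-width \<open>t\<close> equal to half the volume of the ball, so \<open>u \<bullet> x\<close>
  is at distance at least \<open>t\<close> from \<open>c\<close> with probability at least
  1/2.\<close>

lemma ball_distr_abs_deviation:
  fixes u :: "real ^ 'd"
  defines "t \<equiv> measure lborel (cball (0 :: real ^ 'd) 1) / (12 * CARD('d) * 2 ^ CARD('d))"
  assumes u: "norm u = 1"
  shows "t / 2 \<le> (\<integral>x. \<bar>u \<bullet> x - c\<bar> \<partial>ball_distr)"
proof -
  interpret prob_space "ball_distr :: (real ^ 'd) measure" by (rule prob_space_ball_distr)
  let ?V = "measure lborel (cball (0 :: real ^ 'd) 1)"
  have V: "0 < ?V" by (rule measure_unit_cball_pos)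
  have t: "0 < t" using V by (simp add: t_def)
  obtain k where k: "1 \<le> real CARD('d) * \<bar>u $ k\<bar>" using unit_vector_large_coordinate[OF u] by blast
  let ?S = "{y. (\<forall>i. \<bar>y $ i - (0 :: real ^ 'd) $ i\<bar> \<le> 1) \<and> c - t \<le> u \<bullet> y \<and> u \<bullet> y \<le> (c - t) + 2 * t}"
  have S: "?S \<in> sets borel" "emeasure lborel ?S < \<infinity>"
    "measure lborel ?S \<le> (2 * 1) ^ (CARD('d) - 1) * (6 * (2 * t) * CARD('d))"
    using measure_cube_slab_le[OF k, of "2 * t" 1 0 "c - t"] t by auto
  let ?N = "{x. \<bar>u \<bullet> x - c\<bar> < t}"
  have N [measurable]: "?N \<in> sets borel" by measurable
  have "cball 0 1 \<inter> ?N \<subseteq> ?S"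
    using component_le_norm_cart order_trans by (fastforce simp: abs_less_iff)
  then have "measure lborel (cball 0 1 \<inter> ?N) \<le> measure lborel ?S"
    using S by (intro measure_mono_fmeasurable) (auto simp: fmeasurable_def)
  also have "\<dots> \<le> ?V / 2"
  proof -
    have "(2 :: real) ^ CARD('d) = 2 * 2 ^ (CARD('d) - 1)" by (simp flip: power_Suc)
    then show ?thesis using S(3) by (simp add: t_def field_simps)
  qed
  finally have "prob ?N \<le> 1 / 2" using V by (simp add: measure_ball_distr field_simps)
  then have half: "1 / 2 \<le> prob (UNIV - ?N)" using prob_compl[of ?N] by simp
  have int: "integrable ball_distr (\<lambda>x. \<bar>u \<bullet> x - c\<bar>)"
  proof (rule integrable_const_bound[where B = "1 + \<bar>c\<bar>"])
    show "AE x in ball_distr. norm \<bar>u \<bullet> x - c\<bar> \<le> 1 + \<bar>c\<bar>"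
      using AE_ball_distr
    proof eventually_elim
      case (elim x)
      have "\<bar>u \<bullet> x\<bar> \<le> 1" using Cauchy_Schwarz_ineq2[of u x] u elim by simp
      then show ?case by simp
    qed
    have "(\<lambda>x. \<bar>u \<bullet> x - c\<bar>) \<in> borel_measurable borel" by measurable
    then show "(\<lambda>x. \<bar>u \<bullet> x - c\<bar>) \<in> borel_measurable ball_distr"
      using measurable_cong_sets[OF sets_ball_distr refl] by blast
  qed
  have "t / 2 = t * (1 / 2)" by simp
  also have "\<dots> \<le> t * prob (UNIV - ?N)" by (rule mult_left_mono[OF half less_imp_le[OF t]])
  also have "\<dots> = (\<integral>x. t * indicator (UNIV - ?N) x \<partial>ball_distr)"
    by (simp only: integral_mult_right_zero Bochner_Integration.integral_indicator space_ball_distr Int_UNIV_right)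
  also have "\<dots> \<le> (\<integral>x. \<bar>u \<bullet> x - c\<bar> \<partial>ball_distr)"
  proof (rule integral_mono[OF _ int])
    have "integrable ball_distr (indicator (UNIV - ?N) :: _ \<Rightarrow> real)"
      by (rule integrable_real_indicator) (simp_all add: emeasure_eq_measure)
    then show "integrable ball_distr (\<lambda>x. t * indicator (UNIV - ?N) x)" by simp
    show "t * indicator (UNIV - ?N) x \<le> \<bar>u \<bullet> x - c\<bar>" for x
      by (cases "x \<in> ?N") (simp_all add: not_less)
  qed
  finally show ?thesis .
qed

lemma ball_distr_moment:
  assumes "0 \<le> q"
  shows "(\<integral>\<^sup>+ x. ennreal (norm x powr q) \<partial>(ball_distr :: (real ^ 'd) measure)) \<le> 1"
proof -
  interpret prob_space "ball_distr :: (real ^ 'd) measure" by (rule prob_space_ball_distr)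
  have "(\<integral>\<^sup>+ x. ennreal (norm x powr q) \<partial>(ball_distr :: (real ^ 'd) measure)) \<le> (\<integral>\<^sup>+ x. 1 \<partial>(ball_distr :: (real ^ 'd) measure))"
  proof (rule nn_integral_mono_AE)
    show "AE x in ball_distr. ennreal (norm (x :: real ^ 'd) powr q) \<le> 1"
      using AE_ball_distr by eventually_elim (use assms in \<open>simp add: powr_le1\<close>)
  qed
  then show ?thesis using emeasure_space_1 by simp
qed

text \<open>With \<open>u\<close> the direction of \<open>x\<close>, the cap has thickness at most
  \<open>s^2\<close> along \<open>u\<close>, and
  \<open>norm (y - u)^2 \<le> 2 - 2 * (1 - s^2)\<close> confines it to radius
  \<open>sqrt 2 * s\<close>, rounded up to \<open>3/2 * s\<close>. Thickness times cross-section
  gives the power \<open>d + 1\<close>.\<close>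

lemma ball_distr_cap:
  fixes x :: "real ^ 'd" and s :: real
  assumes s: "0 < s" "s\<^sup>2 \<le> 1 / 2" and x: "1 - s\<^sup>2 \<le> norm x" "norm x \<le> 1"
  shows "measure ball_distr {y. x \<bullet> x \<le> x \<bullet> y}
    \<le> 6 * CARD('d) * 3 ^ CARD('d) * s ^ (CARD('d) + 1) / measure lborel (cball (0 :: real ^ 'd) 1)"
proof -
  have x0: "0 < norm x" using s x by linarith
  define u where "u = x /\<^sub>R norm x"
  have u: "norm u = 1" using x0 by (simp add: u_def)
  obtain k where k: "1 \<le> real CARD('d) * \<bar>u $ k\<bar>" using unit_vector_large_coordinate[OF u] by blast
  let ?S = "{y. (\<forall>i. \<bar>y $ i - u $ i\<bar> \<le> 3 / 2 * s) \<and> 1 - s\<^sup>2 \<le> u \<bullet> y \<and> u \<bullet> y \<le> (1 - s\<^sup>2) + s\<^sup>2}"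
  have S: "?S \<in> sets borel" "emeasure lborel ?S < \<infinity>"
    "measure lborel ?S \<le> (2 * (3 / 2 * s)) ^ (CARD('d) - 1) * (6 * s\<^sup>2 * CARD('d))"
    using measure_cube_slab_le[OF k, of "s\<^sup>2" "3 / 2 * s" u "1 - s\<^sup>2"] s by auto
  have sub: "cball 0 1 \<inter> {y. x \<bullet> x \<le> x \<bullet> y} \<subseteq> ?S"
  proof
    fix y assume "y \<in> cball 0 1 \<inter> {y. x \<bullet> x \<le> x \<bullet> y}"
    then have y: "norm y \<le> 1" "x \<bullet> x \<le> x \<bullet> y" by auto
    have "norm x * (u \<bullet> y) = x \<bullet> y" using x0 by (simp add: u_def field_simps)
    then have "norm x * norm x \<le> norm x * (u \<bullet> y)"
      using y(2) by (simp add: power2_norm_eq_inner flip: power2_eq_square)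
    then have uy: "norm x \<le> u \<bullet> y" using x0 by simp
    have uy1: "u \<bullet> y \<le> 1" using Cauchy_Schwarz_ineq2[of u y] u y by simp
    have eq: "(norm (y - u))\<^sup>2 = (norm y)\<^sup>2 + (norm u)\<^sup>2 - 2 * (u \<bullet> y)"
      by (simp add: power2_norm_eq_inner inner_diff_left inner_diff_right inner_commute)
    have "(norm y)\<^sup>2 \<le> 1" "(norm u)\<^sup>2 = 1" using y u by (simp_all add: power_le_one)
    with eq uy x(1) have "(norm (y - u))\<^sup>2 \<le> 2 * s\<^sup>2" by linarith
    also have "\<dots> \<le> (3 / 2 * s)\<^sup>2" by (simp add: power2_eq_square)
    finally have "norm (y - u) \<le> 3 / 2 * s" by (rule power2_le_imp_le) (use s in simp)
    then have "\<bar>y $ i - u $ i\<bar> \<le> 3 / 2 * s" for i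
      using component_le_norm_cart[of "y - u" i] by simp
    then show "y \<in> ?S" using uy uy1 x by auto
  qed
  have "measure lborel (cball 0 1 \<inter> {y. x \<bullet> x \<le> x \<bullet> y}) \<le> measure lborel ?S"
    using S sub by (intro measure_mono_fmeasurable) (auto simp: fmeasurable_def)
  also have "\<dots> \<le> (3 * s) ^ (CARD('d) - 1) * (6 * s\<^sup>2 * CARD('d))" using S(3) by simp
  also have "\<dots> = 6 * CARD('d) * 3 ^ (CARD('d) - 1) * s ^ (CARD('d) - 1 + 2)"
    by (simp only: power_mult_distrib power_add) (simp add: mult_ac)
  also have "CARD('d) - 1 + 2 = CARD('d) + 1" by simp
  also have "6 * CARD('d) * 3 ^ (CARD('d) - 1) * s ^ (CARD('d) + 1)
      \<le> 6 * CARD('d) * 3 ^ CARD('d) * s ^ (CARD('d) + 1)"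
    using s by (intro mult_right_mono mult_left_mono power_increasing) auto
  finally show ?thesis
    using measure_unit_cball_pos[where 'd = 'd] by (subst measure_ball_distr) (auto simp: divide_right_mono)
qed

lemma ball_distr_risk:
  obtains c :: real where "0 < c"
    "\<And>n. 1 \<le> n \<Longrightarrow> ennreal (c * real n powr (- (2 / (real CARD('d) + 1)))) \<le> projection_risk n (ball_distr :: (real ^ 'd) measure)"
proof -
  let ?d = "CARD('d)"
  define V where "V = measure lborel (cball (0 :: real ^ 'd) 1)"
  have V: "0 < V" unfolding V_def by (rule measure_unit_cball_pos)
  define K where "K = 6 * ?d * 3 ^ ?d / V"
  have K: "0 < K" using V by (simp add: K_def)
  \<comment> \<open>\<open>\<sigma> \<le> 1/2\<close> keeps \<open>s\<close> in the range of the cap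
    bound; \<open>K * \<sigma> \<le> 1/2\<close> together with
    \<open>\<sigma> ^ (d + 1) \<le> \<sigma>\<close> brings the cap probability below
    \<open>1 / (2 * n)\<close>.\<close>
  define \<sigma> where "\<sigma> = min (1 / 2) (1 / (2 * K))"
  have \<sigma>: "0 < \<sigma>" "\<sigma> \<le> 1 / 2" "K * \<sigma> \<le> 1 / 2"
    using K by (auto simp: \<sigma>_def min_def field_simps)
  show ?thesis
  proof (rule that[of "\<sigma>\<^sup>2 / 2"])
    fix n :: nat assume n: "1 \<le> n"
    \<comment> \<open>The cap probability scales as \<open>s ^ (d + 1)\<close> and the volume of the
      shell of such points as \<open>s^2\<close>; equating the former with \<open>1 / n\<close>
      produces the exponent \<open>2 / (d + 1)\<close>.\<close>
    define s where "s = \<sigma> * real n powr (- (1 / (real ?d + 1)))"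
    have np: "real n powr (- (1 / (real ?d + 1))) \<le> 1" "0 < real n powr (- (1 / (real ?d + 1)))"
      using n powr_mono[of "- (1 / (real ?d + 1))" 0 n] by auto
    have s: "0 < s" "s \<le> 1 / 2" using \<sigma> np mult_mono[OF \<sigma>(2) np(1)] by (auto simp: s_def)
    have s2: "s\<^sup>2 \<le> 1 / 2" using s power_mono[of s "1 / 2" 2] by (simp add: power2_eq_square)
    have s2_eq: "s\<^sup>2 = \<sigma>\<^sup>2 * real n powr (- (2 / (real ?d + 1)))"
      by (simp add: s_def power_mult_distrib power2_eq_square flip: powr_add)
    have "(real n powr (- (1 / (real ?d + 1)))) ^ (?d + 1) = real n powr (- 1)"
      using n by (subst powr_power) (auto simp: field_simps)
    then have "s ^ (?d + 1) = \<sigma> ^ (?d + 1) / n"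
      using n by (simp add: s_def power_mult_distrib powr_minus divide_inverse del: power_Suc)
    also have "\<dots> \<le> \<sigma> / n"
      using \<sigma> power_decreasing[of 1 "?d + 1" \<sigma>] by (intro divide_right_mono) auto
    finally have "K * s ^ (?d + 1) \<le> K * \<sigma> / n" using K by (simp add: mult_left_mono flip: times_divide_eq_right)
    also have "\<dots> \<le> (1 / 2) / n" using \<sigma> by (intro divide_right_mono) auto
    finally have small: "K * s ^ (?d + 1) \<le> 1 / (2 * n)" by simp
    let ?A = "cball 0 1 - ball (0 :: real ^ 'd) (1 - s\<^sup>2)"
    have "ennreal (1 / (2 * V)) * emeasure lborel ?A \<le> projection_risk n (ball_distr :: (real ^ 'd) measure)"
      unfolding ball_distr_def
    proof (rule projection_risk_uniform_ge)
      show "emeasure lborel (cball (0 :: real ^ 'd) 1) = ennreal V"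
        unfolding V_def by (rule emeasure_unit_cball)
      fix x :: "real ^ 'd" assume "x \<in> ?A"
      then have "measure ball_distr {y. x \<bullet> x \<le> x \<bullet> y} \<le> K * s ^ (?d + 1)"
        using ball_distr_cap[OF s(1) s2, of x] by (simp add: K_def V_def)
      with small show "measure (uniform_measure lborel (cball 0 1)) {y. x \<bullet> x \<le> x \<bullet> y} \<le> 1 / (2 * real n)"
        by (simp add: ball_distr_def)
    qed (use n V in auto)
    moreover have sub: "ball (0 :: real ^ 'd) (1 - s\<^sup>2) \<subseteq> cball 0 1"
    proof
      fix x :: "real ^ 'd" assume "x \<in> ball 0 (1 - s\<^sup>2)"
      then have "norm x < 1 - s\<^sup>2" by simp
      then have "norm x \<le> 1" using zero_le_power2[of s] by linarith
      then show "x \<in> cball 0 1" by simp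
    qed
    have "ennreal (\<sigma>\<^sup>2 / 2 * real n powr (- (2 / (real ?d + 1)))) \<le> ennreal (1 / (2 * V)) * emeasure lborel ?A"
    proof -
      \<comment> \<open>Since \<open>(1 - s^2) ^ d \<le> 1 - s^2\<close>, the shell holds at least
        the fraction \<open>s^2\<close> of the ball in every dimension.\<close>
      have "measure lborel (ball (0 :: real ^ 'd) (1 - s\<^sup>2)) = (1 - s\<^sup>2) ^ ?d * V"
        using content_ball_conv_unit_ball[of "1 - s\<^sup>2" "0 :: real ^ 'd"] s2
        by (simp add: V_def content_cball_conv_ball)
      also have "\<dots> \<le> (1 - s\<^sup>2) * V"
        using s2 V power_decreasing[of 1 ?d "1 - s\<^sup>2"] by (intro mult_right_mono) auto
      finally have "V * s\<^sup>2 \<le> V - measure lborel (ball (0 :: real ^ 'd) (1 - s\<^sup>2))"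
        by (simp add: algebra_simps)
      also have "\<dots> = measure lborel ?A"
        unfolding V_def by (rule measure_Diff[symmetric])
          (use emeasure_lborel_cball_finite[of "0 :: real ^ 'd" 1] sub in auto)
      finally have le: "V * s\<^sup>2 \<le> measure lborel ?A" .
      have "ennreal (\<sigma>\<^sup>2 / 2 * real n powr (- (2 / (real ?d + 1)))) = ennreal (1 / (2 * V)) * ennreal (V * s\<^sup>2)"
        using V by (simp add: s2_eq flip: ennreal_mult)
      also have "\<dots> \<le> ennreal (1 / (2 * V)) * ennreal (measure lborel ?A)"
        using le by (intro mult_left_mono ennreal_leI) auto
      also have "ennreal (measure lborel ?A) = emeasure lborel ?A"
        using emeasure_bounded_finite[of ?A] by (intro emeasure_eq_ennreal_measure[symmetric])
          (auto simp: less_top intro: bounded_subset[OF bounded_cball])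
      finally show ?thesis .
    qed
    ultimately show "ennreal (\<sigma>\<^sup>2 / 2 * real n powr (- (2 / (real ?d + 1)))) \<le> projection_risk n (ball_distr :: (real ^ 'd) measure)"
      by (rule order_trans[rotated])
  qed (use \<sigma> in auto)
qed

subsection \<open>Averaging over coordinate reflections\<close>

definition flip :: "'d set \<Rightarrow> real ^ 'd \<Rightarrow> real ^ 'd" where
  "flip B x = (\<chi> i. if i \<in> B then - x $ i else x $ i)"

lemma flip_nth [simp]: "flip B x $ i = (if i \<in> B then - x $ i else x $ i)"
  by (simp add: flip_def)

lemma flip_flip: "flip B (flip C x) = flip ((B - C) \<union> (C - B)) x"
  by (auto simp: vec_eq_iff)

lemma flip_involutive [simp]: "flip B (flip B x) = x"
  by (simp add: vec_eq_iff)

lemma flip_empty [simp]: "flip {} x = x"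
  by (simp add: vec_eq_iff)

lemma flip_combination: "flip B (u *\<^sub>R x + v *\<^sub>R y) = u *\<^sub>R flip B x + v *\<^sub>R flip B y"
  by (simp add: vec_eq_iff)

lemma continuous_on_flip: "continuous_on S (flip B)"
  unfolding flip_def
proof (rule continuous_on_vec_lambda)
  show "continuous_on S (\<lambda>x. if i \<in> B then - x $ i else x $ i)" for i
    by (cases "i \<in> B") (auto intro!: continuous_intros)
qed

lemma measurable_flip [measurable]: "flip B \<in> borel \<rightarrow>\<^sub>M borel"
  by (rule borel_measurable_continuous_onI[OF continuous_on_flip])

lemma distr_lborel_flip: "distr lborel borel (flip B :: real ^ 'd \<Rightarrow> _) = lborel"
proof -
  define c :: "real ^ 'd \<Rightarrow> real" where "c b = (if b \<in> (\<lambda>i. axis i 1) ` B then - 1 else 1)" for b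
  have "flip B x = 0 + (\<Sum>j\<in>Basis. (c j * (x \<bullet> j)) *\<^sub>R j)" for x :: "real ^ 'd"
  proof (rule euclidean_eqI)
    fix b :: "real ^ 'd" assume "b \<in> Basis"
    then obtain i where "b = axis i 1" by (auto simp: Basis_vec_def)
    then have "flip B x \<bullet> b = c b * (x \<bullet> b)"
      by (auto simp: c_def inner_axis axis_eq_axis)
    with \<open>b \<in> Basis\<close> show "flip B x \<bullet> b = (0 + (\<Sum>j\<in>Basis. (c j * (x \<bullet> j)) *\<^sub>R j)) \<bullet> b"
      by (simp only: add_0 inner_sum_left_Basis)
  qed
  then have eq: "(\<lambda>x. 0 + (\<Sum>j\<in>Basis. (c j * (x \<bullet> j)) *\<^sub>R j)) = flip B" by auto
  have "lborel = density (distr lborel borel (flip B :: real ^ 'd \<Rightarrow> _)) (\<lambda>_. (\<Prod>j\<in>Basis. \<bar>c j\<bar>))"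
    unfolding eq[symmetric] by (rule lborel_affine_euclidean) (simp add: c_def)
  also have "(\<Prod>j\<in>Basis. \<bar>c j\<bar>) = 1" by (intro prod.neutral) (simp add: c_def)
  finally show ?thesis by (simp add: density_1)
qed

text \<open>Applied to \<open>ln f\<close> this gives a function that is invariant under the
  reflections in \<open>S\<close> and concave where all reflected points stay in the support,
  although \<open>f\<close> itself may lack the symmetry.\<close>

definition flip_avg :: "'d set \<Rightarrow> (real ^ 'd \<Rightarrow> real) \<Rightarrow> real ^ 'd \<Rightarrow> real" where
  "flip_avg S g x = (\<Sum>B\<in>Pow S. g (flip B x)) / 2 ^ card S"

text \<open>Composing with \<open>flip C\<close> permutes the subsets of \<open>S\<close> by
  symmetric difference.\<close>

lemma flip_avg_flip:
  assumes "C \<subseteq> S"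
  shows "flip_avg S g (flip C x) = flip_avg S g x"
proof -
  have "(\<Sum>B\<in>Pow S. g (flip B (flip C x))) = (\<Sum>B\<in>Pow S. g (flip B x))"
    by (rule sum.reindex_bij_witness[where i = "\<lambda>B. (B - C) \<union> (C - B)" and j = "\<lambda>B. (B - C) \<union> (C - B)"])
      (use assms in \<open>auto simp: flip_flip intro!: arg_cong[where f = g] arg_cong[where f = "\<lambda>B. flip B x"]\<close>)
  then show ?thesis by (simp add: flip_avg_def)
qed

text \<open>Subsets of \<open>insert k S\<close> are split by whether they contain \<open>k\<close>.
  With \<open>S\<close> the complement of \<open>k\<close>, the full average becomes the mean of the
  partial one at \<open>x\<close> and at its mirror image.\<close>

lemma flip_avg_insert:
  fixes S :: "'d::finite set"
  assumes "k \<notin> S"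
  shows "flip_avg (insert k S) g x = (flip_avg S g x + flip_avg S g (flip {k} x)) / 2"
proof -
  have "(\<Sum>B\<in>Pow (insert k S). g (flip B x)) = (\<Sum>B\<in>Pow S. g (flip B x)) + (\<Sum>B\<in>insert k ` Pow S. g (flip B x))"
    unfolding Pow_insert using assms by (intro sum.union_disjoint) auto
  also have "(\<Sum>B\<in>insert k ` Pow S. g (flip B x)) = (\<Sum>B\<in>Pow S. g (flip (insert k B) x))"
    using assms by (subst sum.reindex) (auto intro!: inj_onI)
  also have "\<dots> = (\<Sum>B\<in>Pow S. g (flip B (flip {k} x)))"
    using assms by (intro sum.cong arg_cong[where f = g]) (auto simp: vec_eq_iff)
  finally show ?thesis using assms by (simp add: flip_avg_def add_divide_distrib)
qed

lemma flip_avg_const_on: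
  fixes S :: "'d::finite set"
  assumes "\<And>B. B \<subseteq> S \<Longrightarrow> g (flip B x) = c"
  shows "flip_avg S g x = c"
  unfolding flip_avg_def using assms by (simp add: card_Pow)

text \<open>Positivity at every reflection is carried along with the inequality:
  \<open>ln 0 = 0\<close> in HOL, so concavity of \<open>ln f\<close> is available only on the
  support.\<close>

lemma flip_avg_concave:
  fixes f :: "real ^ 'd \<Rightarrow> real"
  assumes f: "log_concave f" and pos: "\<And>B. B \<subseteq> S \<Longrightarrow> 0 < f (flip B x)" "\<And>B. B \<subseteq> S \<Longrightarrow> 0 < f (flip B y)"
    and uv: "0 \<le> u" "0 \<le> v" "u + v = 1"
  shows "\<And>B. B \<subseteq> S \<Longrightarrow> 0 < f (flip B (u *\<^sub>R x + v *\<^sub>R y))"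
    and "u * flip_avg S (\<lambda>x. ln (f x)) x + v * flip_avg S (\<lambda>x. ln (f x)) y
      \<le> flip_avg S (\<lambda>x. ln (f x)) (u *\<^sub>R x + v *\<^sub>R y)"
proof -
  show "0 < f (flip B (u *\<^sub>R x + v *\<^sub>R y))" if "B \<subseteq> S" for B
    using log_concaveD(1)[OF f pos(1)[OF that] pos(2)[OF that] uv] by (simp add: flip_combination)
  have "u * (\<Sum>B\<in>Pow S. ln (f (flip B x))) + v * (\<Sum>B\<in>Pow S. ln (f (flip B y)))
      = (\<Sum>B\<in>Pow S. u * ln (f (flip B x)) + v * ln (f (flip B y)))"
    by (simp add: sum.distrib sum_distrib_left)
  also have "\<dots> \<le> (\<Sum>B\<in>Pow S. ln (f (flip B (u *\<^sub>R x + v *\<^sub>R y))))"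
    using log_concaveD(2)[OF f pos(1) pos(2) uv] by (intro sum_mono) (auto simp: flip_combination)
  finally show "u * flip_avg S (\<lambda>x. ln (f x)) x + v * flip_avg S (\<lambda>x. ln (f x)) y
      \<le> flip_avg S (\<lambda>x. ln (f x)) (u *\<^sub>R x + v *\<^sub>R y)"
    unfolding flip_avg_def by (simp add: divide_right_mono flip: add_divide_distrib)
qed

text \<open>By the tangent line of \<open>exp\<close> at \<open>b\<close>, the average of \<open>f\<close> over reflections is at least
  \<open>exp b\<close> where the average of \<open>ln f\<close> is at least \<open>b\<close>.\<close>

lemma exp_flip_avg_le_nn_integral:
  fixes f :: "real ^ 'd \<Rightarrow> real"
  assumes [measurable]: "f \<in> borel_measurable borel" "Q \<in> sets borel"
    and f: "\<And>x. 0 \<le> f x"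
    and Q: "\<And>B x. \<lbrakk>B \<subseteq> S; x \<in> Q\<rbrakk> \<Longrightarrow> flip B x \<in> Q"
    and pos: "\<And>x. x \<in> Q \<Longrightarrow> 0 < f x"
    and b: "\<And>x. x \<in> Q \<Longrightarrow> b \<le> flip_avg S (\<lambda>x. ln (f x)) x"
  shows "ennreal (exp b) * emeasure lborel Q \<le> (\<integral>\<^sup>+ x. ennreal (f x) * indicator Q x \<partial>lborel)"
proof -
  let ?N = "2 ^ card S :: real"
  have Q_iff: "flip B x \<in> Q \<longleftrightarrow> x \<in> Q" if "B \<subseteq> S" for B x
    using Q[OF that, of x] Q[OF that, of "flip B x"] by auto
  have N: "ennreal ?N = 2 ^ card S" by (simp add: ennreal_power[symmetric])
  have card: "card (Pow S) = 2 ^ card S" by (simp add: card_Pow)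
  have "exp b \<le> flip_avg S f x" if "x \<in> Q" for x
  proof -
    have tangent: "exp b * (1 - b) + exp b * ln (f (flip B x)) \<le> f (flip B x)" if "B \<subseteq> S" for B
    proof -
      have p: "0 < f (flip B x)" using Q[OF that \<open>x \<in> Q\<close>] pos by blast
      have "exp b * (1 + (ln (f (flip B x)) - b)) \<le> exp b * exp (ln (f (flip B x)) - b)"
        by (intro mult_left_mono exp_ge_add_one_self) auto
      also have "\<dots> = f (flip B x)" using p by (simp flip: exp_add)
      finally show ?thesis by (simp add: algebra_simps)
    qed
    have "exp b = exp b * (1 - b) + exp b * b" by (simp add: algebra_simps)
    also have "\<dots> \<le> exp b * (1 - b) + exp b * flip_avg S (\<lambda>x. ln (f x)) x"
      using b[OF that] by simp
    also have "\<dots> = (\<Sum>B\<in>Pow S. exp b * (1 - b) + exp b * ln (f (flip B x))) / ?N"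
      by (simp add: flip_avg_def sum.distrib sum_distrib_left card_Pow add_divide_distrib)
    also have "\<dots> \<le> flip_avg S f x"
      unfolding flip_avg_def using tangent by (intro divide_right_mono sum_mono) auto
    finally show ?thesis .
  qed
  then have "(\<integral>\<^sup>+ x. ennreal (exp b) * indicator Q x \<partial>lborel) \<le> (\<integral>\<^sup>+ x. ennreal (flip_avg S f x) * indicator Q x \<partial>lborel)"
    by (intro nn_integral_mono) (auto simp: indicator_def ennreal_leI)
  also have "\<dots> = (\<integral>\<^sup>+ x. (\<Sum>B\<in>Pow S. ennreal (1 / ?N) * (ennreal (f (flip B x)) * indicator Q (flip B x))) \<partial>lborel)"
  proof (rule nn_integral_cong)
    fix x
    have "ennreal (flip_avg S f x) * indicator Q x = (\<Sum>B\<in>Pow S. ennreal (f (flip B x) / ?N)) * indicator Q x"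
      using f by (simp add: flip_avg_def sum_divide_distrib sum_ennreal)
    also have "\<dots> = (\<Sum>B\<in>Pow S. ennreal (1 / ?N) * (ennreal (f (flip B x)) * indicator Q (flip B x)))"
      unfolding sum_distrib_right
    proof (rule sum.cong)
      fix B assume "B \<in> Pow S"
      then have "indicator Q (flip B x) = (indicator Q x :: ennreal)" using Q_iff by (simp add: indicator_def)
      moreover have "ennreal (f (flip B x) / ?N) = ennreal (1 / ?N) * ennreal (f (flip B x))"
        using f by (simp flip: ennreal_mult)
      ultimately show "ennreal (f (flip B x) / ?N) * indicator Q x
          = ennreal (1 / ?N) * (ennreal (f (flip B x)) * indicator Q (flip B x))"
        by (simp add: mult.assoc)
    qed simp
    finally show "ennreal (flip_avg S f x) * indicator Q x
        = (\<Sum>B\<in>Pow S. ennreal (1 / ?N) * (ennreal (f (flip B x)) * indicator Q (flip B x)))" .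
  qed
  also have "\<dots> = (\<Sum>B\<in>Pow S. ennreal (1 / ?N) * (\<integral>\<^sup>+ x. ennreal (f (flip B x)) * indicator Q (flip B x) \<partial>lborel))"
    by (subst nn_integral_sum) (auto simp: nn_integral_cmult)
  also have "\<dots> = (\<Sum>B\<in>Pow S. ennreal (1 / ?N) * (\<integral>\<^sup>+ x. ennreal (f x) * indicator Q x \<partial>lborel))"
  proof (rule sum.cong)
    fix B assume "B \<in> Pow S"
    have "(\<integral>\<^sup>+ x. ennreal (f x) * indicator Q x \<partial>lborel) = (\<integral>\<^sup>+ x. ennreal (f x) * indicator Q x \<partial>distr lborel borel (flip B))"
      by (simp add: distr_lborel_flip)
    also have "\<dots> = (\<integral>\<^sup>+ x. ennreal (f (flip B x)) * indicator Q (flip B x) \<partial>lborel)"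
      by (subst nn_integral_distr) auto
    finally show "ennreal (1 / ?N) * (\<integral>\<^sup>+ x. ennreal (f (flip B x)) * indicator Q (flip B x) \<partial>lborel)
        = ennreal (1 / ?N) * (\<integral>\<^sup>+ x. ennreal (f x) * indicator Q x \<partial>lborel)" by simp
  qed simp
  also have "\<dots> = ennreal (?N * (1 / ?N)) * (\<integral>\<^sup>+ x. ennreal (f x) * indicator Q x \<partial>lborel)"
    by (simp add: card N mult.assoc[symmetric] ennreal_mult del: times_divide_eq_right flip: ennreal_of_nat_eq_real_of_nat)
  finally show ?thesis by (simp add: nn_integral_cmult_indicator)
qed

text \<open>Induction on \<open>S\<close>: the \<open>j\<close>-th coordinate of \<open>y\<close> is
  a convex combination of \<open>r\<close> and \<open>- r\<close>. Pinning the coordinates off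
  \<open>S\<close> to those of \<open>y\<close> is the generality that the induction uses; for
  \<open>S = UNIV\<close> a convex set containing the vertices contains the cube.\<close>

lemma convex_contains_box:
  fixes y :: "real ^ 'd"
  assumes "convex D" "finite S" "0 < r" "\<And>i. i \<in> S \<Longrightarrow> \<bar>y $ i\<bar> \<le> r"
    and "\<And>x. \<lbrakk>\<And>i. i \<in> S \<Longrightarrow> x $ i = r \<or> x $ i = - r; \<And>i. i \<notin> S \<Longrightarrow> x $ i = y $ i\<rbrakk> \<Longrightarrow> x \<in> D"
  shows "y \<in> D"
  using assms(2,4,5)
proof (induction S arbitrary: y)
  case empty
  then show ?case by auto
next
  case (insert j S)
  define z where "z s = (\<chi> i. if i = j then s else y $ i)" for s
  have z: "z s \<in> D" if "s = r \<or> s = - r" for s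
  proof (rule insert.IH)
    show "\<bar>z s $ i\<bar> \<le> r" if "i \<in> S" for i using that insert by (auto simp: z_def)
    fix x assume x: "\<And>i. i \<in> S \<Longrightarrow> x $ i = r \<or> x $ i = - r" "\<And>i. i \<notin> S \<Longrightarrow> x $ i = z s $ i"
    show "x \<in> D"
    proof (rule insert.prems(2))
      show "x $ i = r \<or> x $ i = - r" if "i \<in> insert j S" for i
        using that x(1)[of i] x(2)[of j] insert.hyps \<open>s = r \<or> s = - r\<close> by (auto simp: z_def)
      show "x $ i = y $ i" if "i \<notin> insert j S" for i
        using that x(2)[of i] by (auto simp: z_def)
    qed
  qed
  define u where "u = (1 + y $ j / r) / 2"
  have yj: "- r \<le> y $ j" "y $ j \<le> r" using insert.prems(1)[of j] by auto
  then have u: "0 \<le> u" "0 \<le> 1 - u" using \<open>0 < r\<close> by (auto simp: u_def field_simps)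
  have "u *\<^sub>R z r + (1 - u) *\<^sub>R z (- r) \<in> D"
    using u by (intro convexD[OF \<open>convex D\<close>] z) auto
  moreover have "u *\<^sub>R z r + (1 - u) *\<^sub>R z (- r) = y"
    using \<open>0 < r\<close> by (auto simp: vec_eq_iff z_def u_def field_simps)
  ultimately show ?case by simp
qed


subsection \<open>Bricks and slabs\<close>

text \<open>One shape covers the cube (\<open>brick k r (- r) r\<close>), its end quarters along the
  axis \<open>k\<close>, and the box between cube and atom. Reflections of the coordinates other
  than \<open>k\<close> preserve it.\<close>

definition brick :: "'d \<Rightarrow> real \<Rightarrow> real \<Rightarrow> real \<Rightarrow> (real ^ 'd) set" where
  "brick k \<rho> l u = {x. l \<le> x $ k \<and> x $ k \<le> u \<and> (\<forall>i. i \<noteq> k \<longrightarrow> \<bar>x $ i\<bar> \<le> \<rho>)}"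

lemma brick_eq_cbox:
  "brick k \<rho> l u = cbox (\<chi> i. if i = k then l else - \<rho>) (\<chi> i. if i = k then u else \<rho>)"
  by (auto simp: brick_def mem_box_cart abs_le_iff split: if_splits)
     (smt (verit))+

lemma borel_brick [measurable]: "brick k \<rho> l u \<in> sets borel"
  by (simp add: brick_eq_cbox)

lemma prod_all_but_one:
  fixes F :: "'d::finite \<Rightarrow> 'a::comm_monoid_mult"
  assumes "\<And>i. i \<noteq> k \<Longrightarrow> F i = c"
  shows "(\<Prod>i\<in>UNIV. F i) = F k * c ^ (CARD('d) - 1)"
proof -
  have "(\<Prod>i\<in>UNIV. F i) = F k * (\<Prod>i\<in>UNIV - {k}. F i)" by (simp add: prod.remove)
  also have "(\<Prod>i\<in>UNIV - {k}. F i) = (\<Prod>i\<in>UNIV - {k}. c)" using assms by (intro prod.cong) auto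
  finally show ?thesis by (simp add: card_Diff_singleton)
qed

lemma emeasure_brick:
  fixes k :: "'d::finite"
  assumes "l \<le> u" "0 \<le> \<rho>"
  shows "emeasure lborel (brick k \<rho> l u) = ennreal ((u - l) * (2 * \<rho>) ^ (CARD('d) - 1))"
proof -
  have "(\<chi> i. if i = k then l else - \<rho>) \<in> brick k \<rho> l u" using assms by (simp add: brick_def)
  then have "measure lborel (brick k \<rho> l u) = (\<Prod>i\<in>UNIV. (if i = k then u - l else 2 * \<rho>))"
    unfolding brick_eq_cbox by (subst content_cbox_cart) (auto intro!: prod.cong)
  also have "\<dots> = (u - l) * (2 * \<rho>) ^ (CARD('d) - 1)" by (subst prod_all_but_one[of k]) auto
  finally show ?thesis
    by (subst emeasure_eq_ennreal_measure) (auto simp: brick_eq_cbox emeasure_lborel_cbox_eq)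
qed

lemma flip_brick:
  assumes "x \<in> brick k \<rho> l u" "k \<notin> B"
  shows "flip B x \<in> brick k \<rho> l u"
  using assms by (auto simp: brick_def)

text \<open>The unnormalised competitor: 1 on the cube, with decay only along the axis
  \<open>k\<close>. Its half-infinite box is convex and contains both cube and atom, so its
  log-density is finite at every point of the distribution.\<close>

definition slab_tail :: "'d \<Rightarrow> real \<Rightarrow> real \<Rightarrow> real ^ 'd \<Rightarrow> real" where
  "slab_tail k r \<eta> x = exp (- \<eta> * max 0 (x $ k - r)) *
     indicator {x. - r \<le> x $ k \<and> (\<forall>i. i \<noteq> k \<longrightarrow> \<bar>x $ i\<bar> \<le> r)} x"

lemma closed_convex_slab:
  "closed {x :: real ^ 'd. - r \<le> x $ k \<and> (\<forall>i. i \<noteq> k \<longrightarrow> \<bar>x $ i\<bar> \<le> r)}"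
  "convex {x :: real ^ 'd. - r \<le> x $ k \<and> (\<forall>i. i \<noteq> k \<longrightarrow> \<bar>x $ i\<bar> \<le> r)}"
proof -
  let ?S = "{x :: real ^ 'd. - r \<le> x $ k \<and> (\<forall>i. i \<noteq> k \<longrightarrow> \<bar>x $ i\<bar> \<le> r)}"
  have eq: "?S = {x. - r \<le> x $ k} \<inter> (\<Inter>i\<in>-{k}. {x. \<bar>x $ i\<bar> \<le> r})" by auto
  show "closed ?S" unfolding eq
    by (intro closed_Int closed_INT ballI closed_Collect_le continuous_intros)
  show "convex ?S"
  proof (rule convexI)
    fix x y :: "real ^ 'd" and u v :: real
    assume xy: "x \<in> ?S" "y \<in> ?S" and uv: "0 \<le> u" "0 \<le> v" "u + v = 1"
    have const: "u * c + v * c = c" for c using uv(3) by (metis distrib_right mult_1)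
    have "u * (- r) + v * (- r) \<le> u * x $ k + v * y $ k"
      using xy uv by (intro add_mono mult_left_mono) auto
    moreover have "\<bar>u * x $ i + v * y $ i\<bar> \<le> r" if "i \<noteq> k" for i
    proof -
      have "\<bar>u * x $ i + v * y $ i\<bar> \<le> u * \<bar>x $ i\<bar> + v * \<bar>y $ i\<bar>"
        using abs_triangle_ineq[of "u * x $ i" "v * y $ i"] uv by (simp add: abs_mult)
      also have "\<dots> \<le> u * r + v * r" using xy uv that by (intro add_mono mult_left_mono) auto
      finally show ?thesis by (simp only: const)
    qed
    ultimately show "u *\<^sub>R x + v *\<^sub>R y \<in> ?S" by (simp add: const[of "- r", simplified])
  qed
qed

lemma slab_tail_log_concave:
  assumes "0 < \<eta>"
  shows "log_concave (slab_tail k r \<eta>)" "upper_semicontinuous (slab_tail k r \<eta>)"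
proof -
  have "log_concave (\<lambda>x :: real ^ 'a. exp (- \<eta> * max 0 (x $ k - r)))"
  proof (rule log_concaveI)
    fix x y :: "real ^ 'a" and u v :: real
    assume uv: "0 \<le> u" "0 \<le> v" "u + v = 1"
    have "(u *\<^sub>R x + v *\<^sub>R y) $ k - r = u * (x $ k - r) + v * (y $ k - r)"
      using arg_cong[OF uv(3), of "\<lambda>t. t * r"] by (simp add: algebra_simps)
    also have "\<dots> \<le> u * max 0 (x $ k - r) + v * max 0 (y $ k - r)"
      using uv by (intro add_mono mult_left_mono) auto
    finally have "max 0 ((u *\<^sub>R x + v *\<^sub>R y) $ k - r) \<le> u * max 0 (x $ k - r) + v * max 0 (y $ k - r)"
      using uv by simp
    then have "\<eta> * max 0 ((u *\<^sub>R x + v *\<^sub>R y) $ k - r) \<le> \<eta> * (u * max 0 (x $ k - r) + v * max 0 (y $ k - r))"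
      using assms by (intro mult_left_mono) auto
    then show "0 < exp (- \<eta> * max 0 ((u *\<^sub>R x + v *\<^sub>R y) $ k - r)) \<and>
      u * ln (exp (- \<eta> * max 0 (x $ k - r))) + v * ln (exp (- \<eta> * max 0 (y $ k - r)))
        \<le> ln (exp (- \<eta> * max 0 ((u *\<^sub>R x + v *\<^sub>R y) $ k - r)))"
      by (simp add: algebra_simps)
  qed simp
  then show "log_concave (slab_tail k r \<eta>)"
    unfolding slab_tail_def[abs_def] by (rule log_concave_restrict[OF _ closed_convex_slab(2)])
  have "upper_semicontinuous (\<lambda>x :: real ^ 'a. exp (- \<eta> * max 0 (x $ k - r)))"
    unfolding upper_semicontinuous_def by (auto intro!: open_Collect_less continuous_intros)
  then show "upper_semicontinuous (slab_tail k r \<eta>)"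
    unfolding slab_tail_def[abs_def] by (rule upper_semicontinuous_restrict[OF _ _ closed_convex_slab(1)]) simp
qed

lemma nn_integral_exp_tail:
  assumes "0 < \<eta>" "0 < r"
  shows "(\<integral>\<^sup>+ t. indicator {- r..} t * ennreal (exp (- \<eta> * max 0 (t - r))) \<partial>lborel) = ennreal (2 * r + 1 / \<eta>)"
proof -
  have tail: "(\<integral>\<^sup>+ t. ennreal (exp (- \<eta> * (t - r))) * indicator {r..} t \<partial>lborel) = ennreal (0 - (- exp (- \<eta> * (r - r)) / \<eta>))"
  proof (rule nn_integral_FTC_atLeast[where F = "\<lambda>t. - exp (- \<eta> * (t - r)) / \<eta>" and T = 0 and a = r])
    show "((\<lambda>t. - exp (- \<eta> * (t - r)) / \<eta>) has_real_derivative exp (- \<eta> * (x - r))) (at x)" for x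
      using assms by (auto intro!: derivative_eq_intros)
    show "((\<lambda>t. - exp (- \<eta> * (t - r)) / \<eta>) \<longlongrightarrow> 0) at_top"
      using assms by real_asymp
  qed auto
  have "(\<integral>\<^sup>+ t. indicator {- r..} t * ennreal (exp (- \<eta> * max 0 (t - r))) \<partial>lborel)
      = (\<integral>\<^sup>+ t. indicator {- r..<r} t + ennreal (exp (- \<eta> * (t - r))) * indicator {r..} t \<partial>lborel)"
    using assms by (intro nn_integral_cong) (auto simp: indicator_def max_def)
  also have "\<dots> = emeasure lborel {- r..<r} + (\<integral>\<^sup>+ t. ennreal (exp (- \<eta> * (t - r))) * indicator {r..} t \<partial>lborel)"
    by (subst nn_integral_add) auto
  also have "\<dots> = ennreal (2 * r) + ennreal (1 / \<eta>)" unfolding tail using assms by simp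
  finally show ?thesis using assms by (simp flip: ennreal_plus)
qed

text \<open>The function is a product over the coordinates, one exponential tail and
  \<open>d - 1\<close> indicators of intervals, so the integral factorises.\<close>

lemma nn_integral_slab_tail:
  fixes k :: "'d::finite"
  assumes "0 < \<eta>" "0 < r"
  shows "(\<integral>\<^sup>+ x. ennreal (slab_tail k r \<eta> x) \<partial>lborel) = ennreal ((2 * r + 1 / \<eta>) * (2 * r) ^ (CARD('d) - 1))"
proof -
  define h :: "real ^ 'd \<Rightarrow> real \<Rightarrow> ennreal" where
    "h b t = (if b = axis k 1 then indicator {- r..} t * ennreal (exp (- \<eta> * max 0 (t - r))) else indicator {- r..r} t)" for b t
  have Basis_eq: "(Basis :: (real ^ 'd) set) = range (\<lambda>i. axis i 1)" by (auto simp: Basis_vec_def)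
  have inj: "inj (\<lambda>i :: 'd. axis i (1 :: real))" by (auto simp: inj_def axis_eq_axis)
  have prod_Basis: "(\<Prod>b\<in>Basis. F b) = (\<Prod>i\<in>UNIV. F (axis i 1))" for F :: "real ^ 'd \<Rightarrow> ennreal"
    unfolding Basis_eq using inj by (simp add: prod.reindex)
  have "ennreal (slab_tail k r \<eta> x) = (\<Prod>b\<in>Basis. h b (x \<bullet> b))" for x
  proof -
    have "(\<Prod>b\<in>Basis. h b (x \<bullet> b)) = h (axis k 1) (x $ k) * (\<Prod>i\<in>UNIV - {k}. indicator {- r..r} (x $ i))"
      unfolding prod_Basis by (subst prod.remove[of _ k]) (auto simp: inner_axis h_def axis_eq_axis intro!: prod.cong arg_cong2[where f = "(*)"])
    also have "(\<Prod>i\<in>UNIV - {k}. indicator {- r..r} (x $ i)) = (if \<forall>i. i \<noteq> k \<longrightarrow> \<bar>x $ i\<bar> \<le> r then 1 else 0 :: ennreal)"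
    proof -
      have ind: "indicator {- r..r} t = (if \<bar>t\<bar> \<le> r then 1 else 0 :: ennreal)" for t
        by (auto simp: indicator_def abs_le_iff)
      show ?thesis
        by (cases "\<forall>i. i \<noteq> k \<longrightarrow> \<bar>x $ i\<bar> \<le> r") (auto simp: ind intro!: prod.neutral)
    qed
    finally show ?thesis by (auto simp: h_def slab_tail_def indicator_def)
  qed
  then have "(\<integral>\<^sup>+ x. ennreal (slab_tail k r \<eta> x) \<partial>lborel) = (\<integral>\<^sup>+ x. (\<Prod>b\<in>Basis. h b (x \<bullet> b)) \<partial>lborel)"
    by simp
  also have "\<dots> = (\<Prod>b\<in>Basis. (\<integral>\<^sup>+ t. h b t \<partial>lborel))"
    by (rule nn_integral_lborel_prod) (auto simp: h_def)
  also have "\<dots> = (\<integral>\<^sup>+ t. h (axis k 1) t \<partial>lborel) * ennreal (2 * r) ^ (CARD('d) - 1)"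
    unfolding prod_Basis
  proof (intro prod_all_but_one)
    fix i assume "i \<noteq> k"
    then have "h (axis i 1) = indicator {- r..r}" by (auto simp: h_def fun_eq_iff axis_eq_axis)
    then show "(\<integral>\<^sup>+ t. h (axis i 1) t \<partial>lborel) = ennreal (2 * r)" using assms by simp
  qed
  also have "(\<integral>\<^sup>+ t. h (axis k 1) t \<partial>lborel) = ennreal (2 * r + 1 / \<eta>)"
    unfolding h_def using nn_integral_exp_tail[OF assms] by simp
  also have "ennreal (2 * r) ^ (CARD('d) - 1) = ennreal ((2 * r) ^ (CARD('d) - 1))"
    using assms by (intro ennreal_power) simp
  also have "ennreal (2 * r + 1 / \<eta>) * \<dots> = ennreal ((2 * r + 1 / \<eta>) * (2 * r) ^ (CARD('d) - 1))"
    using assms by (intro ennreal_mult[symmetric]) auto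
  finally show ?thesis .
qed


subsection \<open>Cube vertices with a rare distant atom\<close>

lemma sum_UNIV_option: "(\<Sum>i\<in>UNIV. g i) = g None + (\<Sum>A\<in>UNIV. g (Some (A :: 'd::finite set)))"
  by (simp add: UNIV_option_conv sum.reindex)

text \<open>\<open>r \<le> 1/2\<close> and \<open>1 \<le> M\<close> keep the gap
  \<open>M - r\<close> above \<open>M / 2\<close>; \<open>a * M \<le> 1\<close> bounds
  \<open>scale\<close> by 1; \<open>a \<le> 1/24\<close> absorbs the gain at the atom when
  \<open>f\<close> is large there.\<close>

locale cube_atom =
  fixes k :: "'d::finite" and r M a :: real
  assumes r: "0 < r" "r \<le> 1 / 2" and M: "1 \<le> M" and a: "0 < a" "a \<le> 1 / 24" and aM: "a * M \<le> 1"
begin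

definition corner :: "real ^ 'd" where "corner = (\<chi> i. r)"

text \<open>Indexing a vertex by its set of negative coordinates turns averages over the vertices
  into \<open>flip_avg UNIV\<close> at \<open>corner\<close>.\<close>

definition loc :: "'d set option \<Rightarrow> real ^ 'd" where
  "loc i = (case i of None \<Rightarrow> axis k M | Some A \<Rightarrow> flip A corner)"

definition wt :: "'d set option \<Rightarrow> real" where
  "wt i = (case i of None \<Rightarrow> a | Some A \<Rightarrow> (1 - a) / 2 ^ CARD('d))"

lemma corner_nth [simp]: "corner $ i = r"
  by (simp add: corner_def)

lemma loc_simps [simp]: "loc None = axis k M" "loc (Some A) = flip A corner"
  by (simp_all add: loc_def)

lemma wt_simps [simp]: "wt None = a" "wt (Some A) = (1 - a) / 2 ^ CARD('d)"
  by (simp_all add: wt_def)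

lemma sum_wt: "(\<Sum>i\<in>UNIV. wt i * g (loc i)) = a * g (axis k M) + (1 - a) * flip_avg UNIV g corner"
  by (simp add: sum_UNIV_option flip_avg_def sum_distrib_left sum_divide_distrib)

sublocale weighted_points UNIV wt loc
proof
  show "0 < wt i" for i using a by (cases i) auto
  show "sum wt UNIV = 1" using sum_wt[of "\<lambda>_. 1"] by (simp add: flip_avg_const_on)
qed simp

text \<open>Each vertex is paired with its mirror image in a large coordinate \<open>j\<close> of
  \<open>u\<close>. The two values of \<open>u \<bullet> x\<close> differ by
  \<open>2 * r * \<bar>u $ j\<bar> \<ge> 2 * r / d\<close>, so their mean distance from any
  \<open>c\<close> is at least \<open>r / d\<close>; the vertices carry weight at least 1/2.\<close>

lemma abs_deviation:
  assumes u: "norm u = 1"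
  shows "r / (2 * CARD('d)) \<le> (\<integral>x. \<bar>u \<bullet> x - c\<bar> \<partial>P)"
proof -
  obtain j where j: "1 \<le> real CARD('d) * \<bar>u $ j\<bar>" using unit_vector_large_coordinate[OF u] by blast
  let ?g = "\<lambda>x. \<bar>u \<bullet> x - c\<bar>"
  have g: "r / CARD('d) \<le> (?g (flip B corner) + ?g (flip B (flip {j} corner))) / 2" for B
  proof -
    have "flip B corner - flip B (flip {j} corner) = (2 * (if j \<in> B then - r else r)) *\<^sub>R axis j 1"
      by (auto simp: vec_eq_iff axis_def)
    then have "u \<bullet> flip B corner - u \<bullet> flip B (flip {j} corner) = 2 * (if j \<in> B then - r else r) * u $ j"
      by (simp add: inner_axis flip: inner_diff_right)
    then have "2 * (r * \<bar>u $ j\<bar>) = \<bar>u \<bullet> flip B corner - u \<bullet> flip B (flip {j} corner)\<bar>"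
      using r by (simp add: abs_mult)
    also have "\<dots> \<le> ?g (flip B corner) + ?g (flip B (flip {j} corner))" by arith
    finally have "r * \<bar>u $ j\<bar> \<le> (?g (flip B corner) + ?g (flip B (flip {j} corner))) / 2"
      by (simp only: le_divide_eq_numeral1 mult.commute)
    moreover have "r / CARD('d) \<le> r * \<bar>u $ j\<bar>" using j r by (simp add: field_simps)
    ultimately show ?thesis by (rule order_trans[rotated])
  qed
  have "r / CARD('d) = (\<Sum>B\<in>Pow (UNIV :: 'd set). r / CARD('d)) / 2 ^ CARD('d)"
    by (simp add: card_Pow del: Pow_UNIV)
  also have "\<dots> \<le> (\<Sum>B\<in>Pow UNIV. (?g (flip B corner) + ?g (flip B (flip {j} corner))) / 2) / 2 ^ CARD('d)"
    using g by (intro divide_right_mono sum_mono) auto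
  also have "\<dots> = (flip_avg UNIV ?g corner + flip_avg UNIV ?g (flip {j} corner)) / 2"
    by (simp add: flip_avg_def sum.distrib add_divide_distrib flip: sum_divide_distrib)
  also have "\<dots> = flip_avg UNIV ?g corner" by (simp add: flip_avg_flip)
  finally have avg: "r / CARD('d) \<le> flip_avg UNIV ?g corner" .
  have "r / (2 * CARD('d)) = (1 / 2) * (r / CARD('d))" by simp
  also have "\<dots> \<le> (1 - a) * flip_avg UNIV ?g corner" using avg a r by (intro mult_mono) auto
  also have "\<dots> \<le> (\<Sum>i\<in>UNIV. wt i * ?g (loc i))" using a by (simp add: sum_wt[of ?g])
  also have "\<dots> = (\<integral>x. \<bar>u \<bullet> x - c\<bar> \<partial>P)" by (subst integral_P) auto
  finally show ?thesis .
qed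

lemma member_class: "P \<in> moment_nondegenerate" "r / (2 * CARD('d)) \<le> min_abs_deviation P"
proof -
  have "(\<integral>\<^sup>+ x. ennreal (norm x) \<partial>P) < \<infinity>"
    using integrable_P[of "\<lambda>x. x"] by (simp add: integrable_iff_bounded)
  then show "P \<in> moment_nondegenerate" "r / (2 * CARD('d)) \<le> min_abs_deviation P"
    using r moment_nondegenerateI[OF prob_space_P sets_P _ _ abs_deviation] by auto
qed

sublocale spanning_points UNIV wt loc
  by (rule spanning_points) (rule member_class)

lemma vertex_eq_flip:
  assumes "\<And>i. x $ i = r \<or> x $ i = - r"
  shows "x = flip {i. x $ i = - r} corner"
  using assms r by (auto simp: vec_eq_iff)

lemma projection_pos_cube:
  assumes "\<And>i. \<bar>x $ i\<bar> \<le> r"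
  shows "0 < f x"
proof -
  have "x \<in> {x. 0 < f x}"
  proof (rule convex_contains_box[where S = UNIV and r = r])
    show "convex {x. 0 < f x}"
      by (rule log_concave_convex_support[OF log_concave_densitiesD(2)[OF projection_density]])
    fix y :: "real ^ 'd" assume "\<And>i. i \<in> UNIV \<Longrightarrow> y $ i = r \<or> y $ i = - r"
    then have "y = flip {i. y $ i = - r} corner" by (intro vertex_eq_flip) auto
    then show "y \<in> {x. 0 < f x}" using projection_pos[of "Some {i. y $ i = - r}"] by simp
  qed (use assms r in auto)
  then show ?thesis by simp
qed

section \<open>The symmetrised log-density on the cube\<close>

abbreviation "S \<equiv> UNIV - {k}"

text \<open>\<open>S\<close> leaves out the axis of the atom: its reflections fix the atom, where
  \<open>\<psi>\<close> equals \<open>ln f\<close>, and \<open>\<psi>\<close> is constant on the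
  vertices of each face orthogonal to that axis.\<close>

definition \<psi> :: "real ^ 'd \<Rightarrow> real" where "\<psi> = flip_avg S (\<lambda>x. ln (f x))"

text \<open>The average log-density at the vertices; the expected log-likelihood of \<open>f\<close>
  is \<open>(1 - a) * A + a * ln (f (axis k M))\<close>.\<close>

definition A :: real where "A = flip_avg UNIV (\<lambda>x. ln (f x)) corner"

lemma flip_avg_UNIV: "flip_avg UNIV (\<lambda>x. ln (f x)) x = (\<psi> x + \<psi> (flip {k} x)) / 2"
  using flip_avg_insert[of k S "\<lambda>x. ln (f x)" x] by (simp add: \<psi>_def insert_UNIV)

text \<open>At the vertices \<open>\<psi>\<close> depends only on the sign of the
  \<open>k\<close>-th coordinate and its two values average to \<open>A\<close>, so the affine
  minorant is exact there; concavity extends it to the cube.\<close>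

lemma psi_cube:
  assumes "\<And>i. \<bar>x $ i\<bar> \<le> r"
  shows "A + x $ k / r * (\<psi> corner - A) \<le> \<psi> x"
proof -
  note lc = log_concave_densitiesD(2)[OF projection_density]
  let ?h = "\<lambda>x. A + x $ k / r * (\<psi> corner - A)"
  \<comment> \<open>Positivity at all reflections belongs to the set so that its convexity follows
    from \<open>flip_avg_concave\<close>.\<close>
  let ?D = "{x. (\<forall>B\<subseteq>S. 0 < f (flip B x)) \<and> ?h x \<le> \<psi> x}"
  have "x \<in> ?D"
  proof (rule convex_contains_box[where S = UNIV and r = r])
    show "convex ?D"
    proof (rule convexI)
      fix x y :: "real ^ 'd" and u v :: real
      assume xy: "x \<in> ?D" "y \<in> ?D" and uv: "0 \<le> u" "0 \<le> v" "u + v = 1"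
      have "?h (u *\<^sub>R x + v *\<^sub>R y) = u * ?h x + v * ?h y"
        using arg_cong[OF uv(3), of "\<lambda>t. t * A"] by (simp add: algebra_simps add_divide_distrib)
      also have "\<dots> \<le> u * \<psi> x + v * \<psi> y" using xy uv by (intro add_mono mult_left_mono) auto
      also have "\<dots> \<le> \<psi> (u *\<^sub>R x + v *\<^sub>R y)"
        unfolding \<psi>_def using xy uv by (intro flip_avg_concave(2)[OF lc]) auto
      finally show "u *\<^sub>R x + v *\<^sub>R y \<in> ?D"
        using flip_avg_concave(1)[OF lc _ _ uv, of S x y] xy by auto
    qed
    fix y :: "real ^ 'd" assume "\<And>i. i \<in> UNIV \<Longrightarrow> y $ i = r \<or> y $ i = - r"
    then have y: "y $ i = r \<or> y $ i = - r" for i by auto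
    define C where "C = {i. y $ i = - r}"
    have y_eq: "y = flip C corner" unfolding C_def using y by (rule vertex_eq_flip)
    have "0 < f (flip B y)" for B
      using y r by (intro projection_pos_cube) (metis abs_minus_cancel abs_of_pos flip_nth order_refl)
    moreover have "?h y = \<psi> y"
    proof (cases "k \<in> C")
      case False
      then have "\<psi> y = \<psi> corner" unfolding y_eq \<psi>_def by (intro flip_avg_flip) auto
      then show ?thesis using False r by (simp add: y_eq)
    next
      case True
      then have "y = flip (C - {k}) (flip {k} corner)" by (auto simp: y_eq vec_eq_iff)
      moreover have "\<psi> (flip (C - {k}) (flip {k} corner)) = \<psi> (flip {k} corner)"
        unfolding \<psi>_def by (intro flip_avg_flip) auto
      ultimately have "\<psi> y = \<psi> (flip {k} corner)" by simp
      moreover have "2 * A = \<psi> corner + \<psi> (flip {k} corner)" unfolding A_def by (simp add: flip_avg_UNIV)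
      moreover have "y $ k = - r" using True by (simp add: C_def)
      ultimately show ?thesis using r by simp
    qed
    ultimately show "y \<in> ?D" by simp
  qed (use assms r in auto)
  then show ?thesis by simp
qed

lemma mass_le_1:
  assumes "Q \<in> sets borel"
  shows "(\<integral>\<^sup>+ x. ennreal (f x) * indicator Q x \<partial>lborel) \<le> 1"
proof -
  have "(\<integral>\<^sup>+ x. ennreal (f x) * indicator Q x \<partial>lborel) \<le> (\<integral>\<^sup>+ x. ennreal (f x) \<partial>lborel)"
    by (intro nn_integral_mono) (auto simp: indicator_def)
  then show ?thesis using log_concave_densitiesD(3)[OF projection_density] by simp
qed

definition vol :: real where "vol = measure lborel (brick k r (- r) r)"

text \<open>The log-density of the uniform distribution on the cube, the reference for heights at
  the cube and at the atom.\<close>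

abbreviation \<Lambda> :: real where "\<Lambda> \<equiv> - ln vol"

lemma vol_eq: "vol = 2 * r * (2 * r) ^ (CARD('d) - 1)"
  unfolding vol_def measure_def using r by (simp add: emeasure_brick)

lemma vol_eq_power: "vol = (2 * r) ^ CARD('d)"
  unfolding vol_eq using power_minus_mult[of "CARD('d)" "2 * r"] by (simp only: mult.commute) simp

lemma vol_pos: "0 < vol"
  unfolding vol_eq_power using r by simp

lemma exp_mass_brick:
  assumes lu: "l \<le> u" "- r \<le> l" "u \<le> r" and b: "\<And>x. x \<in> brick k r l u \<Longrightarrow> b \<le> \<psi> x"
  shows "exp b * ((u - l) * (2 * r) ^ (CARD('d) - 1)) \<le> 1"
proof -
  note D = log_concave_densitiesD[OF projection_density]
  have "ennreal (exp b) * emeasure lborel (brick k r l u) \<le> (\<integral>\<^sup>+ x. ennreal (f x) * indicator (brick k r l u) x \<partial>lborel)"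
  proof (rule exp_flip_avg_le_nn_integral[where S = S])
    show "flip B x \<in> brick k r l u" if "B \<subseteq> S" "x \<in> brick k r l u" for B x
      using that by (intro flip_brick) auto
    show "0 < f x" if "x \<in> brick k r l u" for x
    proof (rule projection_pos_cube)
      show "\<bar>x $ i\<bar> \<le> r" for i using that lu by (cases "i = k") (auto simp: brick_def)
    qed
    show "b \<le> flip_avg S (\<lambda>x. ln (f x)) x" if "x \<in> brick k r l u" for x
      using b[OF that] by (simp add: \<psi>_def)
  qed (use D in auto)
  also have "\<dots> \<le> 1" by (rule mass_le_1) simp
  finally show ?thesis
    using lu r by (simp add: emeasure_brick ennreal_le_1 flip: ennreal_mult)
qed

text \<open>Averaging over the reflection in \<open>k\<close> cancels the linear term of
  \<open>psi_cube\<close>, so the full average of \<open>ln f\<close> is at least \<open>A\<close>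
  on the whole cube, and mass at most 1 bounds \<open>A\<close>.\<close>

lemma A_le: "A \<le> \<Lambda>"
proof -
  note D = log_concave_densitiesD[OF projection_density]
  have cube: "\<bar>x $ i\<bar> \<le> r" if "x \<in> brick k r (- r) r" for x i
    using that by (cases "i = k") (auto simp: brick_def)
  have "ennreal (exp A) * emeasure lborel (brick k r (- r) r)
      \<le> (\<integral>\<^sup>+ x. ennreal (f x) * indicator (brick k r (- r) r) x \<partial>lborel)"
  proof (rule exp_flip_avg_le_nn_integral[where S = UNIV])
    show "flip B x \<in> brick k r (- r) r" if "x \<in> brick k r (- r) r" for B x
      using that by (auto simp: brick_def)
    show "0 < f x" if "x \<in> brick k r (- r) r" for x
      using cube[OF that] by (rule projection_pos_cube)
    show "A \<le> flip_avg UNIV (\<lambda>x. ln (f x)) x" if "x \<in> brick k r (- r) r" for x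
    proof -
      have "\<bar>flip {k} x $ i\<bar> \<le> r" for i using cube[OF that, of i] cube[OF that, of k] by auto
      from psi_cube[OF this] psi_cube[OF cube[OF that]] show ?thesis by (simp add: flip_avg_UNIV)
    qed
  qed (use D in auto)
  also have "\<dots> \<le> 1" by (rule mass_le_1) simp
  finally have "exp A * vol \<le> 1"
    using r by (simp add: emeasure_brick ennreal_le_1 vol_eq flip: ennreal_mult)
  then have "exp A \<le> exp \<Lambda>" using vol_pos by (simp add: exp_minus field_simps)
  then show ?thesis by simp
qed

text \<open>On the quarter of the cube at the end towards which the affine minorant of
  \<open>\<psi>\<close> rises, \<open>\<psi>\<close> is at least \<open>A\<close> plus half the
  tilt. That quarter has volume \<open>vol / 4\<close> and mass at most 1, whence
  \<open>ln 4\<close>. The use is a lower bound for \<open>\<psi> corner\<close>, the value on the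
  face towards the atom.\<close>

lemma quarter_bound: "\<bar>\<psi> corner - A\<bar> \<le> 2 * (\<Lambda> - A) + 2 * ln 4"
proof -
  have bound: "b \<le> \<Lambda> + ln 4" if "exp b * (r / 2 * (2 * r) ^ (CARD('d) - 1)) \<le> 1" for b
  proof -
    have "exp b \<le> exp (\<Lambda> + ln 4)"
      using that vol_pos unfolding exp_add exp_minus by (simp add: vol_eq field_simps)
    then show ?thesis by simp
  qed
  have "A + (\<psi> corner - A) / 2 \<le> \<Lambda> + ln 4" if "0 \<le> \<psi> corner - A"
  proof (rule bound)
    have "exp (A + (\<psi> corner - A) / 2) * ((r - r / 2) * (2 * r) ^ (CARD('d) - 1)) \<le> 1"
    proof (rule exp_mass_brick)
      fix x assume x: "x \<in> brick k r (r / 2) r"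
      have "A + (1 / 2) * (\<psi> corner - A) \<le> A + x $ k / r * (\<psi> corner - A)"
        using x r that by (intro add_left_mono mult_right_mono) (auto simp: brick_def field_simps)
      also have "\<dots> \<le> \<psi> x"
      proof (rule psi_cube)
        show "\<bar>x $ i\<bar> \<le> r" for i using x r by (cases "i = k") (auto simp: brick_def)
      qed
      finally show "A + (\<psi> corner - A) / 2 \<le> \<psi> x" by simp
    qed (use r in auto)
    then show "exp (A + (\<psi> corner - A) / 2) * (r / 2 * (2 * r) ^ (CARD('d) - 1)) \<le> 1" by simp
  qed
  moreover have "A - (\<psi> corner - A) / 2 \<le> \<Lambda> + ln 4" if "\<psi> corner - A \<le> 0"
  proof (rule bound)
    have "exp (A - (\<psi> corner - A) / 2) * ((- r / 2 - - r) * (2 * r) ^ (CARD('d) - 1)) \<le> 1"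
    proof (rule exp_mass_brick)
      fix x assume x: "x \<in> brick k r (- r) (- r / 2)"
      have "A + (- 1 / 2) * (\<psi> corner - A) \<le> A + x $ k / r * (\<psi> corner - A)"
        using x r that by (intro add_left_mono mult_right_mono_neg) (auto simp: brick_def field_simps)
      also have "\<dots> \<le> \<psi> x"
      proof (rule psi_cube)
        show "\<bar>x $ i\<bar> \<le> r" for i using x r by (cases "i = k") (auto simp: brick_def)
      qed
      finally show "A - (\<psi> corner - A) / 2 \<le> \<psi> x" by simp
    qed (use r in auto)
    then show "exp (A - (\<psi> corner - A) / 2) * (r / 2 * (2 * r) ^ (CARD('d) - 1)) \<le> 1" by simp
  qed
  ultimately show ?thesis
    by (cases "0 \<le> \<psi> corner - A") (simp_all add: abs_of_nonneg abs_of_nonpos field_simps)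
qed

section \<open>Likelihood comparison and mass off the cube\<close>

definition scale :: real where "scale = sqrt (a * M)"

lemma scale: "0 < scale" "scale \<le> 1" "scale\<^sup>2 = a * M"
  using a M aM by (auto simp: scale_def)

text \<open>The 1 is the price at the atom, \<open>a * M / scale = scale\<close>; the term
  \<open>1 / (2 * r)\<close> is the price of normalising, from
  \<open>ln (1 + scale / (2 * r)) \<le> scale / (2 * r)\<close>.\<close>

definition C1 :: real where "C1 = 1 + 1 / (2 * r)"

lemma C1_ge: "1 \<le> C1"
  using r by (simp add: C1_def)

text \<open>The competitor decays at the rate \<open>1 / scale\<close> that balances the mass it loses off the
  cube against the value it keeps at the atom.\<close>

lemma log_likelihood_ge: "\<Lambda> - C1 * scale \<le> (1 - a) * A + a * ln (f (axis k M))"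
proof -
  let ?n = "(2 * r) ^ (CARD('d) - 1)"
  define m where "m = (2 * r + 1 / (1 / scale)) * ?n"
  have n: "0 < ?n" using r by simp
  have m: "0 < m" unfolding m_def using n scale r by (intro mult_pos_pos) (auto intro: add_pos_pos)
  let ?g = "slab_tail k r (1 / scale) :: real ^ 'd \<Rightarrow> real"
  have g: "(\<lambda>x. (1 / m) * ?g x) \<in> log_concave_densities"
  proof (rule normalize_in_log_concave_densities[OF _ _ _ m])
    show "(\<integral>\<^sup>+ x. ennreal (?g x) \<partial>lborel) = ennreal m"
      unfolding m_def using scale r by (intro nn_integral_slab_tail) auto
  qed (use scale in \<open>auto intro: slab_tail_log_concave\<close>)
  have gA: "?g (flip B corner) = 1" for B
    using r by (auto simp: slab_tail_def)
  have gM: "?g (axis k M) = exp (- (1 / scale) * (M - r))"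
    using r M by (auto simp: slab_tail_def axis_def)
  have "(\<Sum>i\<in>UNIV. wt i * ln ((1 / m) * ?g (loc i))) \<le> (\<Sum>i\<in>UNIV. wt i * ln (f (loc i)))"
  proof (rule projection_maximal_real[OF g])
    show "0 < (1 / m) * ?g (loc i)" for i using m by (cases i) (auto simp: gA gM)
  qed
  also have "\<dots> = (1 - a) * A + a * ln (f (axis k M))"
    using sum_wt[of "\<lambda>x. ln (f x)"] by (simp add: A_def)
  also have "(\<Sum>i\<in>UNIV. wt i * ln ((1 / m) * ?g (loc i)))
      = a * ln ((1 / m) * ?g (axis k M)) + (1 - a) * flip_avg UNIV (\<lambda>x. ln ((1 / m) * ?g x)) corner"
    by (rule sum_wt)
  also have "flip_avg UNIV (\<lambda>x. ln ((1 / m) * ?g x)) corner = - ln m"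
    using m by (intro flip_avg_const_on) (simp add: gA ln_div)
  also have "ln ((1 / m) * ?g (axis k M)) = - ln m - (M - r) / scale"
    using m by (simp add: gM ln_mult ln_div)
  finally have le: "- ln m - a * ((M - r) / scale) \<le> (1 - a) * A + a * ln (f (axis k M))"
    by (simp add: algebra_simps)
  have "a * ((M - r) / scale) \<le> a * (M / scale)"
    using a r scale by (intro mult_left_mono divide_right_mono) auto
  also have "\<dots> = scale" using scale by (simp add: power2_eq_square field_simps)
  finally have s: "a * ((M - r) / scale) \<le> scale" .
  have "m = vol * (1 + scale / (2 * r))" unfolding m_def vol_eq using r by (simp add: field_simps)
  then have "ln m = ln vol + ln (1 + scale / (2 * r))"
    using vol_pos r scale by (simp add: ln_mult add_pos_pos[THEN less_imp_neq, symmetric])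
  also have "\<dots> \<le> ln vol + scale / (2 * r)"
    using r scale by (intro add_left_mono ln_add_one_self_le_self) auto
  finally have "ln m \<le> ln vol + scale / (2 * r)" .
  moreover have "C1 * scale = scale + scale / (2 * r)" by (simp add: C1_def algebra_simps)
  ultimately show ?thesis using le s by linarith
qed

lemma psi_atom: "\<psi> (axis k M) = ln (f (axis k M))"
  unfolding \<psi>_def
proof (rule flip_avg_const_on)
  fix B assume "B \<subseteq> S"
  then have "flip B (axis k M) = axis k M" by (auto simp: vec_eq_iff axis_def)
  then show "ln (f (flip B (axis k M))) = ln (f (axis k M))" by simp
qed

abbreviation tail_mass :: ennreal where
  "tail_mass \<equiv> \<integral>\<^sup>+ x. ennreal (f x) * indicator (- brick k r (- r) r) x \<partial>lborel"

text \<open>At fraction \<open>s\<close> of the way from the face to the atom, the cone over the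
  face has shrunk by \<open>1 - s \<ge> 1/2\<close>, so it contains a brick of half-width
  \<open>r / 2\<close> for \<open>s\<close> between \<open>t / 2\<close> and \<open>t\<close>.
  Concavity of \<open>\<psi>\<close> gives height \<open>b\<close> there, and the length is
  \<open>(M - r) * t / 2 \<ge> M * t / 4\<close>.\<close>

lemma tail_mass_ge:
  assumes t: "0 < t" "t \<le> 1 / 2"
    and b: "\<And>s. \<lbrakk>t / 2 \<le> s; s \<le> t\<rbrakk> \<Longrightarrow> b \<le> (1 - s) * \<psi> corner + s * ln (f (axis k M))"
  shows "ennreal (exp b * (M / 4 * t * r ^ (CARD('d) - 1))) \<le> tail_mass"
proof -
  note D = log_concave_densitiesD[OF projection_density]
  let ?l = "r + (M - r) * (t / 2)" and ?u = "r + (M - r) * t"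
  let ?Q = "brick k (r / 2) ?l ?u"
  have Mr: "M / 2 \<le> M - r" "0 < M - r" using M r by auto
  have key: "(\<forall>B\<subseteq>S. 0 < f (flip B x)) \<and> b \<le> \<psi> x" if x: "x \<in> ?Q" for x
  proof -
    define s where "s = (x $ k - r) / (M - r)"
    have s: "t / 2 \<le> s" "s \<le> t"
      using x Mr by (auto simp: brick_def s_def field_simps)
    have s1: "0 < s" "s \<le> 1 / 2" using s t by auto
    \<comment> \<open>The line from the atom through \<open>x\<close> meets the face of the cube at
      \<open>v\<close>.\<close>
    define v where "v = (\<chi> i. if i = k then r else x $ i / (1 - s))"
    have v: "\<bar>v $ i\<bar> \<le> r" for i
    proof (cases "i = k")
      case False
      then have "\<bar>x $ i\<bar> \<le> r * (1 / 2)" using x by (auto simp: brick_def)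
      also have "\<dots> \<le> r * (1 - s)" using s1 r by (intro mult_left_mono) auto
      finally show ?thesis using False s1 by (simp add: v_def abs_divide field_simps)
    qed (use r in \<open>simp add: v_def\<close>)
    have x_eq: "x = (1 - s) *\<^sub>R v + s *\<^sub>R axis k M"
    proof -
      have "s * (M - r) = x $ k - r" using Mr by (simp add: s_def)
      then have "x $ k = (1 - s) * r + s * M" by (simp add: algebra_simps)
      then show ?thesis using s1 by (auto simp: vec_eq_iff v_def axis_def)
    qed
    have pos_v: "0 < f (flip B v)" for B
    proof (rule projection_pos_cube)
      show "\<bar>flip B v $ i\<bar> \<le> r" for i using v[of i] by simp
    qed
    have pos_M: "0 < f (flip B (axis k M))" if "B \<subseteq> S" for B
    proof -
      have "flip B (axis k M) = axis k M" using that by (auto simp: vec_eq_iff axis_def)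
      then show ?thesis using projection_pos[of None] by simp
    qed
    have uv: "0 \<le> 1 - s" "0 \<le> s" "1 - s + s = 1" using s1 by auto
    have "v $ k = r" by (simp add: v_def)
    then have "\<psi> corner \<le> \<psi> v" using psi_cube[OF v] r by simp
    then have "b \<le> (1 - s) * \<psi> v + s * \<psi> (axis k M)"
      using b[OF s] mult_left_mono[of "\<psi> corner" "\<psi> v" "1 - s"] uv by (simp add: psi_atom)
    also have "\<dots> \<le> \<psi> x"
      unfolding x_eq \<psi>_def using pos_v pos_M uv by (intro flip_avg_concave(2)[OF D(2)]) auto
    finally have "b \<le> \<psi> x" .
    moreover have "0 < f (flip B x)" if "B \<subseteq> S" for B
      unfolding x_eq using that pos_v pos_M uv by (intro flip_avg_concave(1)[OF D(2)]) auto
    ultimately show ?thesis by blast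
  qed
  have "exp b * (M / 4 * t * r ^ (CARD('d) - 1)) \<le> exp b * ((?u - ?l) * (2 * (r / 2)) ^ (CARD('d) - 1))"
  proof -
    have "M / 4 * t \<le> (M - r) * (t / 2)"
      using mult_right_mono[OF Mr(1), of "t / 2"] t by simp
    then have "exp b * (M / 4 * t * r ^ (CARD('d) - 1)) \<le> exp b * ((M - r) * (t / 2) * r ^ (CARD('d) - 1))"
      using r by (intro mult_left_mono mult_right_mono) auto
    moreover have eq: "?u - ?l = (M - r) * (t / 2)" "2 * (r / 2) = r" by (simp_all add: field_simps)
    ultimately show ?thesis unfolding eq by simp
  qed
  then have "ennreal (exp b * (M / 4 * t * r ^ (CARD('d) - 1))) \<le> ennreal (exp b) * emeasure lborel ?Q"
    using r t Mr by (subst emeasure_brick) (auto intro!: ennreal_leI simp flip: ennreal_mult)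
  also have "\<dots> \<le> (\<integral>\<^sup>+ x. ennreal (f x) * indicator ?Q x \<partial>lborel)"
  proof (rule exp_flip_avg_le_nn_integral[where S = S])
    show "flip B x \<in> ?Q" if "B \<subseteq> S" "x \<in> ?Q" for B x
      using that by (intro flip_brick) auto
    show "0 < f x" if "x \<in> ?Q" for x
      using key[OF that] by (metis empty_subsetI flip_empty)
    show "b \<le> flip_avg S (\<lambda>x. ln (f x)) x" if "x \<in> ?Q" for x
      using key[OF that] by (simp add: \<psi>_def)
  qed (use D in auto)
  also have "\<dots> \<le> tail_mass"
  proof (rule nn_integral_mono)
    fix x
    have "0 < (M - r) * (t / 2)" using Mr t by simp
    then show "ennreal (f x) * indicator ?Q x \<le> ennreal (f x) * indicator (- brick k r (- r) r) x"
      by (auto simp: indicator_def brick_def)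
  qed
  finally show ?thesis .
qed

text \<open>\<open>quarter_bound\<close> gives \<open>\<psi> corner \<ge> \<Lambda> - 3 * (\<Lambda>
  - A) - 2 * ln 4\<close>, and the likelihood comparison gives
  \<open>\<Lambda> - A \<le> 2 * C1\<close>, up to a further term when the height at the atom
  exceeds \<open>\<Lambda>\<close>.\<close>

definition C2 :: real where "C2 = 6 * C1 + 2 * ln 4"

text \<open>Height times cross-section of the tail brick, with one unit of log-height given up on
  the way; the denominator comes from the length \<open>M * t / 4\<close> and
  \<open>M * t \<ge> scale / (2 + C1)\<close>.\<close>

definition tail_const :: real where
  "tail_const = exp (\<Lambda> - C2 - 1) * r ^ (CARD('d) - 1) / (4 * (2 + C1))"

lemma tail_const_pos: "0 < tail_const"
  using r C1_ge by (simp add: tail_const_def)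

text \<open>The comparison bounds the drop \<open>D\<close> from \<open>\<Lambda>\<close> to the
  atom by \<open>a * D \<le> C1 * scale\<close>. The symmetrised log-density stays above
  \<open>\<Lambda> - C2 - 1\<close> for a fraction \<open>1 / (2 + D)\<close> of the way, and since
  \<open>a * M = scale^2\<close> that stretch is at least of order \<open>scale\<close>. An atom
  higher than \<open>\<Lambda>\<close> may pull the cube down and is treated apart.\<close>

lemma tail_mass_lower_bound: "ennreal (tail_const * scale) \<le> tail_mass"
proof (cases "ln (f (axis k M)) \<le> \<Lambda>")
  case True
  define D where "D = \<Lambda> - ln (f (axis k M))"
  define \<delta> where "\<delta> = \<Lambda> - A"
  have nn: "0 \<le> D" "0 \<le> \<delta>" using True A_le by (auto simp: D_def \<delta>_def)
  have sum_le: "(1 - a) * \<delta> + a * D \<le> C1 * scale"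
    using log_likelihood_ge by (simp add: D_def \<delta>_def algebra_simps)
  have C1s: "C1 * scale \<le> C1" using scale C1_ge by (simp add: mult_left_le)
  have "(1 / 2) * \<delta> \<le> (1 - a) * \<delta>" using a nn by (intro mult_right_mono) auto
  moreover have "0 \<le> a * D" using a nn by simp
  ultimately have "\<delta> \<le> 2 * C1" using sum_le C1s by linarith
  then have corner: "\<Lambda> - C2 \<le> \<psi> corner"
    using quarter_bound by (simp add: C2_def \<delta>_def)
  have "0 \<le> (1 - a) * \<delta>" using a nn by simp
  then have "a * D \<le> C1 * scale" using sum_le by linarith
  then have aD: "a * (2 + D) \<le> (2 + C1) * scale"
  proof -
    have "a * a \<le> a * M" using a M by (intro mult_left_mono) auto
    then have "a \<le> scale" using a by (simp add: scale_def real_le_rsqrt power2_eq_square)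
    then show ?thesis using \<open>a * D \<le> C1 * scale\<close> by (simp add: algebra_simps)
  qed
  \<comment> \<open>A fraction of order \<open>1 / D\<close> loses at most one unit of log-height;
    the summand 2 keeps \<open>t \<le> 1/2\<close> when \<open>D\<close> is small.\<close>
  define t where "t = 1 / (2 + D)"
  have t: "0 < t" "t \<le> 1 / 2" "t * D \<le> 1" using nn by (auto simp: t_def field_simps)
  have "ennreal (exp (\<Lambda> - C2 - 1) * (M / 4 * t * r ^ (CARD('d) - 1))) \<le> tail_mass"
  proof (rule tail_mass_ge[OF t(1,2)])
    fix s assume s: "t / 2 \<le> s" "s \<le> t"
    have "s * D \<le> t * D" using s nn by (intro mult_right_mono) auto
    then have "s * D \<le> 1" using t by linarith
    moreover have "0 \<le> s * C2" using s t C1_ge by (intro mult_nonneg_nonneg) (auto simp: C2_def)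
    moreover have "(1 - s) * (\<Lambda> - C2) \<le> (1 - s) * \<psi> corner"
      using corner s t by (intro mult_left_mono) auto
    moreover have "(1 - s) * (\<Lambda> - C2) + s * (\<Lambda> - D) = \<Lambda> - C2 + s * C2 - s * D" by (simp add: algebra_simps)
    moreover have "ln (f (axis k M)) = \<Lambda> - D" by (simp add: D_def)
    ultimately show "\<Lambda> - C2 - 1 \<le> (1 - s) * \<psi> corner + s * ln (f (axis k M))" by simp
  qed
  moreover have "tail_const * scale \<le> exp (\<Lambda> - C2 - 1) * (M / 4 * t * r ^ (CARD('d) - 1))"
  proof -
    have "scale * (2 + D) * scale = M * (a * (2 + D))"
      using scale(3) by (simp add: power2_eq_square algebra_simps)
    also have "\<dots> \<le> M * ((2 + C1) * scale)" using aD M by (intro mult_left_mono) auto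
    finally have "scale * (2 + D) * scale \<le> M * (2 + C1) * scale" by (simp only: mult.assoc)
    then have "scale * (2 + D) \<le> M * (2 + C1)" by (rule mult_right_le_imp_le) (rule scale(1))
    then have "scale / (2 + C1) \<le> M * t" using nn C1_ge by (simp add: t_def field_simps)
    then have "exp (\<Lambda> - C2 - 1) * r ^ (CARD('d) - 1) / 4 * (scale / (2 + C1))
        \<le> exp (\<Lambda> - C2 - 1) * r ^ (CARD('d) - 1) / 4 * (M * t)"
      using r by (intro mult_left_mono) auto
    then show ?thesis by (simp add: tail_const_def field_simps)
  qed
  ultimately show ?thesis by (meson ennreal_leI order_trans)
next
  case False
  define z where "z = ln (f (axis k M)) - \<Lambda>"
  define \<delta> where "\<delta> = \<Lambda> - A"
  have nn: "0 \<le> z" "0 \<le> \<delta>" using False A_le by (auto simp: z_def \<delta>_def)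
  have sum_le: "(1 - a) * \<delta> \<le> C1 * scale + a * z"
    using log_likelihood_ge by (simp add: z_def \<delta>_def algebra_simps)
  have C1s: "C1 * scale \<le> C1" using scale C1_ge by (simp add: mult_left_le)
  have "(1 / 2) * \<delta> \<le> (1 - a) * \<delta>" using a nn by (intro mult_right_mono) auto
  \<comment> \<open>With 1/24 the excess \<open>z\<close> raises the bound on
    \<open>\<delta>\<close> by \<open>z / 12\<close> and lowers the one on
    \<open>\<psi> corner\<close> by \<open>z / 4\<close>. At fraction \<open>s \<ge> 1/4\<close>
    towards the atom the gain \<open>s * z\<close> outweighs \<open>(1 - s) * z / 4\<close>.\<close>
  moreover have "a * z \<le> 1 / 24 * z" using a nn by (intro mult_right_mono) auto
  ultimately have "\<delta> \<le> 2 * C1 + z / 12" using sum_le C1s by linarith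
  then have corner: "\<Lambda> - C2 - z / 4 \<le> \<psi> corner"
    using quarter_bound by (simp add: C2_def \<delta>_def)
  have "ennreal (exp (\<Lambda> - C2 - 1) * (M / 4 * (1 / 2) * r ^ (CARD('d) - 1))) \<le> tail_mass"
  proof (rule tail_mass_ge)
    fix s :: real assume s: "1 / 2 / 2 \<le> s" "s \<le> 1 / 2"
    have "0 \<le> s * C2" using s C1_ge by (intro mult_nonneg_nonneg) (auto simp: C2_def)
    moreover have "(1 - s) * (\<Lambda> - C2 - z / 4) \<le> (1 - s) * \<psi> corner"
      using corner s by (intro mult_left_mono) auto
    moreover have "(1 - s) * (\<Lambda> - C2 - z / 4) + s * (\<Lambda> + z) = \<Lambda> - C2 + s * C2 + (5 / 4 * s - 1 / 4) * z"
      by (simp add: field_simps)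
    moreover have "0 \<le> (5 / 4 * s - 1 / 4) * z" using s nn by (intro mult_nonneg_nonneg) auto
    moreover have "ln (f (axis k M)) = \<Lambda> + z" by (simp add: z_def)
    ultimately show "\<Lambda> - C2 - 1 \<le> (1 - s) * \<psi> corner + s * ln (f (axis k M))" by simp
  qed auto
  moreover have "tail_const * scale \<le> exp (\<Lambda> - C2 - 1) * (M / 4 * (1 / 2) * r ^ (CARD('d) - 1))"
  proof -
    have "scale / (2 + C1) \<le> 1 / 2" using scale C1_ge by (simp add: field_simps)
    also have "\<dots> \<le> M * (1 / 2)" using M by simp
    finally have "exp (\<Lambda> - C2 - 1) * r ^ (CARD('d) - 1) / 4 * (scale / (2 + C1))
        \<le> exp (\<Lambda> - C2 - 1) * r ^ (CARD('d) - 1) / 4 * (M * (1 / 2))"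
      using r by (intro mult_left_mono) auto
    then show ?thesis by (simp add: tail_const_def field_simps)
  qed
  ultimately show ?thesis by (meson ennreal_leI order_trans)
qed

section \<open>Risk and moments of the cube with its atom\<close>

text \<open>With probability at least \<open>(1 - a) ^ n \<ge> 1 - n * a\<close> the whole sample
  lies in the cube, and the loss is then at least \<open>tail_mass\<close>.\<close>

lemma risk_ge:
  assumes n: "1 \<le> n"
  shows "ennreal ((1 - real n * a) * (tail_const * scale)) \<le> projection_risk n P"
proof -
  interpret prob_space P by (rule prob_space_P)
  interpret product: product_prob_space "\<lambda>_. P" "{..<n}" ..
  let ?\<Pi> = "Pi\<^sub>M {..<n} (\<lambda>_. P)"
  let ?K = "brick k r (- r) r"
  have K: "?K \<in> sets P" by simp
  have K_convex: "convex ?K" by (simp add: brick_eq_cbox)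
  have "ennreal (1 - a) = ennreal (\<Sum>A\<in>(UNIV :: 'd set set). wt (Some A))"
    by (simp add: card_Pow flip: Pow_UNIV)
  also have "\<dots> = (\<Sum>A\<in>(UNIV :: 'd set set). ennreal (wt (Some A)))"
    using a by (subst sum_ennreal) auto
  also have "\<dots> = (\<Sum>A\<in>UNIV. ennreal (wt (Some A)) * indicator ?K (loc (Some A)))"
    using r by (intro sum.cong) (auto simp: brick_def indicator_def)
  also have "\<dots> \<le> emeasure P ?K"
    by (subst emeasure_P) (auto simp: sum_UNIV_option)
  finally have PK: "1 - a \<le> prob ?K" by (simp add: emeasure_eq_measure)
  have "1 - real n * a = 1 + real n * (- a)" by simp
  also have "\<dots> \<le> (1 + - a) ^ n" using a by (intro Bernoulli_inequality) auto
  also have "\<dots> \<le> prob ?K ^ n" using PK a by (intro power_mono) auto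
  finally have pow: "1 - real n * a \<le> prob ?K ^ n" .
  have "ennreal ((1 - real n * a) * (tail_const * scale)) \<le> ennreal (prob ?K ^ n * (tail_const * scale))"
    using pow tail_const_pos scale by (intro ennreal_leI mult_right_mono) auto
  also have "\<dots> = ennreal (tail_const * scale) * ennreal (prob ?K ^ n)"
    using tail_const_pos scale by (subst mult.commute, intro ennreal_mult) auto
  also have "\<dots> \<le> tail_mass * ennreal (prob ?K ^ n)"
    by (intro mult_right_mono tail_mass_lower_bound) auto
  also have "ennreal (prob ?K ^ n) = emeasure ?\<Pi> (PiE {..<n} (\<lambda>_. ?K))"
    using K by (subst product.emeasure_PiM) (auto simp: emeasure_eq_measure ennreal_power)
  also have "tail_mass * \<dots> = (\<integral>\<^sup>+ X. tail_mass * indicator (PiE {..<n} (\<lambda>_. ?K)) X \<partial>?\<Pi>)"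
    using K by (subst nn_integral_cmult_indicator) (auto intro!: sets_PiM_I_finite)
  also have "\<dots> \<le> projection_risk n P"
    unfolding projection_risk_def
  proof (rule nn_integral_mono)
    fix X
    show "tail_mass * indicator (PiE {..<n} (\<lambda>_. ?K)) X \<le> projection_loss P n X"
    proof (cases "X \<in> PiE {..<n} (\<lambda>_. ?K)")
      case True
      then show ?thesis
        using projection_loss_ge[OF projection_density n K_convex, of X] by (auto simp: PiE_iff)
    qed simp
  qed
  finally show ?thesis .
qed

lemma moment:
  assumes q: "1 \<le> q" and "a * M powr q \<le> 1 / 2" and corner: "norm corner \<le> 1 / 2"
  shows "(\<integral>\<^sup>+ x. ennreal (norm x powr q) \<partial>P) \<le> 1"
proof -
  have norm_flip: "norm (flip B corner) = norm corner" for B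
  proof -
    have "(flip B corner $ i)\<^sup>2 = (corner $ i)\<^sup>2" for i by simp
    then show ?thesis by (simp only: norm_vec_def L2_set_def real_norm_def power2_abs)
  qed
  have "norm corner powr q \<le> norm corner powr 1" using q corner by (intro powr_mono') auto
  then have "norm corner powr q \<le> 1 / 2" using corner by simp
  moreover have "flip_avg UNIV (\<lambda>x. norm x powr q) corner = norm corner powr q"
    by (rule flip_avg_const_on) (simp add: norm_flip)
  ultimately have "(1 - a) * flip_avg UNIV (\<lambda>x. norm x powr q) corner \<le> 1 * (1 / 2)"
    using a by (intro mult_mono) auto
  moreover have norm_axis_M: "norm (axis k M :: real ^ 'd) = \<bar>M\<bar>"
    by (simp add: norm_eq_sqrt_inner inner_axis_axis)
  moreover have "(\<integral>x. norm x powr q \<partial>P) = (\<Sum>i\<in>UNIV. wt i * norm (loc i) powr q)"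
    by (subst integral_P) auto
  ultimately have "(\<integral>x. norm x powr q \<partial>P) \<le> 1"
    using assms(2) M sum_wt[of "\<lambda>x. norm x powr q"] by (simp add: norm_axis_M)
  then show ?thesis
    by (subst nn_integral_eq_integral) (auto intro!: integrable_P simp: ennreal_le_1)
qed

end

lemma ex_cube_atom_member:
  fixes k :: "'d::finite" and q :: real
  assumes q: "1 < q" and n: "1 \<le> n"
  defines "r \<equiv> 1 / (2 * real CARD('d))"
  obtains P :: "(real ^ 'd) measure" where "P \<in> moment_nondegenerate"
    "(\<integral>\<^sup>+ x. ennreal (norm x powr q) \<partial>P) \<le> 1" "r / (2 * CARD('d)) \<le> min_abs_deviation P"
    "ennreal (cube_atom.tail_const k r / 10 * real n powr (- (1 / 2 - 1 / (2 * q)))) \<le> projection_risk n P"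
proof -
  \<comment> \<open>Together with the next choice \<open>a * M powr q\<close> is 1/24 for every
    \<open>q\<close>: the atom lies as far out as the moment constraint allows, up to
    constants.\<close>
  define M where "M = real n powr (1 / q)"
  \<comment> \<open>The 24 serves twice: it meets the smallness of \<open>a\<close> demanded by the
    locale, and \<open>n * a = 1/24\<close> leaves \<open>1 - n * a \<ge> 1/2\<close>.\<close>
  define a where "a = 1 / (24 * real n)"
  have d: "1 \<le> real CARD('d)" by (simp add: Suc_leI)
  have aM_eq: "a * M = real n powr (1 / q - 1) / 24"
    using n by (simp add: a_def M_def powr_diff)
  have "real n powr (1 / q - 1) \<le> real n powr 0" using n q by (intro powr_mono) auto
  then have aM1: "a * M \<le> 1" using aM_eq n by simp
  interpret cube_atom k r M a
  proof
    show "1 \<le> M" unfolding M_def using n q by (intro ge_one_powr_ge_zero) auto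
  qed (use d n aM1 in \<open>auto simp: r_def a_def field_simps\<close>)
  have aMq: "a * M powr q = 1 / 24"
    using n q by (simp add: a_def M_def powr_powr)
  have "norm corner \<le> (\<Sum>i\<in>(UNIV :: 'd set). \<bar>corner $ i\<bar>)" by (rule norm_le_l1_cart)
  also have "\<dots> = real CARD('d) * r" using r by simp
  also have "\<dots> = 1 / 2" by (simp add: r_def)
  finally have corner: "norm corner \<le> 1 / 2" .
  have "(real n powr (- (1 / 2 - 1 / (2 * q))))\<^sup>2 = real n powr (1 / q - 1)"
    by (simp add: power2_eq_square flip: powr_add)
  \<comment> \<open>\<open>a * M\<close> carries the factor 1/24, and 5 is a rational stand-in for
    its root; the factor 1/2 from the sampling event makes the final 10.\<close>
  then have sq: "(real n powr (- (1 / 2 - 1 / (2 * q))) / 5)\<^sup>2 \<le> a * M"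
    unfolding aM_eq by (simp add: power_divide)
  then have scale_ge: "real n powr (- (1 / 2 - 1 / (2 * q))) / 5 \<le> scale"
    unfolding scale_def by (rule real_le_rsqrt)
  have "ennreal (tail_const / 10 * real n powr (- (1 / 2 - 1 / (2 * q))))
      = ennreal (1 / 2 * (tail_const * (real n powr (- (1 / 2 - 1 / (2 * q))) / 5)))" by simp
  also have "\<dots> \<le> ennreal ((1 - real n * a) * (tail_const * scale))"
    using n scale_ge tail_const_pos by (intro ennreal_leI mult_mono mult_left_mono) (auto simp: a_def)
  also have "\<dots> \<le> projection_risk n P" by (rule risk_ge[OF n])
  finally have "ennreal (tail_const / 10 * real n powr (- (1 / 2 - 1 / (2 * q)))) \<le> projection_risk n P" .
  then show ?thesis
    using member_class moment[OF _ _ corner] q aMq by (intro that[of P]) auto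
qed

section \<open>Both rates with constants depending only on the dimension\<close>

theorem theorem6:
  shows "\<exists>\<epsilon> c :: real. \<epsilon> > 0 \<and> c > 0 \<and>
    (\<forall>(q::real) (n::nat). q > 1 \<longrightarrow> n \<ge> 1 \<longrightarrow>
      (SUP P \<in> {P :: (real ^ 'd) measure. P \<in> moment_nondegenerate \<and>
                  (\<integral>\<^sup>+ x. ennreal (norm x powr q) \<partial>P) \<le> 1 \<and>
                  min_abs_deviation P \<ge> \<epsilon>}.
         projection_risk n P)
      \<ge> ennreal (c * real n powr (- min (2 / (real CARD('d) + 1)) (1 / 2 - 1 / (2 * q)))))"
proof -
  let ?d = "real CARD('d)"
  define k :: 'd where "k = undefined"
  define r where "r = 1 / (2 * ?d)"
  have r: "0 < r" by (simp add: r_def)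
  define \<epsilon>1 where "\<epsilon>1 = measure lborel (cball (0 :: real ^ 'd) 1) / (12 * CARD('d) * 2 ^ CARD('d)) / 2"
  have \<epsilon>1: "0 < \<epsilon>1" using measure_unit_cball_pos[where 'd = 'd] by (simp add: \<epsilon>1_def)
  define \<epsilon> where "\<epsilon> = min \<epsilon>1 (r / (2 * ?d))"
  have \<epsilon>: "0 < \<epsilon>" using \<epsilon>1 r by (simp add: \<epsilon>_def)
  obtain c1 where c1: "0 < c1"
    "\<And>n. 1 \<le> n \<Longrightarrow> ennreal (c1 * real n powr (- (2 / (?d + 1)))) \<le> projection_risk n (ball_distr :: (real ^ 'd) measure)"
    using ball_distr_risk[where 'd = 'd] by blast
  \<comment> \<open>\<open>tail_const\<close> depends on \<open>k\<close> and \<open>r\<close> only,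
    so one admissible choice of \<open>M\<close> and \<open>a\<close> shows that it is positive
    before \<open>q\<close> and \<open>n\<close> are fixed.\<close>
  have "cube_atom r 1 (1 / 24)" using r by unfold_locales (auto simp: r_def field_simps Suc_leI)
  then have tc: "0 < cube_atom.tail_const k r" by (rule cube_atom.tail_const_pos)
  define c where "c = min c1 (cube_atom.tail_const k r / 10)"
  have c: "0 < c" using c1 tc by (simp add: c_def)
  interpret prob_space "ball_distr :: (real ^ 'd) measure" by (rule prob_space_ball_distr)
  have "(\<integral>\<^sup>+ x. ennreal (norm x) \<partial>(ball_distr :: (real ^ 'd) measure)) \<le> 1"
    using ball_distr_moment[of 1, where 'd = 'd] by simp
  then have "(\<integral>\<^sup>+ x. ennreal (norm x) \<partial>(ball_distr :: (real ^ 'd) measure)) < \<infinity>"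
    by (rule le_less_trans) simp
  then have ball: "(ball_distr :: (real ^ 'd) measure) \<in> moment_nondegenerate" "\<epsilon>1 \<le> min_abs_deviation (ball_distr :: (real ^ 'd) measure)"
    using moment_nondegenerateI[OF prob_space_ball_distr sets_ball_distr _ \<epsilon>1, where 'd = 'd] ball_distr_abs_deviation
    by (auto simp: \<epsilon>1_def)
  have "ennreal (c * real n powr (- min (2 / (?d + 1)) (1 / 2 - 1 / (2 * q))))
      \<le> (SUP P \<in> {P :: (real ^ 'd) measure. P \<in> moment_nondegenerate \<and>
          (\<integral>\<^sup>+ x. ennreal (norm x powr q) \<partial>P) \<le> 1 \<and> min_abs_deviation P \<ge> \<epsilon>}. projection_risk n P)"
    if q: "1 < q" and n: "1 \<le> n" for q :: real and n :: nat
  \<comment> \<open>The smaller exponent is the slower rate; it decides which distribution witnesses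
    the supremum.\<close>
  proof (cases "2 / (?d + 1) \<le> 1 / 2 - 1 / (2 * q)")
    case True
    have "ennreal (c * real n powr (- min (2 / (?d + 1)) (1 / 2 - 1 / (2 * q))))
        \<le> ennreal (c1 * real n powr (- (2 / (?d + 1))))"
      using True by (intro ennreal_leI) (simp add: c_def mult_right_mono)
    also note c1(2)[OF n]
    finally show ?thesis
      using ball ball_distr_moment[of q] q by (intro SUP_upper2[of ball_distr]) (auto simp: \<epsilon>_def)
  next
    case False
    obtain P :: "(real ^ 'd) measure" where P: "P \<in> moment_nondegenerate"
      "(\<integral>\<^sup>+ x. ennreal (norm x powr q) \<partial>P) \<le> 1" "r / (2 * CARD('d)) \<le> min_abs_deviation P"
      "ennreal (cube_atom.tail_const k r / 10 * real n powr (- (1 / 2 - 1 / (2 * q)))) \<le> projection_risk n P"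
      using ex_cube_atom_member[OF q n] unfolding r_def by blast
    have "ennreal (c * real n powr (- min (2 / (?d + 1)) (1 / 2 - 1 / (2 * q))))
        \<le> ennreal (cube_atom.tail_const k r / 10 * real n powr (- (1 / 2 - 1 / (2 * q))))"
    proof -
      have "min (2 / (?d + 1)) (1 / 2 - 1 / (2 * q)) = 1 / 2 - 1 / (2 * q)" using False by simp
      moreover have "c \<le> cube_atom.tail_const k r / 10" by (simp add: c_def)
      ultimately show ?thesis by (simp only:) (intro ennreal_leI mult_right_mono; simp)
    qed
    also note P(4)
    finally show ?thesis
      using P by (intro SUP_upper2[of P]) (auto simp: \<epsilon>_def)
  qed
  then show ?thesis using \<epsilon> c by blast
qed


end
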